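(* Let $A$ be a C*-algebra, let $G$ be a countable, discrete, residually finite group which admits a regular approximation $\sigma$ with $\operatorname{asdim}(\square_\sigma G)<\infty$, and let $(\alpha,w): G\curvearrowright A$ be a cocycle action. Then $\dim_{\mathrm{Rok}}(\alpha)<\infty$ if and only if $\dim_{\mathrm{am}}(\alpha)<\infty$.
   Context: **Regular approximations.** Let $G$ be a countable discrete group. A decreasing sequence $\sigma=(G_n)_n$ of finite-index subgroups of $G$ ($G_{n+1}\le G_n$) is a *regular approximation* of $G$ if it is semi-conjugacy-separating: for every $g\in G\setminus\{1\}$ there is $n$ with $G_n\cap g^G G_n=\varnothing$, where $g^G$ is the conjugacy class of $g$ (equivalently $\bigcap_n\bigcup_{k\in G}kG_nk^{-1}=\{1\}$). **Box space.** Fix a proper (balls are finite) right-invariant metric $d$ on $G$. On $G/G_n$ (left cosets) put the quotient metric $d_n(xG_n,yG_n)=\inf\{d(xh_1,yh_2): h_1,h_2\in G_n\}$. The box space $\square_\sigma G$ is the coarse disjoint union of the $(G/G_n,d_n)$: the set $\bigsqcup_n G/G_n$ with a metric $d^B$ restricting to $d_n$ on each $G/G_n$ and with $\operatorname{dist}_{d^B}(G/G_n,G/G_m)\to\infty$ as $n\neq m$, $n+m\to\infty$. Its coarse equivalence class does not depend on $d$, $d^B$. **Asymptotic dimension.** $\operatorname{asdim}(X)$ is the smallest $s\in\mathbb N$ (including $0$; $\infty$ if none) such that for every $R>0$ there is a uniformly bounded cover $\mathcal V=\mathcal V^{(0)}\cup\dots\cup\mathcal V^{(s)}$ of $X$ with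 Lebesgue number at least $R$ and each $\mathcal V^{(l)}$ consisting of pairwise disjoint sets. **Cocycle actions.** A cocycle action $(\alpha,w):G\curvearrowright A$ is a pair of maps $\alpha:G\to\operatorname{Aut}(A)$ and $w:G\times G\to\mathcal U(\mathcal M(A))$ with $\alpha_r\circ\alpha_s=\operatorname{Ad}(w(r,s))\circ\alpha_{rs}$ and $\alpha_r(w(s,t))w(r,st)=w(r,s)w(rs,t)$ for all $r,s,t\in G$ (one may assume $\alpha_1=\mathrm{id}$, $w(1,t)=w(t,1)=1$). **Relative central sequence algebras.** $A_\infty=\ell^\infty(\mathbb N,A)/c_0(\mathbb N,A)$, with $A\subset A_\infty$ as constant sequences. For a C*-subalgebra $D\subset A_\infty$, let $\operatorname{Ann}(D,A_\infty)=\{x\in A_\infty: xd=dx=0\ \forall d\in D\}$ and $F(D,A_\infty)=(A_\infty\cap D')/\operatorname{Ann}(D,A_\infty)$. It is unital if $D$ is separable. If $D\subset A$ is $\alpha$-invariant and closed under multiplication with all $w(g,h)$, applying $\alpha_g$ componentwise induces a genuine action $\tilde\alpha_\infty:G\curvearrowright F(D,A_\infty)$. **Rokhlin dimension.** For a finite-index subgroup $H\le G$, $\dim_{\mathrm{Rok}}(\alpha,H)$ is the smallest $d\in\mathbb N$ (including $0$; $\infty$ if none) such that for every separable, $\alpha$-invariant C*-subalgebra $D\subset A$ closed under multiplication with $\{w(g,h):g,h\in G\}$ there exist equivariant completely positive contractive order zero (i.e. orthogonality preserving) maps $\varphi_l:(C(G/H),G\text{-shift})\to(F(D,A_\infty),\tilde\alpha_\infty)$,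 $l=0,\dots,d$, with $\varphi_0(1)+\dots+\varphi_d(1)=1$. Here the $G$-shift is induced by left translation on $G/H$. The full Rokhlin dimension is $\dim_{\mathrm{Rok}}(\alpha)=\sup\{\dim_{\mathrm{Rok}}(\alpha,H): H\le G,\ [G:H]<\infty\}$. **Amenability dimension.** $\dim_{\mathrm{am}}(\alpha)$ is the smallest $d\in\mathbb N$ (including $0$; $\infty$ if none) such that for all $\varepsilon>0$ and finite sets $M\subset G$, $F\subset A$ there are finitely supported maps $\mu^{(l)}:G\to A_{1,+}$, $g\mapsto\mu^{(l)}_g$ (values in the positive contractions of $A$), $l=0,\dots,d$, with: (a) $\|(\sum_{l=0}^d\sum_{g\in G}\mu^{(l)}_g)a-a\|\le\varepsilon$ for all $a\in F$; (b) $\mu^{(l)}_g\mu^{(l)}_h=0$ for all $l$ and $g\ne h$; (c) $\|\sum_{h\in E}(\alpha_g(\mu^{(l)}_h)-\mu^{(l)}_{gh})a\|\le\varepsilon$ for all $a\in F$, all $l$, $g\in M$ and finite $E\subset G$; (d) $\|[\sum_{g\in E}\mu^{(l)}_g,a]\|\le\varepsilon$ for all $a\in F$, all $l$ and finite $E\subset G$. *)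

theory Defs
  imports
    "HOL-Analysis.Analysis"
    "HOL-Algebra.Left_Coset"
    "HOL-Algebra.Ring"
begin

section \<open>C*-algebras\<close>

class scaleC =
  fixes scaleC :: "complex \<Rightarrow> 'a \<Rightarrow> 'a" (infixr \<open>*\<^sub>C\<close> 75)

class adj =
  fixes adj :: "'a \<Rightarrow> 'a"

text \<open>Not assumed unital; the zero algebra is allowed.\<close>

class cstar_algebra = real_normed_algebra + banach + scaleC + adj +
  assumes scaleC_add_right: "c *\<^sub>C (x + y) = c *\<^sub>C x + c *\<^sub>C y"
    and scaleC_add_left: "(c + c') *\<^sub>C x = c *\<^sub>C x + c' *\<^sub>C x"
    and scaleC_scaleC: "c *\<^sub>C (c' *\<^sub>C x) = (c * c') *\<^sub>C x"
    and scaleR_scaleC: "r *\<^sub>R x = complex_of_real r *\<^sub>C x"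
    and mult_scaleC_left: "(c *\<^sub>C x) * y = c *\<^sub>C (x * y)"
    and mult_scaleC_right: "x * (c *\<^sub>C y) = c *\<^sub>C (x * y)"
    and norm_scaleC: "norm (c *\<^sub>C x) = cmod c * norm x"
    and adj_adj: "adj (adj x) = x"
    and adj_add: "adj (x + y) = adj x + adj y"
    and adj_scaleC: "adj (c *\<^sub>C x) = cnj c *\<^sub>C adj x"
    and adj_mult: "adj (x * y) = adj y * adj x"
    and cstar_identity: "norm (adj x * x) = (norm x)\<^sup>2"

context cstar_algebra
begin

lemma norm_adj: "norm (adj x) = norm x"
proof -
  have le: "norm y \<le> norm (adj y)" for y
  proof (cases "y = 0")
    case False
    have "norm y * norm y \<le> norm (adj y) * norm y"
      using norm_mult_ineq[of "adj y" y] cstar_identity[of y] by (simp add: power2_eq_square)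
    then show ?thesis using False by simp
  qed simp
  from le[of x] le[of "adj x"] show ?thesis by (simp add: adj_adj)
qed

lemma adj_zero: "adj 0 = 0"
  using norm_adj[of 0] by simp

lemma adj_minus: "adj (x - y) = adj x - adj y"
proof -
  have "adj x = adj (x - y) + adj y" by (simp flip: adj_add)
  then show ?thesis by simp
qed

lemma scaleC_zero: "c *\<^sub>C 0 = 0"
  using norm_scaleC[of c 0] by simp

lemma scaleC_diff_right: "c *\<^sub>C (x - y) = c *\<^sub>C x - c *\<^sub>C y"
proof -
  have "c *\<^sub>C x = c *\<^sub>C (x - y) + c *\<^sub>C y" by (simp flip: scaleC_add_right)
  then show ?thesis by simp
qed

end

lemma bounded_linear_adj: "bounded_linear (adj :: 'a::cstar_algebra \<Rightarrow> 'a)"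
proof (rule bounded_linear_intro[where K = 1])
  show "adj (r *\<^sub>R x) = r *\<^sub>R adj x" for r and x :: 'a
    by (simp add: scaleR_scaleC adj_scaleC)
qed (simp_all add: adj_add norm_adj)

lemma bounded_linear_scaleC: "bounded_linear (\<lambda>x :: 'a::cstar_algebra. c *\<^sub>C x)"
proof (rule bounded_linear_intro[where K = "cmod c"])
  show "c *\<^sub>C (r *\<^sub>R x) = r *\<^sub>R (c *\<^sub>C x)" for r and x :: 'a
    by (simp add: scaleR_scaleC scaleC_scaleC mult.commute)
qed (simp_all add: scaleC_add_right norm_scaleC mult.commute)

text \<open>\<^term>\<open>x = adj z * z\<close> characterises positivity in a C*-algebra.\<close>

definition positive_elem :: "'a::cstar_algebra \<Rightarrow> bool" where
  "positive_elem x \<longleftrightarrow> (\<exists>z. x = adj z * z)"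

definition positive_contraction :: "'a::cstar_algebra \<Rightarrow> bool" where
  "positive_contraction x \<longleftrightarrow> positive_elem x \<and> norm x \<le> 1"

definition cstar_subalgebra :: "'a::cstar_algebra set \<Rightarrow> bool" where
  "cstar_subalgebra D \<longleftrightarrow>
     closed D \<and> 0 \<in> D \<and>
     (\<forall>x\<in>D. \<forall>y\<in>D. x + y \<in> D \<and> x * y \<in> D) \<and>
     (\<forall>x\<in>D. adj x \<in> D \<and> (\<forall>c. c *\<^sub>C x \<in> D))"

definition clinear_map :: "('a::cstar_algebra \<Rightarrow> 'a) \<Rightarrow> bool" where
  "clinear_map f \<longleftrightarrow> (\<forall>x y. f (x + y) = f x + f y) \<and> (\<forall>c x. f (c *\<^sub>C x) = c *\<^sub>C f x)"

definition star_automorphism :: "('a::cstar_algebra \<Rightarrow> 'a) \<Rightarrow> bool" where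
  "star_automorphism f \<longleftrightarrow>
     bij f \<and> clinear_map f \<and> (\<forall>x y. f (x * y) = f x * f y) \<and> (\<forall>x. f (adj x) = adj (f x))"


section \<open>Multipliers\<close>

text \<open>
  The multiplier algebra is the algebra of double centralizers: \<open>(L, R)\<close> stands for the
  multiplier \<open>m\<close> with \<open>L x = m x\<close> and \<open>R x = x m\<close>.
\<close>

type_synonym 'a multiplier = "('a \<Rightarrow> 'a) \<times> ('a \<Rightarrow> 'a)"

abbreviation mult_left :: "'a multiplier \<Rightarrow> 'a \<Rightarrow> 'a" where
  "mult_left m \<equiv> fst m"

abbreviation mult_right :: "'a \<Rightarrow> 'a multiplier \<Rightarrow> 'a" where
  "mult_right x m \<equiv> snd m x"

definition multipliers :: "'a::cstar_algebra multiplier set" where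
  "multipliers = {(L, R).
     bounded_linear L \<and> bounded_linear R \<and> clinear_map L \<and> clinear_map R \<and>
     (\<forall>x y. L (x * y) = L x * y) \<and> (\<forall>x y. R (x * y) = x * R y) \<and> (\<forall>x y. R x * y = x * L y)}"

definition mlt_one :: "'a multiplier" where
  "mlt_one = (id, id)"

definition mlt_times :: "'a multiplier \<Rightarrow> 'a multiplier \<Rightarrow> 'a multiplier" where
  "mlt_times m m' = (\<lambda>x. mult_left m (mult_left m' x), \<lambda>x. mult_right (mult_right x m) m')"

definition mlt_adj :: "'a::cstar_algebra multiplier \<Rightarrow> 'a multiplier" where
  "mlt_adj m = (\<lambda>x. adj (mult_right (adj x) m), \<lambda>x. adj (mult_left m (adj x)))"

definition unitary_multipliers :: "'a::cstar_algebra multiplier set" where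
  "unitary_multipliers =
     {u \<in> multipliers. mlt_times (mlt_adj u) u = mlt_one \<and> mlt_times u (mlt_adj u) = mlt_one}"

definition Ad :: "'a::cstar_algebra multiplier \<Rightarrow> 'a \<Rightarrow> 'a" where
  "Ad u x = mult_right (mult_left u x) (mlt_adj u)"

text \<open>The unique extension of an automorphism of \<open>A\<close> to the multiplier algebra.\<close>

definition mlt_ext :: "('a \<Rightarrow> 'a) \<Rightarrow> 'a multiplier \<Rightarrow> 'a multiplier" where
  "mlt_ext f m = (\<lambda>x. f (mult_left m (inv_into UNIV f x)), \<lambda>x. f (mult_right (inv_into UNIV f x) m))"


section \<open>Cocycle actions\<close>

definition cocycle_action ::
    "('g, 'm) monoid_scheme \<Rightarrow> ('g \<Rightarrow> 'a::cstar_algebra \<Rightarrow> 'a) \<Rightarrow> ('g \<Rightarrow> 'g \<Rightarrow> 'a multiplier) \<Rightarrow> bool" where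
  "cocycle_action G \<alpha> w \<longleftrightarrow>
     (\<forall>r\<in>carrier G. star_automorphism (\<alpha> r)) \<and>
     (\<forall>r\<in>carrier G. \<forall>s\<in>carrier G. w r s \<in> unitary_multipliers) \<and>
     (\<forall>r\<in>carrier G. \<forall>s\<in>carrier G. \<alpha> r \<circ> \<alpha> s = Ad (w r s) \<circ> \<alpha> (r \<otimes>\<^bsub>G\<^esub> s)) \<and>
     (\<forall>r\<in>carrier G. \<forall>s\<in>carrier G. \<forall>t\<in>carrier G.
        mlt_times (mlt_ext (\<alpha> r) (w s t)) (w r (s \<otimes>\<^bsub>G\<^esub> t)) =
        mlt_times (w r s) (w (r \<otimes>\<^bsub>G\<^esub> s) t))"


section \<open>The sequence algebra\<close>

text \<open>
  For the discrete space \<^typ>\<open>nat\<close>, the type \<^typ>\<open>nat \<Rightarrow>\<^sub>C 'a\<close> is the algebra of all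
  bounded sequences.
\<close>

instance bcontfun :: (topological_space, complete_space) complete_space
proof
  fix f :: "nat \<Rightarrow> 'a \<Rightarrow>\<^sub>C 'b"
  assume f: "Cauchy f"
  have "\<forall>e>0. \<exists>N. \<forall>m n x. N \<le> m \<and> N \<le> n \<and> True \<longrightarrow> dist (f m x) (f n x) < e"
    using f unfolding Cauchy_def by (meson dist_fun_lt_imp_dist_val_lt)
  then obtain g where "\<forall>e>0. \<exists>N. \<forall>n x. N \<le> n \<and> True \<longrightarrow> dist (f n x) (g x) < e"
    unfolding uniformly_convergent_eq_cauchy[of "\<lambda>_. True" "\<lambda>n. apply_bcontfun (f n)", symmetric]
    by blast
  then have "uniform_limit UNIV (\<lambda>n. apply_bcontfun (f n)) g sequentially"
    unfolding uniform_limit_sequentially_iff by simp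
  from uniform_limit_bcontfunE[OF this sequentially_bot]
  show "convergent f" by (metis convergentI)
qed

lemma bcontfun_bounded_linear:
  "bounded_linear h \<Longrightarrow> f \<in> bcontfun \<Longrightarrow> (\<lambda>x. h (f x)) \<in> bcontfun"
  for f :: "'b::topological_space \<Rightarrow> 'a::real_normed_vector"
  unfolding bcontfun_def
  by (auto intro: bounded_linear.continuous_on)
     (metis bounded_linear_image image_image)

lemma bcontfun_mult:
  fixes f g :: "'b::topological_space \<Rightarrow> 'a::real_normed_algebra"
  assumes "f \<in> bcontfun" "g \<in> bcontfun"
  shows "(\<lambda>x. f x * g x) \<in> bcontfun"
proof -
  from assms obtain B C where *: "\<And>x. norm (f x) \<le> B" "\<And>x. norm (g x) \<le> C"
    unfolding bcontfun_def bounded_iff by auto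
  show ?thesis
  proof (rule bcontfun_normI)
    show "continuous_on UNIV (\<lambda>x. f x * g x)"
      using assms unfolding bcontfun_def by (auto intro!: continuous_intros)
    show "norm (f x * g x) \<le> B * C" for x
      by (rule order_trans[OF norm_mult_ineq])
         (meson * mult_mono norm_ge_zero order_trans)
  qed
qed

instantiation bcontfun :: (topological_space, cstar_algebra) cstar_algebra
begin

context includes bcontfun.lifting
begin

lift_definition times_bcontfun :: "('a \<Rightarrow>\<^sub>C 'b) \<Rightarrow> ('a \<Rightarrow>\<^sub>C 'b) \<Rightarrow> 'a \<Rightarrow>\<^sub>C 'b"
  is "\<lambda>f g x. f x * g x" by (rule bcontfun_mult)

lift_definition scaleC_bcontfun :: "complex \<Rightarrow> ('a \<Rightarrow>\<^sub>C 'b) \<Rightarrow> 'a \<Rightarrow>\<^sub>C 'b"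
  is "\<lambda>c f x. c *\<^sub>C f x" by (rule bcontfun_bounded_linear[OF bounded_linear_scaleC])

lift_definition adj_bcontfun :: "('a \<Rightarrow>\<^sub>C 'b) \<Rightarrow> 'a \<Rightarrow>\<^sub>C 'b"
  is "\<lambda>f x. adj (f x)" by (rule bcontfun_bounded_linear[OF bounded_linear_adj])

end

lemmas [simp] = times_bcontfun.rep_eq scaleC_bcontfun.rep_eq adj_bcontfun.rep_eq

instance
proof
  fix f g h :: "'a \<Rightarrow>\<^sub>C 'b" and c c' :: complex and r :: real
  show "f * g * h = f * (g * h)" "(f + g) * h = f * h + g * h" "f * (g + h) = f * g + f * h"
    by (rule bcontfun_eqI; simp add: algebra_simps)+
  show "(r *\<^sub>R f) * g = r *\<^sub>R (f * g)" "f * (r *\<^sub>R g) = r *\<^sub>R (f * g)"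
    by (rule bcontfun_eqI; simp)+
  show le: "norm (f * g) \<le> norm f * norm g" for f g :: "'a \<Rightarrow>\<^sub>C 'b"
  proof (rule norm_bound)
    fix x
    show "norm ((f * g) x) \<le> norm f * norm g"
      using norm_mult_ineq[of "f x" "g x"] norm_bounded[of f x] norm_bounded[of g x]
      by simp (meson mult_mono norm_ge_zero order_trans)
  qed
  show "c *\<^sub>C (f + g) = c *\<^sub>C f + c *\<^sub>C g" "(c + c') *\<^sub>C f = c *\<^sub>C f + c' *\<^sub>C f"
    "c *\<^sub>C (c' *\<^sub>C f) = (c * c') *\<^sub>C f" "r *\<^sub>R f = complex_of_real r *\<^sub>C f"
    "(c *\<^sub>C f) * g = c *\<^sub>C (f * g)" "f * (c *\<^sub>C g) = c *\<^sub>C (f * g)"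
    "adj (adj f) = f" "adj (f + g) = adj f + adj g" "adj (c *\<^sub>C f) = cnj c *\<^sub>C adj f"
    "adj (f * g) = adj g * adj f"
    by (rule bcontfun_eqI; simp add: scaleC_add_right scaleC_add_left scaleC_scaleC scaleR_scaleC
        mult_scaleC_left mult_scaleC_right adj_adj adj_add adj_scaleC adj_mult)+
  have sc: "norm (c *\<^sub>C f) \<le> cmod c * norm f" for c and f :: "'a \<Rightarrow>\<^sub>C 'b"
    by (rule norm_bound) (simp add: norm_scaleC mult_left_mono norm_bounded)
  show "norm (c *\<^sub>C f) = cmod c * norm f"
  proof (cases "c = 0")
    case True
    then show ?thesis using sc[of c f] by simp
  next
    case False
    have "inverse c *\<^sub>C (c *\<^sub>C f) = f"
      using False scaleR_scaleC[of 1, where 'a='b] by (intro bcontfun_eqI) (simp add: scaleC_scaleC)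
    with sc[of "inverse c" "c *\<^sub>C f"] have "norm f \<le> norm (c *\<^sub>C f) / cmod c"
      by (simp add: norm_inverse divide_inverse mult.commute)
    then have "cmod c * norm f \<le> norm (c *\<^sub>C f)"
      using False by (simp add: field_simps)
    with sc[of c f] show ?thesis by simp
  qed
  have na: "norm (adj f) \<le> norm f" for f :: "'a \<Rightarrow>\<^sub>C 'b"
    by (rule norm_bound) (simp add: norm_adj norm_bounded)
  show "norm (adj f * f) = (norm f)\<^sup>2"
  proof (rule antisym)
    show "norm (adj f * f) \<le> (norm f)\<^sup>2"
      using le[of "adj f" f] mult_right_mono[OF na[of f], of "norm f"]
      by (simp add: power2_eq_square)
    have "norm f \<le> sqrt (norm (adj f * f))"
    proof (rule norm_bound)
      fix x
      have "(norm (f x))\<^sup>2 \<le> norm (adj f * f)"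
        using norm_bounded[of "adj f * f" x] by (simp add: cstar_identity)
      then show "norm (f x) \<le> sqrt (norm (adj f * f))"
        by (rule real_le_rsqrt)
    qed
    then show "(norm f)\<^sup>2 \<le> norm (adj f * f)"
      by (metis norm_ge_zero power_mono real_sqrt_pow2)
  qed
qed

end

definition null_equiv :: "(nat \<Rightarrow>\<^sub>C 'a::cstar_algebra) \<Rightarrow> (nat \<Rightarrow>\<^sub>C 'a) \<Rightarrow> bool" where
  "null_equiv x y \<longleftrightarrow> (\<lambda>n. x n - y n) \<longlonglongrightarrow> 0"

lemma equivp_null_equiv: "equivp null_equiv"
proof (rule equivpI)
  show "reflp null_equiv" by (simp add: reflp_def null_equiv_def)
  show "symp null_equiv"
    using tendsto_minus by (force simp: symp_def null_equiv_def)
  show "transp null_equiv"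
    using tendsto_add by (force simp: transp_def null_equiv_def)
qed

quotient_type (overloaded) 'a seq_alg = "nat \<Rightarrow>\<^sub>C ('a::cstar_algebra)" / null_equiv
  morphisms rep_seq seq_class
  by (rule equivp_null_equiv)

lemma seq_class_exhaust:
  obtains u where "X = seq_class u"
  using Quotient3_abs_rep[OF Quotient3_seq_alg] by metis

lemma null_equiv_bounded_linear:
  fixes x y :: "nat \<Rightarrow>\<^sub>C 'a::cstar_algebra" and x' y' :: "nat \<Rightarrow>\<^sub>C 'b::cstar_algebra"
  assumes "bounded_linear h" "null_equiv x y" "\<And>n. x' n = h (x n)" "\<And>n. y' n = h (y n)"
  shows "null_equiv x' y'"
proof -
  have "(\<lambda>n. h (x n - y n)) \<longlonglongrightarrow> h 0"
    using assms(1,2) unfolding null_equiv_def by (rule bounded_linear.tendsto)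
  then show ?thesis
    using assms(1) unfolding null_equiv_def assms(3,4)
    by (simp add: bounded_linear.linear linear_diff linear_0)
qed

lemma null_equiv_mult:
  fixes x x' y y' :: "nat \<Rightarrow>\<^sub>C 'a::cstar_algebra"
  assumes "null_equiv x x'" "null_equiv y y'"
  shows "null_equiv (x * y) (x' * y')"
proof -
  have b: "Bseq (apply_bcontfun z)" for z :: "nat \<Rightarrow>\<^sub>C 'a"
    by (rule BseqI'[where K = "norm z"]) (rule norm_bounded)
  have "(\<lambda>n. (x n - x' n) * y n) \<longlonglongrightarrow> 0" "(\<lambda>n. x' n * (y n - y' n)) \<longlonglongrightarrow> 0"
    using assms b unfolding null_equiv_def by (auto simp: tendsto_Zfun_iff bounded_bilinear.Zfun_prod_Bfun[OF bounded_bilinear_mult] bounded_bilinear.Bfun_prod_Zfun[OF bounded_bilinear_mult])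
  from tendsto_add[OF this] show ?thesis
    unfolding null_equiv_def by (simp add: algebra_simps)
qed


instantiation seq_alg :: (cstar_algebra) "{real_vector, scaleC, adj, times}"
begin

lift_definition zero_seq_alg :: "'a seq_alg" is 0 .

lift_definition plus_seq_alg :: "'a seq_alg \<Rightarrow> 'a seq_alg \<Rightarrow> 'a seq_alg" is "(+)"
  using tendsto_add by (force simp: null_equiv_def add_diff_add)

lift_definition uminus_seq_alg :: "'a seq_alg \<Rightarrow> 'a seq_alg" is uminus
  by (rule null_equiv_bounded_linear[OF bounded_linear_minus[OF bounded_linear_ident]]) auto

lift_definition minus_seq_alg :: "'a seq_alg \<Rightarrow> 'a seq_alg \<Rightarrow> 'a seq_alg" is "(-)"
proof -
  fix x x' y y' :: "nat \<Rightarrow>\<^sub>C 'a"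
  assume "null_equiv x x'" "null_equiv y y'"
  then have "(\<lambda>n. (x n - x' n) - (y n - y' n)) \<longlonglongrightarrow> 0 - 0"
    unfolding null_equiv_def by (rule tendsto_diff)
  then show "null_equiv (x - y) (x' - y')"
    unfolding null_equiv_def by (simp add: algebra_simps)
qed

lift_definition scaleR_seq_alg :: "real \<Rightarrow> 'a seq_alg \<Rightarrow> 'a seq_alg" is scaleR
  by (rule null_equiv_bounded_linear[OF bounded_linear_scaleR_right]) auto

lift_definition scaleC_seq_alg :: "complex \<Rightarrow> 'a seq_alg \<Rightarrow> 'a seq_alg" is scaleC
  by (rule null_equiv_bounded_linear[OF bounded_linear_scaleC]) auto

lift_definition adj_seq_alg :: "'a seq_alg \<Rightarrow> 'a seq_alg" is adj
  by (rule null_equiv_bounded_linear[OF bounded_linear_adj]) auto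

lift_definition times_seq_alg :: "'a seq_alg \<Rightarrow> 'a seq_alg \<Rightarrow> 'a seq_alg" is "(*)"
  by (rule null_equiv_mult)

instance
proof
  fix x y z :: "'a seq_alg"
  have r: "null_equiv u u" for u :: "nat \<Rightarrow>\<^sub>C 'a"
    using equivp_null_equiv by (rule equivp_reflp)
  show "x + y + z = x + (y + z)" "x + y = y + x" "0 + x = x" "- x + x = 0" "x - y = x + - y"
    by (transfer; simp add: algebra_simps r)+
  fix a b :: real
  show "a *\<^sub>R (x + y) = a *\<^sub>R x + a *\<^sub>R y" "(a + b) *\<^sub>R x = a *\<^sub>R x + b *\<^sub>R x"
    "a *\<^sub>R b *\<^sub>R x = (a * b) *\<^sub>R x" "1 *\<^sub>R x = x"
    by (transfer; simp add: algebra_simps r)+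
qed

end

lift_definition seq_norm :: "'a::cstar_algebra seq_alg \<Rightarrow> real" is "\<lambda>x. Inf {norm y |y. null_equiv x y}"
proof -
  fix x x' :: "nat \<Rightarrow>\<^sub>C 'a"
  assume "null_equiv x x'"
  then have "null_equiv x = null_equiv x'"
    using equivp_null_equiv unfolding equivp_def by blast
  then show "Inf {norm y |y. null_equiv x y} = Inf {norm y |y. null_equiv x' y}"
    by simp
qed

lemma seq_norm_class_less_iff:
  fixes x :: "nat \<Rightarrow>\<^sub>C 'a::cstar_algebra"
  shows "seq_norm (seq_class x) < r \<longleftrightarrow> (\<exists>s<r. \<forall>\<^sub>F n in sequentially. norm (x n) \<le> s)"
proof -
  have N: "seq_norm (seq_class x) = Inf {norm y |y. null_equiv x y}"
    by (rule seq_norm.abs_eq)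
  have ne: "{norm y |y. null_equiv x y} \<noteq> {}"
    using equivp_reflp[OF equivp_null_equiv] by blast
  have bd: "bdd_below {norm y |y. null_equiv x y}"
    by (rule bdd_belowI[of _ 0]) auto
  show ?thesis
  proof
    assume "seq_norm (seq_class x) < r"
    then obtain y where y: "null_equiv x y" "norm y < r"
      unfolding N using cInf_lessD[OF ne] by blast
    define s where "s = (norm y + r) / 2"
    have s: "s < r" "s - norm y > 0" using y by (auto simp: s_def)
    have "\<forall>\<^sub>F n in sequentially. norm (x n - y n) < s - norm y"
      using y(1) s(2) unfolding null_equiv_def tendsto_iff by (simp add: dist_norm)
    then have "\<forall>\<^sub>F n in sequentially. norm (x n) \<le> s"
    proof eventually_elim
      case (elim n)
      then show ?case
        using norm_triangle_sub[of "x n" "y n"] norm_bounded[of y n] by linarith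
    qed
    with s(1) show "\<exists>s<r. \<forall>\<^sub>F n in sequentially. norm (x n) \<le> s" by blast
  next
    assume "\<exists>s<r. \<forall>\<^sub>F n in sequentially. norm (x n) \<le> s"
    then obtain s M where s: "s < r" "\<And>n. n \<ge> M \<Longrightarrow> norm (x n) \<le> s"
      unfolding eventually_sequentially by blast
    have s0: "0 \<le> s" using s(2)[of M] norm_ge_zero order_trans by blast
    define f where "f n = (if n \<ge> M then x n else 0)" for n
    have f: "norm (f n) \<le> s" for n using s s0 by (simp add: f_def)
    have "f \<in> bcontfun" by (rule bcontfun_normI[OF _ f]) simp
    then obtain y where y: "f = apply_bcontfun y" by (rule bcontfunE)
    have "norm y \<le> s" by (rule norm_bound) (use f y in metis)
    moreover have "null_equiv x y"
      unfolding null_equiv_def y[symmetric]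
      by (rule tendsto_eventually) (auto simp: eventually_sequentially f_def)
    ultimately show "seq_norm (seq_class x) < r"
      unfolding N using cInf_lower[OF _ bd, of "norm y"] s(1) by (force intro: le_less_trans)
  qed
qed

lemma seq_norm_class_le_iff:
  fixes x :: "nat \<Rightarrow>\<^sub>C 'a::cstar_algebra"
  shows "seq_norm (seq_class x) \<le> r \<longleftrightarrow> (\<forall>s>r. \<forall>\<^sub>F n in sequentially. norm (x n) \<le> s)"
proof
  assume *: "seq_norm (seq_class x) \<le> r"
  show "\<forall>s>r. \<forall>\<^sub>F n in sequentially. norm (x n) \<le> s"
  proof (intro allI impI)
    fix s assume "r < s"
    with * have "seq_norm (seq_class x) < s" by simp
    then obtain t where "t < s" "\<forall>\<^sub>F n in sequentially. norm (x n) \<le> t"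
      unfolding seq_norm_class_less_iff by blast
    then show "\<forall>\<^sub>F n in sequentially. norm (x n) \<le> s"
      by (auto elim: eventually_mono)
  qed
next
  assume *: "\<forall>s>r. \<forall>\<^sub>F n in sequentially. norm (x n) \<le> s"
  show "seq_norm (seq_class x) \<le> r"
  proof (rule dense_ge)
    fix s assume "r < s"
    then obtain t where "r < t" "t < s" using dense by blast
    then have "seq_norm (seq_class x) < s" using * seq_norm_class_less_iff by blast
    then show "seq_norm (seq_class x) \<le> s" by simp
  qed
qed

lemma seq_norm_class_le: "seq_norm (seq_class x) \<le> norm x"
  unfolding seq_norm_class_le_iff
  by (intro allI impI always_eventually) (meson norm_bounded order.trans less_imp_le)

lemma seq_norm_class_ge_zero: "0 \<le> seq_norm (seq_class x)"
proof (rule ccontr)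
  assume "\<not> ?thesis"
  then obtain s where "s < 0" "\<forall>\<^sub>F n in sequentially. norm (x n) \<le> s"
    using seq_norm_class_less_iff[of x 0] by auto
  then obtain n where "norm (x n) \<le> s" by (meson eventually_sequentially order_refl)
  with \<open>s < 0\<close> show False by (meson norm_ge_zero not_less order_trans)
qed

lemma seq_class_bounded_linear_norm:
  fixes x y :: "nat \<Rightarrow>\<^sub>C 'a::cstar_algebra"
  assumes "\<And>n. norm (y n) = k * norm (x n)" "0 \<le> k"
  shows "seq_norm (seq_class y) = k * seq_norm (seq_class x)"
proof (cases "k = 0")
  case True
  with assms show ?thesis
    using seq_norm_class_le_iff[of y 0] seq_norm_class_ge_zero[of y] by auto
next
  case False
  with assms(2) have k: "0 < k" by simp
  have "seq_norm (seq_class y) < r \<longleftrightarrow> k * seq_norm (seq_class x) < r" for r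
  proof -
    have "k * seq_norm (seq_class x) < r \<longleftrightarrow> seq_norm (seq_class x) < r / k"
      using k by (simp add: field_simps)
    also have "\<dots> \<longleftrightarrow> (\<exists>s<r / k. \<forall>\<^sub>F n in sequentially. norm (x n) \<le> s)"
      by (rule seq_norm_class_less_iff)
    also have "\<dots> \<longleftrightarrow> (\<exists>s<r. \<forall>\<^sub>F n in sequentially. norm (y n) \<le> s)"
    proof safe
      fix s assume "s < r / k" "\<forall>\<^sub>F n in sequentially. norm (x n) \<le> s"
      then show "\<exists>s<r. \<forall>\<^sub>F n in sequentially. norm (y n) \<le> s"
        using k by (intro exI[of _ "k * s"]) (auto simp: assms(1) field_simps)
    next
      fix s assume "s < r" "\<forall>\<^sub>F n in sequentially. norm (y n) \<le> s"
      then show "\<exists>s<r / k. \<forall>\<^sub>F n in sequentially. norm (x n) \<le> s"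
        using k by (intro exI[of _ "s / k"]) (auto simp: assms(1) field_simps)
    qed
    finally show ?thesis by (simp add: seq_norm_class_less_iff)
  qed
  then show ?thesis by (meson less_irrefl linorder_neqE_linordered_idom)
qed

instantiation seq_alg :: (cstar_algebra) real_normed_vector
begin

definition norm_seq_alg :: "'a seq_alg \<Rightarrow> real" where
  "norm_seq_alg = seq_norm"

definition dist_seq_alg :: "'a seq_alg \<Rightarrow> 'a seq_alg \<Rightarrow> real" where
  "dist_seq_alg x y = seq_norm (x - y)"

definition sgn_seq_alg :: "'a seq_alg \<Rightarrow> 'a seq_alg" where
  "sgn_seq_alg x = x /\<^sub>R seq_norm x"

definition uniformity_seq_alg :: "('a seq_alg \<times> 'a seq_alg) filter" where
  "uniformity_seq_alg = (INF e\<in>{0 <..}. principal {(x, y). dist x y < e})"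

definition open_seq_alg :: "'a seq_alg set \<Rightarrow> bool" where
  "open_seq_alg S = (\<forall>x\<in>S. \<forall>\<^sub>F (x', y) in uniformity. x' = x \<longrightarrow> y \<in> S)"

instance
proof
  fix x y z :: "'a seq_alg" and a b :: real
  show "norm x = 0 \<longleftrightarrow> x = 0"
  proof -
    obtain u where u: "x = seq_class u" by (rule seq_class_exhaust)
    have "norm x = 0 \<longleftrightarrow> seq_norm (seq_class u) \<le> 0"
      using seq_norm_class_ge_zero[of u] u by (auto simp: norm_seq_alg_def)
    also have "\<dots> \<longleftrightarrow> u \<longlonglongrightarrow> 0"
      unfolding seq_norm_class_le_iff tendsto_iff dist_norm
    proof safe
      fix s :: real assume *: "\<forall>e>0. \<forall>\<^sub>F n in sequentially. norm (u n - 0) < e" "0 < s"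
      then show "\<forall>\<^sub>F n in sequentially. norm (u n) \<le> s"
        by (auto elim: eventually_mono dest!: spec[of _ s])
    next
      fix e :: real assume *: "\<forall>s>0. \<forall>\<^sub>F n in sequentially. norm (u n) \<le> s" "0 < e"
      then have "\<forall>\<^sub>F n in sequentially. norm (u n) \<le> e / 2" using half_gt_zero[OF *(2)] by blast
      then show "\<forall>\<^sub>F n in sequentially. norm (u n - 0) < e"
        using \<open>0 < e\<close> by (auto elim!: eventually_mono)
    qed
    also have "\<dots> \<longleftrightarrow> x = 0"
      unfolding u zero_seq_alg_def seq_alg.abs_eq_iff null_equiv_def by simp
    finally show ?thesis .
  qed
  show "norm (x + y) \<le> norm x + norm y"
  proof -
    obtain u v where uv: "x = seq_class u" "y = seq_class v" by (metis seq_class_exhaust)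
    have "seq_norm (seq_class (u + v)) \<le> seq_norm (seq_class u) + seq_norm (seq_class v)"
      unfolding seq_norm_class_le_iff
    proof (intro allI impI)
      fix s assume s: "seq_norm (seq_class u) + seq_norm (seq_class v) < s"
      define e where "e = (s - (seq_norm (seq_class u) + seq_norm (seq_class v))) / 2"
      have "e > 0" using s by (simp add: e_def)
      then have "\<forall>\<^sub>F n in sequentially. norm (u n) \<le> seq_norm (seq_class u) + e"
        "\<forall>\<^sub>F n in sequentially. norm (v n) \<le> seq_norm (seq_class v) + e"
        using seq_norm_class_le_iff[of u "seq_norm (seq_class u)"] seq_norm_class_le_iff[of v "seq_norm (seq_class v)"]
        by auto
      then show "\<forall>\<^sub>F n in sequentially. norm ((u + v) n) \<le> s"
      proof eventually_elim
        case (elim n)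
        have "norm ((u + v) n) \<le> norm (u n) + norm (v n)"
          by (simp add: norm_triangle_ineq)
        with elim show ?case unfolding e_def by argo
      qed
    qed
    then show ?thesis by (simp add: uv plus_seq_alg.abs_eq norm_seq_alg_def)
  qed
  show "norm (a *\<^sub>R x) = \<bar>a\<bar> * norm x"
  proof -
    obtain u where u: "x = seq_class u" by (rule seq_class_exhaust)
    show ?thesis unfolding u scaleR_seq_alg.abs_eq norm_seq_alg_def
      by (rule seq_class_bounded_linear_norm) auto
  qed
qed (simp_all add: norm_seq_alg_def dist_seq_alg_def sgn_seq_alg_def uniformity_seq_alg_def open_seq_alg_def)

end

lemmas norm_seq_less_iff = seq_norm_class_less_iff[folded norm_seq_alg_def]
  and norm_seq_le_iff = seq_norm_class_le_iff[folded norm_seq_alg_def]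
  and norm_seq_scaled = seq_class_bounded_linear_norm[folded norm_seq_alg_def]

lemma bounded_linear_seq_class:
  "bounded_linear (seq_class :: (nat \<Rightarrow>\<^sub>C 'a::cstar_algebra) \<Rightarrow> 'a seq_alg)"
  by (rule bounded_linear_intro[where K = 1])
     (simp_all add: plus_seq_alg.abs_eq scaleR_seq_alg.abs_eq norm_seq_alg_def seq_norm_class_le)

lemma seq_class_lift:
  fixes X :: "'a::cstar_algebra seq_alg"
  assumes "norm X < r"
  obtains x where "X = seq_class x" "norm x < r"
proof -
  obtain u where u: "X = seq_class u" by (rule seq_class_exhaust)
  have ne: "{norm y |y. null_equiv u y} \<noteq> {}"
    using equivp_reflp[OF equivp_null_equiv] by blast
  obtain y where "null_equiv u y" "norm y < r"
    using cInf_lessD[OF ne, of r] assms unfolding u norm_seq_alg_def seq_norm.abs_eq by blast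
  with that[of y] show thesis unfolding u seq_alg.abs_eq_iff by simp
qed

instance seq_alg :: (cstar_algebra) banach
proof
  fix X :: "nat \<Rightarrow> 'a seq_alg"
  assume X: "Cauchy X"
  have "\<exists>N. \<forall>m\<ge>N. \<forall>n\<ge>N. norm (X m - X n) < (1/2) ^ k" for k
    using CauchyD[OF X, of "(1/2)^k"] by simp
  then obtain N where N: "\<And>k m n. m \<ge> N k \<Longrightarrow> n \<ge> N k \<Longrightarrow> norm (X m - X n) < (1/2) ^ k"
    by metis
  define K where "K k = (\<Sum>i\<le>k. N i) + k" for k
  have K: "K k \<ge> N k" "K k \<ge> k" "K (Suc k) > K k" for k
    unfolding K_def by (auto intro: member_le_sum trans_le_add1)
  have "\<exists>y. X (K (Suc k)) - X (K k) = seq_class y \<and> norm y < (1/2) ^ k" for k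
    using seq_class_lift[OF N[of k "K (Suc k)" "K k"]] K[of k] by (metis less_imp_le order_trans)
  then obtain y where y: "\<And>k. X (K (Suc k)) - X (K k) = seq_class (y k)" "\<And>k. norm (y k) < (1/2) ^ k"
    by metis
  have "summable y"
    by (rule summable_comparison_test'[where N = 0, OF summable_geometric[of "1/2 :: real"]])
       (use y(2) less_imp_le in auto)
  then have "(\<lambda>n. \<Sum>k<n. y k) \<longlonglongrightarrow> suminf y" by (rule summable_LIMSEQ)
  from bounded_linear.tendsto[OF bounded_linear_seq_class this]
  have "(\<lambda>n. \<Sum>k<n. X (K (Suc k)) - X (K k)) \<longlonglongrightarrow> seq_class (suminf y)"
    by (simp add: linear_sum[OF bounded_linear.linear[OF bounded_linear_seq_class]] y(1))
  then have "(\<lambda>n. X (K n) - X (K 0)) \<longlonglongrightarrow> seq_class (suminf y)"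
    using sum_lessThan_telescope[of "\<lambda>k. X (K k)"] by simp
  from tendsto_add[OF this tendsto_const[of "X (K 0)"]]
  have *: "(X \<circ> K) \<longlonglongrightarrow> seq_class (suminf y) + X (K 0)"
    by (simp add: o_def)
  have "strict_mono K" using K(3) by (simp add: strict_mono_Suc_iff)
  from Cauchy_converges_subseq[OF X this *] show "convergent X"
    by (rule convergentI)
qed

instance seq_alg :: (cstar_algebra) cstar_algebra
proof
  have r: "null_equiv u u" for u :: "nat \<Rightarrow>\<^sub>C 'a"
    using equivp_null_equiv by (rule equivp_reflp)
  fix x y z :: "'a seq_alg" and c c' :: complex and a :: real
  show "x * y * z = x * (y * z)" "(x + y) * z = x * z + y * z" "x * (y + z) = x * y + x * z"
    "(a *\<^sub>R x) * y = a *\<^sub>R (x * y)" "x * (a *\<^sub>R y) = a *\<^sub>R (x * y)"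
    "c *\<^sub>C (x + y) = c *\<^sub>C x + c *\<^sub>C y" "(c + c') *\<^sub>C x = c *\<^sub>C x + c' *\<^sub>C x"
    "c *\<^sub>C (c' *\<^sub>C x) = (c * c') *\<^sub>C x" "a *\<^sub>R x = complex_of_real a *\<^sub>C x"
    "(c *\<^sub>C x) * y = c *\<^sub>C (x * y)" "x * (c *\<^sub>C y) = c *\<^sub>C (x * y)"
    "adj (adj x) = x" "adj (x + y) = adj x + adj y" "adj (c *\<^sub>C x) = cnj c *\<^sub>C adj x"
    "adj (x * y) = adj y * adj x"
    by (transfer; simp add: r algebra_simps scaleC_add_right scaleC_add_left scaleC_scaleC scaleR_scaleC
        mult_scaleC_left mult_scaleC_right adj_adj adj_add adj_scaleC adj_mult)+
  show mult: "norm (x * y) \<le> norm x * norm y" for x y :: "'a seq_alg"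
  proof (rule LIMSEQ_le_const)
    show "(\<lambda>n. (norm x + inverse (real (Suc n))) * (norm y + inverse (real (Suc n)))) \<longlonglongrightarrow> norm x * norm y"
      using tendsto_mult[OF tendsto_add[OF tendsto_const[of "norm x"] LIMSEQ_inverse_real_of_nat]
          tendsto_add[OF tendsto_const[of "norm y"] LIMSEQ_inverse_real_of_nat]] by simp
    show "\<exists>N. \<forall>n\<ge>N. norm (x * y) \<le> (norm x + inverse (real (Suc n))) * (norm y + inverse (real (Suc n)))"
    proof (intro exI allI impI)
      fix n
      have p: "inverse (real (Suc n)) > 0" by simp
      obtain u where u: "x = seq_class u" "norm u < norm x + inverse (real (Suc n))"
        by (rule seq_class_lift[of x "norm x + inverse (real (Suc n))"]) (use p in auto)
      obtain v where v: "y = seq_class v" "norm v < norm y + inverse (real (Suc n))"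
        by (rule seq_class_lift[of y "norm y + inverse (real (Suc n))"]) (use p in auto)
      have "norm (x * y) \<le> norm (u * v)"
        unfolding u(1) v(1) times_seq_alg.abs_eq norm_seq_alg_def by (rule seq_norm_class_le)
      also have "\<dots> \<le> norm u * norm v" by (rule norm_mult_ineq)
      also have "\<dots> \<le> (norm x + inverse (real (Suc n))) * (norm y + inverse (real (Suc n)))"
        using u(2) v(2) by (intro mult_mono) (auto intro: less_imp_le order_trans[OF norm_ge_zero])
      finally show "norm (x * y) \<le> (norm x + inverse (real (Suc n))) * (norm y + inverse (real (Suc n)))" .
    qed
  qed
  obtain u where u: "x = seq_class u" by (rule seq_class_exhaust)
  show "norm (c *\<^sub>C x) = cmod c * norm x"
    unfolding u scaleC_seq_alg.abs_eq by (rule norm_seq_scaled) (auto simp: norm_scaleC)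
  have na: "norm (adj x) = norm x"
    using norm_seq_scaled[of "adj u" 1 u] by (simp add: norm_adj u adj_seq_alg.abs_eq)
  show "norm (adj x * x) = (norm x)\<^sup>2"
  proof (rule antisym)
    show "norm (adj x * x) \<le> (norm x)\<^sup>2"
      using mult[of "adj x" x] by (simp add: na power2_eq_square)
    show "(norm x)\<^sup>2 \<le> norm (adj x * x)"
    proof (rule dense_ge)
      fix s assume s: "norm (adj x * x) < s"
      then have s0: "0 \<le> s" using norm_ge_zero order_trans less_imp_le by blast
      have "norm x \<le> sqrt s"
        unfolding u norm_seq_le_iff
      proof (intro allI impI)
        fix t assume t: "sqrt s < t"
        have "norm (seq_class (adj u * u)) \<le> s"
          using s by (simp add: u adj_seq_alg.abs_eq times_seq_alg.abs_eq)
        moreover have "s < t\<^sup>2" using t s0 by (metis real_sqrt_ge_zero real_sqrt_pow2 power_strict_mono pos2)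
        ultimately have "\<forall>\<^sub>F n in sequentially. norm ((adj u * u) n) \<le> t\<^sup>2"
          unfolding norm_seq_le_iff by blast
        then show "\<forall>\<^sub>F n in sequentially. norm (u n) \<le> t"
        proof eventually_elim
          case (elim n)
          then have "(norm (u n))\<^sup>2 \<le> t\<^sup>2" by (simp add: cstar_identity)
          moreover have "0 \<le> t" using t s0 real_sqrt_ge_zero[of s] by linarith
          ultimately show ?case by (rule power2_le_imp_le)
        qed
      qed
      then show "(norm x)\<^sup>2 \<le> s" using s0 by (metis norm_ge_zero power_mono real_sqrt_pow2)
    qed
  qed
qed


definition const_seq :: "'a::cstar_algebra \<Rightarrow> 'a seq_alg" where
  "const_seq a = seq_class (const_bcontfun a)"

text \<open>
  Componentwise application. Boundedness of the linear map \<open>f\<close> makes this well defined on classes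
  modulo null sequences; every automorphism qualifies, being isometric. The \<open>else\<close> branch is a dummy.
\<close>

lift_definition seq_map :: "('a::cstar_algebra \<Rightarrow> 'a) \<Rightarrow> 'a seq_alg \<Rightarrow> 'a seq_alg"
  is "\<lambda>f (x :: nat \<Rightarrow>\<^sub>C 'a). if bounded_linear f then Bcontfun (\<lambda>n. f (apply_bcontfun x n)) else 0"
proof -
  fix f :: "'a \<Rightarrow> 'a" and x y :: "nat \<Rightarrow>\<^sub>C 'a"
  assume xy: "null_equiv x y"
  show "null_equiv (if bounded_linear f then Bcontfun (\<lambda>n. f (x n)) else 0)
          (if bounded_linear f then Bcontfun (\<lambda>n. f (y n)) else 0)"
  proof (cases "bounded_linear f")
    case True
    have "apply_bcontfun (Bcontfun (\<lambda>n. f (z n))) = (\<lambda>n. f (z n))" for z :: "nat \<Rightarrow>\<^sub>C 'a"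
      by (rule Bcontfun_inverse) (rule bcontfun_bounded_linear[OF True apply_bcontfun])
    with True xy show ?thesis
      by (auto intro: null_equiv_bounded_linear[OF True xy])
  qed (simp add: null_equiv_def)
qed


section \<open>Algebras given by a carrier set\<close>

text \<open>
  Not every algebra below is a type: the relative central sequence algebra depends on a
  subalgebra. The field \<^const>\<open>one\<close> is only meaningful for unital algebras.
\<close>

record 'b star_ring = "'b ring" +
  cscale :: "complex \<Rightarrow> 'b \<Rightarrow> 'b"
  star_op :: "'b \<Rightarrow> 'b"
  rnorm :: "'b \<Rightarrow> real"

text \<open>
  Positivity of an \<open>n\<close> by \<open>n\<close> matrix \<open>X\<close> over \<open>B\<close>, that is \<open>X = Z* Z\<close> in \<open>M\<^sub>n(B)\<close>.
  Only the entries with indices below \<open>n\<close> matter.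
\<close>

definition mat_positive :: "('b, 'm) star_ring_scheme \<Rightarrow> nat \<Rightarrow> (nat \<Rightarrow> nat \<Rightarrow> 'b) \<Rightarrow> bool" where
  "mat_positive B n X \<longleftrightarrow>
     (\<exists>Z. (\<forall>i<n. \<forall>j<n. Z i j \<in> carrier B) \<and>
          (\<forall>i<n. \<forall>j<n. X i j = (\<Oplus>\<^bsub>B\<^esub>k\<in>{..<n}. star_op B (Z k i) \<otimes>\<^bsub>B\<^esub> Z k j)))"

definition ring_positive :: "('b, 'm) star_ring_scheme \<Rightarrow> 'b \<Rightarrow> bool" where
  "ring_positive B x \<longleftrightarrow> (\<exists>z\<in>carrier B. x = star_op B z \<otimes>\<^bsub>B\<^esub> z)"

definition linear_between ::
    "('b, 'm) star_ring_scheme \<Rightarrow> ('c, 'n) star_ring_scheme \<Rightarrow> ('b \<Rightarrow> 'c) \<Rightarrow> bool" where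
  "linear_between B C \<phi> \<longleftrightarrow>
     (\<forall>x\<in>carrier B. \<phi> x \<in> carrier C) \<and>
     (\<forall>x\<in>carrier B. \<forall>y\<in>carrier B. \<phi> (x \<oplus>\<^bsub>B\<^esub> y) = \<phi> x \<oplus>\<^bsub>C\<^esub> \<phi> y) \<and>
     (\<forall>c. \<forall>x\<in>carrier B. \<phi> (cscale B c x) = cscale C c (\<phi> x))"

definition completely_positive ::
    "('b, 'm) star_ring_scheme \<Rightarrow> ('c, 'n) star_ring_scheme \<Rightarrow> ('b \<Rightarrow> 'c) \<Rightarrow> bool" where
  "completely_positive B C \<phi> \<longleftrightarrow>
     linear_between B C \<phi> \<and>
     (\<forall>n X. mat_positive B n X \<longrightarrow> mat_positive C n (\<lambda>i j. \<phi> (X i j)))"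

definition contractive ::
    "('b, 'm) star_ring_scheme \<Rightarrow> ('c, 'n) star_ring_scheme \<Rightarrow> ('b \<Rightarrow> 'c) \<Rightarrow> bool" where
  "contractive B C \<phi> \<longleftrightarrow> (\<forall>x\<in>carrier B. rnorm C (\<phi> x) \<le> rnorm B x)"

definition order_zero ::
    "('b, 'm) star_ring_scheme \<Rightarrow> ('c, 'n) star_ring_scheme \<Rightarrow> ('b \<Rightarrow> 'c) \<Rightarrow> bool" where
  "order_zero B C \<phi> \<longleftrightarrow>
     (\<forall>x y. ring_positive B x \<and> ring_positive B y \<and> x \<otimes>\<^bsub>B\<^esub> y = \<zero>\<^bsub>B\<^esub> \<longrightarrow>
        \<phi> x \<otimes>\<^bsub>C\<^esub> \<phi> y = \<zero>\<^bsub>C\<^esub>)"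

definition cpc_order_zero ::
    "('b, 'm) star_ring_scheme \<Rightarrow> ('c, 'n) star_ring_scheme \<Rightarrow> ('b \<Rightarrow> 'c) \<Rightarrow> bool" where
  "cpc_order_zero B C \<phi> \<longleftrightarrow> completely_positive B C \<phi> \<and> contractive B C \<phi> \<and> order_zero B C \<phi>"

text \<open>
  \<open>C(X)\<close> for a finite nonempty discrete space \<open>X\<close>; functions are extended by zero outside \<open>X\<close>.
\<close>

definition fun_alg :: "'x set \<Rightarrow> ('x \<Rightarrow> complex) star_ring" where
  "fun_alg X =
     \<lparr>carrier = {f. \<forall>x. x \<notin> X \<longrightarrow> f x = 0},
      mult = (\<lambda>f g x. f x * g x),
      one = (\<lambda>x. if x \<in> X then 1 else 0),
      zero = (\<lambda>x. 0),
      add = (\<lambda>f g x. f x + g x),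
      cscale = (\<lambda>c f x. c * f x),
      star_op = (\<lambda>f x. cnj (f x)),
      rnorm = (\<lambda>f. SUP x\<in>X. cmod (f x))\<rparr>"

lemma abelian_group_fun_alg: "abelian_group (fun_alg X)"
proof (rule abelian_groupI)
  fix f assume "f \<in> carrier (fun_alg X)"
  then show "\<exists>g\<in>carrier (fun_alg X). g \<oplus>\<^bsub>fun_alg X\<^esub> f = \<zero>\<^bsub>fun_alg X\<^esub>"
    by (intro bexI[of _ "\<lambda>x. - f x"]) (auto simp: fun_alg_def)
qed (auto simp: fun_alg_def algebra_simps)


section \<open>Relative central sequence algebras\<close>

definition annihilator :: "'b::cstar_algebra set \<Rightarrow> 'b set" where
  "annihilator D = {x. \<forall>d\<in>D. x * d = 0 \<and> d * x = 0}"

definition rel_commutant :: "'b::cstar_algebra set \<Rightarrow> 'b set" where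
  "rel_commutant D = {x. \<forall>d\<in>D. x * d = d * x}"

definition ann_coset :: "'b::cstar_algebra set \<Rightarrow> 'b \<Rightarrow> 'b set" where
  "ann_coset D x = (\<lambda>z. x + z) ` annihilator D"

definition ann_mult :: "'b::cstar_algebra set \<Rightarrow> 'b set \<Rightarrow> 'b set \<Rightarrow> 'b set" where
  "ann_mult D X Y = (\<Union>x\<in>X. \<Union>y\<in>Y. ann_coset D (x * y))"

text \<open>
  Elements are cosets of the annihilator, and each operation is carried out on representatives and
  saturated. The unit exists when \<open>D\<close> is separable and is unspecified if there is none.
\<close>

definition F_alg :: "'b::cstar_algebra set \<Rightarrow> 'b set star_ring" where
  "F_alg D =
     \<lparr>carrier = ann_coset D ` rel_commutant D,
      mult = ann_mult D,
      one = (THE E. E \<in> ann_coset D ` rel_commutant D \<and>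
               (\<forall>X\<in>ann_coset D ` rel_commutant D. ann_mult D E X = X \<and> ann_mult D X E = X)),
      zero = annihilator D,
      add = (\<lambda>X Y. \<Union>x\<in>X. \<Union>y\<in>Y. ann_coset D (x + y)),
      cscale = (\<lambda>c X. \<Union>x\<in>X. ann_coset D (c *\<^sub>C x)),
      star_op = (\<lambda>X. \<Union>x\<in>X. ann_coset D (adj x)),
      rnorm = (\<lambda>X. Inf (norm ` X))\<rparr>"

definition induced_map :: "'b::cstar_algebra set \<Rightarrow> ('b \<Rightarrow> 'b) \<Rightarrow> 'b set \<Rightarrow> 'b set" where
  "induced_map D h X = (\<Union>x\<in>X. ann_coset D (h x))"

lemma ann_zero: "0 \<in> annihilator D"
  and ann_add: "x \<in> annihilator D \<Longrightarrow> y \<in> annihilator D \<Longrightarrow> x + y \<in> annihilator D"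
  and ann_diff: "x \<in> annihilator D \<Longrightarrow> y \<in> annihilator D \<Longrightarrow> x - y \<in> annihilator D"
  and ann_scaleC: "x \<in> annihilator D \<Longrightarrow> c *\<^sub>C x \<in> annihilator D"
  by (simp_all add: annihilator_def distrib_left distrib_right left_diff_distrib
      right_diff_distrib mult_scaleC_left mult_scaleC_right scaleC_zero)

lemma ann_coset_eq_iff: "ann_coset D x = ann_coset D y \<longleftrightarrow> x - y \<in> annihilator D"
proof
  assume "ann_coset D x = ann_coset D y"
  moreover have "x \<in> ann_coset D x" using ann_zero[of D] by (force simp: ann_coset_def)
  ultimately show "x - y \<in> annihilator D" by (auto simp: ann_coset_def)
next
  have sub: "ann_coset D x \<subseteq> ann_coset D y" if "x - y \<in> annihilator D" for x y
  proof
    fix v assume "v \<in> ann_coset D x"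
    then obtain z where "z \<in> annihilator D" "v = x + z" by (auto simp: ann_coset_def)
    then have "v = y + (x - y + z)" "x - y + z \<in> annihilator D" using ann_add that by auto
    then show "v \<in> ann_coset D y" unfolding ann_coset_def by (rule image_eqI)
  qed
  assume *: "x - y \<in> annihilator D"
  then have "y - x \<in> annihilator D" using ann_diff[OF ann_zero *] by simp
  with * sub show "ann_coset D x = ann_coset D y" by blast
qed

lemma in_ann_coset_iff: "x \<in> ann_coset D y \<longleftrightarrow> x - y \<in> annihilator D"
  by (force simp: ann_coset_def image_iff)

lemma ann_coset_lift:
  assumes "\<And>x'. x' - x \<in> annihilator D \<Longrightarrow> h x' - h x \<in> annihilator D"
  shows "(\<Union>x'\<in>ann_coset D x. ann_coset D (h x')) = ann_coset D (h x)"
proof -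
  have "ann_coset D (h x') = ann_coset D (h x)" if "x' \<in> ann_coset D x" for x'
    using assms that by (simp add: in_ann_coset_iff ann_coset_eq_iff)
  moreover have "ann_coset D x \<noteq> {}" using ann_zero by (auto simp: ann_coset_def)
  ultimately show ?thesis by (intro SUP_eq_const)
qed

lemma F_alg_add:
  "ann_coset D x \<oplus>\<^bsub>F_alg D\<^esub> ann_coset D y = ann_coset D (x + y)"
proof -
  have "(\<Union>y'\<in>ann_coset D y. ann_coset D (x' + y')) = ann_coset D (x' + y)" for x'
    by (rule ann_coset_lift) simp
  moreover have "(\<Union>x'\<in>ann_coset D x. ann_coset D (x' + y)) = ann_coset D (x + y)"
    by (rule ann_coset_lift) simp
  ultimately show ?thesis by (simp add: F_alg_def)
qed

lemma F_alg_scale: "cscale (F_alg D) c (ann_coset D x) = ann_coset D (c *\<^sub>C x)"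
  by (simp add: F_alg_def) (rule ann_coset_lift, metis ann_scaleC scaleC_diff_right)

lemma F_alg_star:
  assumes "adj ` D \<subseteq> D"
  shows "star_op (F_alg D) (ann_coset D x) = ann_coset D (adj x)"
proof -
  have *: "adj z \<in> annihilator D" if "z \<in> annihilator D" for z
    unfolding annihilator_def
  proof (intro CollectI ballI conjI)
    fix d assume "d \<in> D"
    then have "adj d \<in> D" using assms by auto
    then have "adj (adj d * z) = 0" "adj (z * adj d) = 0"
      using that by (auto simp: annihilator_def adj_zero)
    then show "adj z * d = 0" "d * adj z = 0" by (simp_all add: adj_mult adj_adj)
  qed
  show ?thesis
    by (simp add: F_alg_def) (rule ann_coset_lift, metis * adj_minus)
qed

lemma F_alg_mult:
  assumes x: "x \<in> rel_commutant D" and y: "y \<in> rel_commutant D"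
  shows "ann_coset D x \<otimes>\<^bsub>F_alg D\<^esub> ann_coset D y = ann_coset D (x * y)"
proof -
  have r: "a * z \<in> annihilator D" if "a \<in> rel_commutant D" "z \<in> annihilator D" for a z
    unfolding annihilator_def
  proof (intro CollectI ballI conjI)
    fix d assume "d \<in> D"
    with that have "z * d = 0" "d * z = 0" "d * a = a * d"
      by (auto simp: annihilator_def rel_commutant_def)
    then show "a * z * d = 0" "d * (a * z) = 0"
      by (simp add: mult.assoc, metis mult.assoc mult_zero_right)
  qed
  have l: "z * a \<in> annihilator D" if "a \<in> rel_commutant D" "z \<in> annihilator D" for a z
    unfolding annihilator_def
  proof (intro CollectI ballI conjI)
    fix d assume "d \<in> D"
    with that have "z * d = 0" "d * z = 0" "a * d = d * a"
      by (auto simp: annihilator_def rel_commutant_def)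
    then show "z * a * d = 0" "d * (z * a) = 0"
      by (metis mult.assoc mult_zero_left, metis mult.assoc mult_zero_left)
  qed
  have ann: "z \<in> rel_commutant D" if "z \<in> annihilator D" for z
    using that by (auto simp: annihilator_def rel_commutant_def)
  have "(\<Union>y'\<in>ann_coset D y. ann_coset D (x' * y')) = ann_coset D (x' * y)"
    if "x' \<in> ann_coset D x" for x'
  proof (rule ann_coset_lift)
    fix y' assume *: "y' - y \<in> annihilator D"
    define z where "z = x' - x"
    have "z \<in> rel_commutant D" using ann that by (simp add: in_ann_coset_iff z_def)
    then have "x + z \<in> rel_commutant D"
      using x by (simp add: rel_commutant_def distrib_left distrib_right)
    then have "x' \<in> rel_commutant D" by (simp add: z_def)
    with r * show "x' * y' - x' * y \<in> annihilator D"
      by (simp flip: right_diff_distrib)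
  qed
  moreover have "(\<Union>x'\<in>ann_coset D x. ann_coset D (x' * y)) = ann_coset D (x * y)"
    by (rule ann_coset_lift) (use l y in \<open>simp flip: left_diff_distrib\<close>)
  ultimately show ?thesis by (simp add: F_alg_def ann_mult_def)
qed

lemma abelian_group_F_alg: "abelian_group (F_alg D)"
proof -
  have c: "carrier (F_alg D) = ann_coset D ` rel_commutant D"
    and z: "\<zero>\<^bsub>F_alg D\<^esub> = ann_coset D 0"
    by (simp_all add: F_alg_def ann_coset_def)
  have rc: "0 \<in> rel_commutant D"
    "x \<in> rel_commutant D \<Longrightarrow> y \<in> rel_commutant D \<Longrightarrow> x + y \<in> rel_commutant D"
    "x \<in> rel_commutant D \<Longrightarrow> - x \<in> rel_commutant D" for x y
    by (simp_all add: rel_commutant_def algebra_simps)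
  show ?thesis
  proof (rule abelian_groupI)
    fix X assume "X \<in> carrier (F_alg D)"
    then obtain x where x: "X = ann_coset D x" "x \<in> rel_commutant D" by (auto simp: c)
    then show "\<exists>Y\<in>carrier (F_alg D). Y \<oplus>\<^bsub>F_alg D\<^esub> X = \<zero>\<^bsub>F_alg D\<^esub>"
      by (intro bexI[of _ "ann_coset D (- x)"]) (auto simp: F_alg_add c z rc)
  qed (auto simp: c z F_alg_add rc add_ac)
qed

lemma F_alg_one:
  assumes e: "e \<in> rel_commutant D" and unit: "\<And>d. d \<in> D \<Longrightarrow> e * d = d"
  shows "\<one>\<^bsub>F_alg D\<^esub> = ann_coset D e"
proof -
  let ?F = "ann_coset D ` rel_commutant D"
  have m: "ann_mult D = mult (F_alg D)" by (simp add: F_alg_def)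
  have de: "d * e = d" if "d \<in> D" for d using e unit that by (auto simp: rel_commutant_def)
  have "ann_mult D (ann_coset D e) X = X \<and> ann_mult D X (ann_coset D e) = X" if X: "X \<in> ?F" for X
  proof -
    obtain x where x: "X = ann_coset D x" "x \<in> rel_commutant D" using X by auto
    have xd: "x * d = d * x" if "d \<in> D" for d using x(2) that by (simp add: rel_commutant_def)
    have "(e * x - x) * d = 0 \<and> d * (e * x - x) = 0 \<and> (x * e - x) * d = 0 \<and> d * (x * e - x) = 0"
      if "d \<in> D" for d
    proof -
      have "e * x * d = x * d" using unit[OF that] xd[OF that] by (metis mult.assoc)
      moreover have "d * (e * x) = d * x" using de[OF that] by (metis mult.assoc)
      moreover have "x * e * d = x * d" using unit[OF that] by (metis mult.assoc)
      moreover have "d * (x * e) = d * x" using de[OF that] xd[OF that] by (metis mult.assoc)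
      ultimately show ?thesis by (simp add: left_diff_distrib right_diff_distrib)
    qed
    then have "e * x - x \<in> annihilator D" "x * e - x \<in> annihilator D"
      unfolding annihilator_def by blast+
    then show ?thesis
      unfolding m x(1) F_alg_mult[OF e x(2)] F_alg_mult[OF x(2) e] ann_coset_eq_iff by simp
  qed
  then have e1: "ann_coset D e \<in> ?F \<and>
      (\<forall>X\<in>?F. ann_mult D (ann_coset D e) X = X \<and> ann_mult D X (ann_coset D e) = X)"
    using e by blast
  have uniq: "E = ann_coset D e"
    if "E \<in> ?F \<and> (\<forall>X\<in>?F. ann_mult D E X = X \<and> ann_mult D X E = X)" for E
  proof -
    have "ann_mult D E (ann_coset D e) = E" using that e1 by blast
    moreover have "ann_mult D E (ann_coset D e) = ann_coset D e" using that e1 by blast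
    ultimately show ?thesis by (rule trans[OF sym])
  qed
  have "(THE E. E \<in> ?F \<and> (\<forall>X\<in>?F. ann_mult D E X = X \<and> ann_mult D X E = X)) = ann_coset D e"
    by (rule the_equality, rule e1, rule uniq)
  then show ?thesis unfolding F_alg_def by (simp only: monoid.simps)
qed


section \<open>Groups, finite-index subgroups and box spaces\<close>

definition finite_index_subgroup :: "('g, 'm) monoid_scheme \<Rightarrow> 'g set \<Rightarrow> bool" where
  "finite_index_subgroup G H \<longleftrightarrow> subgroup H G \<and> finite (lcosets\<^bsub>G\<^esub> H)"

definition residually_finite :: "('g, 'm) monoid_scheme \<Rightarrow> bool" where
  "residually_finite G \<longleftrightarrow>
     (\<forall>g\<in>carrier G - {\<one>\<^bsub>G\<^esub>}. \<exists>N. N \<lhd> G \<and> finite_index_subgroup G N \<and> g \<notin> N)"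

definition conj_class :: "('g, 'm) monoid_scheme \<Rightarrow> 'g \<Rightarrow> 'g set" where
  "conj_class G g = {k \<otimes>\<^bsub>G\<^esub> g \<otimes>\<^bsub>G\<^esub> inv\<^bsub>G\<^esub> k |k. k \<in> carrier G}"

definition regular_approximation :: "('g, 'm) monoid_scheme \<Rightarrow> (nat \<Rightarrow> 'g set) \<Rightarrow> bool" where
  "regular_approximation G \<sigma> \<longleftrightarrow>
     (\<forall>n. finite_index_subgroup G (\<sigma> n)) \<and>
     (\<forall>n. \<sigma> (Suc n) \<subseteq> \<sigma> n) \<and>
     (\<forall>g\<in>carrier G - {\<one>\<^bsub>G\<^esub>}. \<exists>n. \<sigma> n \<inter> (conj_class G g <#>\<^bsub>G\<^esub> \<sigma> n) = {})"

definition proper_right_invariant_metric ::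
    "('g, 'm) monoid_scheme \<Rightarrow> ('g \<Rightarrow> 'g \<Rightarrow> real) \<Rightarrow> bool" where
  "proper_right_invariant_metric G d \<longleftrightarrow>
     Metric_space (carrier G) d \<and>
     (\<forall>x\<in>carrier G. \<forall>r. finite {y \<in> carrier G. d x y \<le> r}) \<and>
     (\<forall>x\<in>carrier G. \<forall>y\<in>carrier G. \<forall>g\<in>carrier G. d (x \<otimes>\<^bsub>G\<^esub> g) (y \<otimes>\<^bsub>G\<^esub> g) = d x y)"

definition quotient_metric :: "('g \<Rightarrow> 'g \<Rightarrow> real) \<Rightarrow> 'g set \<Rightarrow> 'g set \<Rightarrow> real" where
  "quotient_metric d X Y = Inf {d x y |x y. x \<in> X \<and> y \<in> Y}"

definition box_space :: "('g, 'm) monoid_scheme \<Rightarrow> (nat \<Rightarrow> 'g set) \<Rightarrow> (nat \<times> 'g set) set" where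
  "box_space G \<sigma> = (SIGMA n:UNIV. lcosets\<^bsub>G\<^esub> (\<sigma> n))"

definition box_space_metric ::
    "('g, 'm) monoid_scheme \<Rightarrow> ('g \<Rightarrow> 'g \<Rightarrow> real) \<Rightarrow> (nat \<Rightarrow> 'g set) \<Rightarrow>
     (nat \<times> 'g set \<Rightarrow> nat \<times> 'g set \<Rightarrow> real) \<Rightarrow> bool" where
  "box_space_metric G d \<sigma> dB \<longleftrightarrow>
     Metric_space (box_space G \<sigma>) dB \<and>
     (\<forall>n. \<forall>X\<in>lcosets\<^bsub>G\<^esub> (\<sigma> n). \<forall>Y\<in>lcosets\<^bsub>G\<^esub> (\<sigma> n). dB (n, X) (n, Y) = quotient_metric d X Y) \<and>
     (\<forall>R. \<exists>N. \<forall>n m. n \<noteq> m \<and> n + m \<ge> N \<longrightarrow>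
        (\<forall>X\<in>lcosets\<^bsub>G\<^esub> (\<sigma> n). \<forall>Y\<in>lcosets\<^bsub>G\<^esub> (\<sigma> m). dB (n, X) (m, Y) \<ge> R))"


section \<open>Asymptotic dimension\<close>

text \<open>
  The bound \<open>r < R\<close> says that the diameter of \<open>S\<close> is less than \<open>R\<close>.
\<close>

definition lebesgue_number_at_least ::
    "'x set \<Rightarrow> ('x \<Rightarrow> 'x \<Rightarrow> real) \<Rightarrow> 'x set set \<Rightarrow> real \<Rightarrow> bool" where
  "lebesgue_number_at_least M d \<V> R \<longleftrightarrow>
     (\<forall>S. S \<subseteq> M \<and> S \<noteq> {} \<and> (\<exists>r<R. \<forall>x\<in>S. \<forall>y\<in>S. d x y \<le> r) \<longrightarrow> (\<exists>U\<in>\<V>. S \<subseteq> U))"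

definition asdim_le :: "'x set \<Rightarrow> ('x \<Rightarrow> 'x \<Rightarrow> real) \<Rightarrow> nat \<Rightarrow> bool" where
  "asdim_le M d s \<longleftrightarrow>
     (\<forall>R>0. \<exists>\<V> :: nat \<Rightarrow> 'x set set.
        \<Union> (\<Union>l\<le>s. \<V> l) = M \<and>
        (\<exists>B. \<forall>U\<in>(\<Union>l\<le>s. \<V> l). \<forall>x\<in>U. \<forall>y\<in>U. d x y \<le> B) \<and>
        lebesgue_number_at_least M d (\<Union>l\<le>s. \<V> l) R \<and>
        (\<forall>l\<le>s. pairwise disjnt (\<V> l)))"

text \<open>In \<^typ>\<open>enat\<close> the infimum of the empty set is \<open>\<infinity>\<close>.\<close>

definition asdim :: "'x set \<Rightarrow> ('x \<Rightarrow> 'x \<Rightarrow> real) \<Rightarrow> enat" where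
  "asdim M d = Inf {enat s |s. asdim_le M d s}"


section \<open>Rokhlin dimension\<close>

definition shift :: "('g, 'm) monoid_scheme \<Rightarrow> 'g set \<Rightarrow> 'g \<Rightarrow> ('g set \<Rightarrow> complex) \<Rightarrow> 'g set \<Rightarrow> complex" where
  "shift G H g f = (\<lambda>X. if X \<in> lcosets\<^bsub>G\<^esub> H then f (inv\<^bsub>G\<^esub> g <#\<^bsub>G\<^esub> X) else 0)"

definition admissible_subalgebra ::
    "('g, 'm) monoid_scheme \<Rightarrow> ('g \<Rightarrow> 'a::cstar_algebra \<Rightarrow> 'a) \<Rightarrow> ('g \<Rightarrow> 'g \<Rightarrow> 'a multiplier) \<Rightarrow>
     'a set \<Rightarrow> bool" where
  "admissible_subalgebra G \<alpha> w D \<longleftrightarrow>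
     cstar_subalgebra D \<and> separable_space (top_of_set D) \<and>
     (\<forall>g\<in>carrier G. \<alpha> g ` D \<subseteq> D) \<and>
     (\<forall>g\<in>carrier G. \<forall>h\<in>carrier G. \<forall>x\<in>D. mult_left (w g h) x \<in> D \<and> mult_right x (w g h) \<in> D)"

definition rokhlin_dim_le ::
    "('g, 'm) monoid_scheme \<Rightarrow> ('g \<Rightarrow> 'a::cstar_algebra \<Rightarrow> 'a) \<Rightarrow> ('g \<Rightarrow> 'g \<Rightarrow> 'a multiplier) \<Rightarrow>
     'g set \<Rightarrow> nat \<Rightarrow> bool" where
  "rokhlin_dim_le G \<alpha> w H d \<longleftrightarrow>
     (\<forall>D. admissible_subalgebra G \<alpha> w D \<longrightarrow>
        (let C = fun_alg (lcosets\<^bsub>G\<^esub> H); F = F_alg (const_seq ` D) in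
         \<exists>\<phi>. (\<forall>l\<le>d. cpc_order_zero C F (\<phi> l) \<and>
               (\<forall>g\<in>carrier G. \<forall>f\<in>carrier C.
                  \<phi> l (shift G H g f) = induced_map (const_seq ` D) (seq_map (\<alpha> g)) (\<phi> l f))) \<and>
             (\<Oplus>\<^bsub>F\<^esub>l\<in>{..d}. \<phi> l \<one>\<^bsub>C\<^esub>) = \<one>\<^bsub>F\<^esub>))"

definition dim_Rok_at ::
    "('g, 'm) monoid_scheme \<Rightarrow> ('g \<Rightarrow> 'a::cstar_algebra \<Rightarrow> 'a) \<Rightarrow> ('g \<Rightarrow> 'g \<Rightarrow> 'a multiplier) \<Rightarrow>
     'g set \<Rightarrow> enat" where
  "dim_Rok_at G \<alpha> w H = Inf {enat d |d. rokhlin_dim_le G \<alpha> w H d}"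

definition dim_Rok ::
    "('g, 'm) monoid_scheme \<Rightarrow> ('g \<Rightarrow> 'a::cstar_algebra \<Rightarrow> 'a) \<Rightarrow> ('g \<Rightarrow> 'g \<Rightarrow> 'a multiplier) \<Rightarrow> enat" where
  "dim_Rok G \<alpha> w = Sup {dim_Rok_at G \<alpha> w H |H. finite_index_subgroup G H}"


section \<open>Amenability dimension\<close>

definition am_dim_le :: "('g, 'm) monoid_scheme \<Rightarrow> ('g \<Rightarrow> 'a::cstar_algebra \<Rightarrow> 'a) \<Rightarrow> nat \<Rightarrow> bool" where
  "am_dim_le G \<alpha> d \<longleftrightarrow>
     (\<forall>\<epsilon>>0. \<forall>M F. M \<subseteq> carrier G \<and> finite M \<and> finite F \<longrightarrow>
       (\<exists>\<mu> :: nat \<Rightarrow> 'g \<Rightarrow> 'a.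
          (\<forall>l\<le>d. finite {g \<in> carrier G. \<mu> l g \<noteq> 0} \<and>
                 (\<forall>g\<in>carrier G. positive_contraction (\<mu> l g))) \<and>
          (\<forall>a\<in>F. norm ((\<Sum>l\<le>d. \<Sum>g\<in>{g \<in> carrier G. \<mu> l g \<noteq> 0}. \<mu> l g) * a - a) \<le> \<epsilon>) \<and>
          (\<forall>l\<le>d. \<forall>g\<in>carrier G. \<forall>h\<in>carrier G. g \<noteq> h \<longrightarrow> \<mu> l g * \<mu> l h = 0) \<and>
          (\<forall>a\<in>F. \<forall>l\<le>d. \<forall>g\<in>M. \<forall>E. E \<subseteq> carrier G \<and> finite E \<longrightarrow>
             norm ((\<Sum>h\<in>E. \<alpha> g (\<mu> l h) - \<mu> l (g \<otimes>\<^bsub>G\<^esub> h)) * a) \<le> \<epsilon>) \<and>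
          (\<forall>a\<in>F. \<forall>l\<le>d. \<forall>E. E \<subseteq> carrier G \<and> finite E \<longrightarrow>
             norm ((\<Sum>g\<in>E. \<mu> l g) * a - a * (\<Sum>g\<in>E. \<mu> l g)) \<le> \<epsilon>)))"

definition dim_am :: "('g, 'm) monoid_scheme \<Rightarrow> ('g \<Rightarrow> 'a::cstar_algebra \<Rightarrow> 'a) \<Rightarrow> enat" where
  "dim_am G \<alpha> = Inf {enat d |d. am_dim_le G \<alpha> d}"

end

theory Submission
  imports Defs "HOL-Computational_Algebra.Polynomial"
begin

text \<open>
  Both dimensions are compared with towers in \<open>A\<close>: sequences of exactly orthogonal positive
  contractions indexed by \<open>G/H\<close>, asymptotically central, equivariant and summing up to a unit.
  Orthogonal positive elements lift along quotients by closed ideals, so the order zero maps witnessing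
  Rokhlin dimension along \<open>H\<close> are the same thing as such towers (complete positivity
  of the map given by a tower comes from the square roots of its elements). Summing the functions
  witnessing amenability dimension over the cosets of \<open>H\<close> yields towers. Conversely, finite asymptotic
  dimension of the box space yields, on \<open>G\<close>, finitely many almost invariant finitely supported
  functions \<open>\<nu>\<^sub>j\<close> that are injective on supports modulo some \<open>\<sigma> n\<close> and sum up to a partition of unity
  of \<open>G / \<sigma> n\<close>; multiplying them with towers along \<open>\<sigma> n\<close> gives witnesses for the amenability dimension.

  The functional calculus this needs is obtained without spectral theory. A self-adjoint contraction
  \<open>a\<close> is the real part of the unitary \<open>u = a + \<i> s\<close>, \<open>s\<^sup>2 = 1 - a\<^sup>2\<close>, so a polynomial \<open>p(a)\<close> of degree \<open>N\<close> is up
  to a power of \<open>u\<close> a polynomial of degree \<open>2 N\<close> in \<open>u\<close>, whose coefficients are at most \<open>sup |p|\<close>. Hence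
  \<open>norm (p a) \<le> (2 N + 1) sup |p|\<close>, and the factor disappears on replacing \<open>p\<close> by its powers.
\<close>

section \<open>Polynomials in a self-adjoint element\<close>

text \<open>The two dimensions differ in form: amenability dimension asks for exact orthogonality in
  the algebra and for estimates uniform over all finite subsets of the group, Rokhlin dimension
  lives in a quotient of a sequence algebra. Lifting settles the first point; the second dictates
  the order of choices in the converse direction. The tolerance for the functions
  \<open>\<nu> j\<close> fixes the level \<open>n\<close>, so it must not depend on the number of
  cosets or on the supports. It need not: after regrouping by cosets, injectivity modulo
  \<open>\<sigma> n\<close> leaves at most two differences of values per coset, and orthogonality of
  the tower turns the sum over cosets into a maximum. Only the errors of the towers are added up,
  and these are chosen after \<open>n\<close>. Pairs of colours give the bound
  \<open>(p + 1) * (s + 1) - 1\<close>; in the other direction one \<open>p\<close> serves every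
  subgroup. The relation between \<open>\<alpha>\<close> and the cocycle makes each
  \<open>\<alpha> g\<close> map an admissible \<open>D\<close> onto itself, which is why the action
  on cosets of the annihilator is well defined.\<close>

lemma scaleC_one: "(1::complex) *\<^sub>C x = (x::'a::cstar_algebra)"
  using scaleR_scaleC[of 1 x] by simp

lemma scaleC_zero_left: "0 *\<^sub>C x = (0::'a::cstar_algebra)"
  using scaleR_scaleC[of 0 x] by simp

lemma scaleC_minus_left: "(- c) *\<^sub>C x = - (c *\<^sub>C (x::'a::cstar_algebra))"
proof -
  have "(- c) *\<^sub>C x + c *\<^sub>C x = 0"
    by (simp flip: scaleC_add_left add: scaleC_zero_left)
  then show ?thesis by (simp add: eq_neg_iff_add_eq_0)
qed

lemma scaleC_sum_right: "c *\<^sub>C (\<Sum>i\<in>I. f i) = (\<Sum>i\<in>I. c *\<^sub>C (f i :: 'a::cstar_algebra))"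
  by (induct I rule: infinite_finite_induct) (auto simp: scaleC_zero scaleC_add_right)

lemma adj_sum: "adj (\<Sum>i\<in>I. f i) = (\<Sum>i\<in>I. adj (f i :: 'a::cstar_algebra))"
  by (induct I rule: infinite_finite_induct) (auto simp: adj_zero adj_add)

lemma adj_scaleR: "adj (r *\<^sub>R x) = r *\<^sub>R adj (x::'a::cstar_algebra)"
  by (simp add: scaleR_scaleC adj_scaleC)

lemma adj_uminus: "adj (- x) = - adj (x::'a::cstar_algebra)"
  using adj_minus[of 0 x] by (simp add: adj_zero)

lemma norm_selfadj_square: "adj a = a \<Longrightarrow> norm (a * a) = (norm (a::'a::cstar_algebra))\<^sup>2"
  using cstar_identity[of a] by simp

section \<open>Coefficients of a polynomial bounded on the unit circle\<close>

abbreviation circ_root :: "nat \<Rightarrow> nat \<Rightarrow> complex" where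
  "circ_root M j \<equiv> exp (2 * of_real pi * \<i> * of_nat j / of_nat M)"

lemma circ_root_power: "circ_root M j ^ m = circ_root M m ^ j"
  by (simp flip: exp_of_nat_mult add: field_simps)

lemma cmod_circ_root: "cmod (circ_root M j) = 1"
proof -
  have "2 * of_real pi * \<i> * of_nat j / of_nat M = \<i> * of_real (2 * pi * j / M)"
    by (simp add: field_simps)
  then show ?thesis by (metis norm_exp_i_times)
qed

text \<open>Cauchy's estimate in discrete form: the \<open>i\<close>-th coefficient is the average
  of \<open>poly Q z / z ^ i\<close> over the \<open>M\<close>-th roots of unity.\<close>

lemma coeff_le_sup_circle:
  fixes Q :: "complex poly"
  assumes B: "\<And>z. cmod z = 1 \<Longrightarrow> cmod (poly Q z) \<le> B"
  shows "cmod (coeff Q i) \<le> B"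
proof -
  \<comment> \<open>Beyond \<open>i\<close> and the degree, so that different exponents give
    different roots of unity and only the \<open>i\<close>-th geometric sum survives.\<close>
  define M where "M = Suc (max (degree Q) i)"
  have M: "M \<ge> 1" "i < M" "degree Q < M" by (auto simp: M_def)
  let ?w = "circ_root M"
  have w0: "?w j \<noteq> 0" for j by simp
  have geo: "(\<Sum>m<M. (?w j / ?w i) ^ m) = (if j = i then of_nat M else 0)" if "j \<le> degree Q" for j
  proof (cases "j = i")
    case False
    have "?w j \<noteq> ?w i"
      using complex_root_unity_eq[OF M(1), of j i] False that M by auto
    then have ne: "?w j / ?w i \<noteq> 1" by simp
    have "?w j ^ M = 1" for j
      using M(1) by (subst circ_root_power) (simp add: exp_eq_1 flip: exp_of_nat_mult)
    then have "(?w j / ?w i) ^ M = 1" by (simp only: power_divide) simp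
    then show ?thesis using ne False by (simp only: geometric_sum[OF ne]) simp
  qed simp
  have "(\<Sum>m<M. poly Q (?w m) / ?w m ^ i) = (\<Sum>m<M. \<Sum>j\<le>degree Q. coeff Q j * (?w j / ?w i) ^ m)"
    unfolding poly_altdef sum_divide_distrib
    by (intro sum.cong refl) (simp only: power_divide circ_root_power[of M _ i] circ_root_power[of M i] times_divide_eq_right circ_root_power[of M], metis circ_root_power)
  also have "\<dots> = (\<Sum>j\<le>degree Q. coeff Q j * (\<Sum>m<M. (?w j / ?w i) ^ m))"
    by (subst sum.swap) (simp only: sum_distrib_left)
  also have "\<dots> = (\<Sum>j\<le>degree Q. coeff Q j * (if j = i then of_nat M else 0))"
    by (intro sum.cong refl) (use geo in \<open>simp only: atMost_iff\<close>)
  also have "\<dots> = coeff Q i * of_nat M"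
    by (cases "i \<le> degree Q") (simp_all add: if_distrib cong: if_cong, simp add: coeff_eq_0)
  finally have eq: "coeff Q i * of_nat M = (\<Sum>m<M. poly Q (?w m) / ?w m ^ i)" ..
  have "cmod (coeff Q i) * M = cmod (coeff Q i * of_nat M)" by (simp add: norm_mult)
  also have "\<dots> \<le> (\<Sum>m<M. cmod (poly Q (?w m) / ?w m ^ i))" unfolding eq by (rule norm_sum)
  also have "\<dots> \<le> (\<Sum>m<M. B)"
  proof (rule sum_mono)
    fix m
    have "cmod (poly Q (?w m) / ?w m ^ i) = cmod (poly Q (?w m))"
      by (simp only: norm_divide norm_power cmod_circ_root) simp
    then show "cmod (poly Q (?w m) / ?w m ^ i) \<le> B" using B[OF cmod_circ_root] by simp
  qed
  finally show ?thesis using M(1) by simp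
qed

text \<open>Horner evaluation of \<open>p(a) x\<close>. Acting on \<open>x\<close> gives the
  constant term a meaning although the algebra may lack a unit.\<close>

definition pact :: "real poly \<Rightarrow> 'a \<Rightarrow> 'a \<Rightarrow> 'a::cstar_algebra" where
  "pact p a x = fold_coeffs (\<lambda>c y. c *\<^sub>R x + a * y) p 0"

lemma pact_0 [simp]: "pact 0 a x = 0"
  by (simp add: pact_def)

lemma pact_pCons [simp]: "pact (pCons c p) a x = c *\<^sub>R x + a * pact p a x"
  by (cases "c = 0 \<and> p = 0") (auto simp: pact_def fold_coeffs_pCons_not_0_0_eq)

lemma pact_add: "pact (p + q) a x = pact p a x + pact q a x"
  by (induct p q rule: poly_induct2) (simp_all add: algebra_simps)

lemma pact_smult: "pact (smult c p) a x = c *\<^sub>R pact p a x"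
  by (induct p) (simp_all add: algebra_simps)

lemma pact_minus: "pact (- p) a x = - pact p a x"
  using pact_smult[of "-1" p a x] by simp

lemma pact_diff: "pact (p - q) a x = pact p a x - pact q a x"
  using pact_add[of p "- q" a x] by (simp add: pact_minus)

lemma pact_scaleR_right: "pact p a (r *\<^sub>R x) = r *\<^sub>R pact p a x"
  by (induct p) (simp_all add: algebra_simps)

lemma pact_zero_right [simp]: "pact p a 0 = 0"
  using pact_scaleR_right[of p a 0 0] by simp

lemma pact_times_right: "pact p a (x * y) = pact p a x * y"
  by (induct p) (simp_all add: algebra_simps)

lemma pact_commute: "a * pact p a x = pact p a (a * x)"
  by (induct p) (simp_all add: algebra_simps)

lemma pact_mult: "pact (p * q) a x = pact p a (pact q a x)"
  by (induct p) (simp_all add: algebra_simps pact_add pact_smult)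

text \<open>For the algebra-valued inner product \<open>adj x * y\<close> a real polynomial in a
  self-adjoint element is symmetric.\<close>

lemma pact_adj: "adj a = a \<Longrightarrow> adj (pact p a x) * y = adj x * pact p a y"
proof (induct p arbitrary: y)
  case 0 then show ?case by (simp add: adj_zero)
next
  case (pCons c p)
  have "adj (pact p a x) * (a * y) = adj x * (a * pact p a y)"
    using pCons.hyps(2)[OF pCons.prems, of "a * y"] by (simp add: pact_commute)
  then show ?case using pCons.prems
    by (simp add: adj_add adj_scaleR adj_mult algebra_simps)
qed

text \<open>By the C*-identity and the symmetry of \<open>p(a)\<close>. Iterated, this passes from
  \<open>p\<close> to its powers \<open>p ^ (2 ^ k)\<close>.\<close>

lemma norm_pact_square_le:
  assumes "adj a = a"
  shows "(norm (pact p a x))\<^sup>2 \<le> norm x * norm (pact (p * p) a x)"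
proof -
  have "(norm (pact p a x))\<^sup>2 = norm (adj x * pact (p * p) a x)"
    using pact_adj[OF assms, of p x "pact p a x"] by (simp add: pact_mult flip: cstar_identity)
  also have "\<dots> \<le> norm (adj x) * norm (pact (p * p) a x)" by (rule norm_mult_ineq)
  finally show ?thesis by (simp add: norm_adj)
qed

text \<open>
  With \<open>s = 1 - \<sigma>\<close> the hypothesis on \<open>\<sigma>\<close> says \<open>a\<^sup>2 + s\<^sup>2 = 1\<close>, so the operators are multiplication
  by the unitaries \<open>a \<plusminus> \<i> s\<close> of the unitization.
\<close>

lemma cos_sin_isometry:
  fixes a \<sigma> x :: "'a::cstar_algebra"
  assumes a: "adj a = a" and s: "adj \<sigma> = \<sigma>" and c: "a * \<sigma> = \<sigma> * a"
    and e: "\<sigma> + \<sigma> = a * a + \<sigma> * \<sigma>" and j: "cnj j = - j" "j * j = -1"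
  shows "norm (a * x + j *\<^sub>C (x - \<sigma> * x)) = norm x"
proof -
  define u where "u = a * x"
  define v where "v = x - \<sigma> * x"
  have uv: "adj u * v = adj v * u"
    unfolding u_def v_def using a s c
    by (simp add: adj_mult adj_minus algebra_simps) (metis mult.assoc)
  have "adj (u + j *\<^sub>C v) * (u + j *\<^sub>C v) = adj u * u + adj v * v"
    using j uv
    by (simp add: adj_add adj_scaleC distrib_left distrib_right mult_scaleC_left mult_scaleC_right
        left_diff_distrib right_diff_distrib scaleC_diff_right scaleC_scaleC scaleC_minus_left scaleC_one)
  also have "\<dots> = adj x * (a * a + \<sigma> * \<sigma>) * x + adj x * x - adj x * (\<sigma> + \<sigma>) * x"
    unfolding u_def v_def using a s by (simp add: adj_mult adj_minus algebra_simps)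
  also have "\<dots> = adj x * x" by (simp add: e)
  finally have "(norm (u + j *\<^sub>C v))\<^sup>2 = (norm x)\<^sup>2" by (metis cstar_identity)
  then show ?thesis by (simp add: u_def v_def power2_eq_iff_nonneg)
qed

text \<open>The square root of \<open>1 - a * a\<close> lies only in the unitization, but
  \<open>1\<close> minus it lies in the algebra: it is a fixed point of the map sending
  \<open>s\<close> to half of \<open>a * a + s * s\<close>, a contraction on the self-adjoint
  elements that commute with \<open>a\<close> and have norm at most
  \<open>(norm a)^2\<close>.\<close>

lemma exists_one_minus_sqrt:
  fixes a :: "'a::cstar_algebra"
  assumes a: "adj a = a" and n: "norm a < 1"
  obtains \<sigma> where "adj \<sigma> = \<sigma>" "a * \<sigma> = \<sigma> * a" "\<sigma> + \<sigma> = a * a + \<sigma> * \<sigma>"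
proof -
  define \<rho> where "\<rho> = (norm a)\<^sup>2"
  have \<rho>: "0 \<le> \<rho>" "\<rho> < 1" using n by (auto simp: \<rho>_def power_less_one_iff abs_square_less_1)
  define S where "S = {\<sigma>. adj \<sigma> = \<sigma> \<and> a * \<sigma> = \<sigma> * a \<and> norm \<sigma> \<le> \<rho>}"
  define f where "f \<sigma> = (1/2) *\<^sub>R (a * a + \<sigma> * \<sigma>)" for \<sigma>
  have "closed S" unfolding S_def
    by (intro closed_Collect_conj closed_Collect_eq closed_Collect_le continuous_intros
        bounded_linear.continuous_on[OF bounded_linear_adj])
  then have cS: "complete S" by (simp add: complete_eq_closed)
  have "0 \<in> S" using \<rho> by (simp add: S_def adj_zero)
  then have ne: "S \<noteq> {}" by blast
  have fS: "f ` S \<subseteq> S"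
  proof
    fix y assume "y \<in> f ` S"
    then obtain s where s: "y = f s" "adj s = s" "a * s = s * a" "norm s \<le> \<rho>" by (auto simp: S_def)
    have "norm s * norm s \<le> \<rho> * 1" using s(4) \<rho> by (intro mult_mono) auto
    moreover have "norm (a * a + s * s) \<le> \<rho> + norm s * norm s"
      using norm_triangle_ineq[of "a * a" "s * s"] norm_mult_ineq[of s s] norm_mult_ineq[of a a]
      by (simp add: \<rho>_def power2_eq_square)
    ultimately have "norm y \<le> \<rho>" by (simp add: s f_def)
    moreover have "adj y = y" using s a by (simp add: f_def adj_scaleR adj_add adj_mult)
    moreover have "a * (s * s) = (s * s) * a" by (metis s(3) mult.assoc)
    then have "a * y = y * a" by (simp add: s f_def algebra_simps)
    ultimately show "y \<in> S" by (simp add: S_def)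
  qed
  have lip: "dist (f s) (f t) \<le> \<rho> * dist s t" if "s \<in> S" "t \<in> S" for s t
  proof -
    have "f s - f t = (1/2) *\<^sub>R (s * (s - t) + (s - t) * t)"
      by (simp add: f_def algebra_simps)
    then have "norm (f s - f t) \<le> (1/2) * (norm s * norm (s - t) + norm (s - t) * norm t)"
      using norm_triangle_ineq[of "s * (s - t)" "(s - t) * t"]
        norm_mult_ineq[of s "s - t"] norm_mult_ineq[of "s - t" t] by simp
    also have "\<dots> \<le> (1/2) * (\<rho> * norm (s - t) + norm (s - t) * \<rho>)"
      using that by (intro mult_left_mono add_mono mult_mono) (auto simp: S_def \<rho>)
    finally show ?thesis by (simp add: dist_norm algebra_simps)
  qed
  obtain s where s: "s \<in> S" "f s = s"
    using Banach_fix[OF cS ne \<rho>(1,2) fS] lip by blast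
  have "s + s = 2 *\<^sub>R f s" by (simp add: s scaleR_2)
  then have "s + s = a * a + s * s" by (simp add: f_def)
  with s that show thesis by (auto simp: S_def)
qed

text \<open>Polynomials in an operator \<open>U\<close>, because the unitary is available only
  through its isometric action on the algebra.\<close>

definition cact :: "complex poly \<Rightarrow> ('a \<Rightarrow> 'a) \<Rightarrow> 'a \<Rightarrow> 'a::cstar_algebra" where
  "cact p U x = fold_coeffs (\<lambda>c y. c *\<^sub>C x + U y) p 0"

context
  fixes U :: "'a::cstar_algebra \<Rightarrow> 'a"
  assumes U_add: "U (x + y) = U x + U y" and U_scaleC: "U (c *\<^sub>C x) = c *\<^sub>C U x"
begin

lemma cact_0 [simp]: "cact 0 U x = 0"
  by (simp add: cact_def)

lemma cact_pCons [simp]: "cact (pCons c p) U x = c *\<^sub>C x + U (cact p U x)"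
proof (cases "c = 0 \<and> p = 0")
  case True
  have "U 0 = 0" using U_scaleC[of 0 0] by (simp add: scaleC_zero_left)
  with True show ?thesis by (simp add: scaleC_zero_left)
qed (auto simp: cact_def fold_coeffs_pCons_not_0_0_eq)

lemma cact_add: "cact (p + q) U x = cact p U x + cact q U x"
  by (induct p q rule: poly_induct2) (simp_all add: U_add scaleC_add_left)

lemma cact_smult: "cact (smult c p) U x = c *\<^sub>C cact p U x"
  by (induct p) (simp_all add: scaleC_zero U_scaleC scaleC_add_right scaleC_scaleC)

lemma cact_monom: "cact (monom c n) U x = c *\<^sub>C (U ^^ n) x"
proof (induct n)
  case 0
  have "U 0 = 0" using U_scaleC[of 0 0] by (simp add: scaleC_zero_left)
  then show ?case by (simp add: monom_0)
qed (simp add: monom_Suc U_scaleC scaleC_zero_left)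

lemma funpow_U_add: "(U ^^ n) (x + y) = (U ^^ n) x + (U ^^ n) y"
  and funpow_U_scaleC: "(U ^^ n) (c *\<^sub>C x) = c *\<^sub>C (U ^^ n) x"
  by (induct n) (simp_all add: U_add U_scaleC)

lemma norm_cact_le:
  assumes "\<And>x. norm (U x) = norm x"
  shows "degree p \<le> n \<Longrightarrow> (\<And>i. cmod (coeff p i) \<le> B) \<Longrightarrow> norm (cact p U x) \<le> real (Suc n) * B * norm x"
proof (induct n arbitrary: p)
  case 0
  then obtain c where p: "p = [:c:]" by (metis degree_0_id le_zero_eq)
  have "U 0 = 0" using U_scaleC[of 0 0] by (simp add: scaleC_zero_left)
  then show ?case using 0(2)[of 0] by (simp add: p norm_scaleC mult_right_mono)
next
  case (Suc n)
  obtain c q where p: "p = pCons c q" by (cases p)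
  have "degree q \<le> n" using Suc.prems(1) by (auto simp: p split: if_splits)
  moreover have "cmod (coeff q i) \<le> B" for i using Suc.prems(2)[of "Suc i"] by (simp add: p)
  ultimately have "norm (cact q U x) \<le> real (Suc n) * B * norm x" by (rule Suc.hyps)
  moreover have "cmod c * norm x \<le> B * norm x"
    using Suc.prems(2)[of 0] by (intro mult_right_mono) (auto simp: p)
  ultimately show ?case
    using norm_triangle_ineq[of "c *\<^sub>C x" "U (cact q U x)"]
    by (simp add: p assms norm_scaleC algebra_simps)
qed

end

text \<open>The hypothesis \<open>aU\<close> says that \<open>a\<close> acts as the real part of
  \<open>U\<close>, multiplied by \<open>U\<close> to avoid an inverse. On the circle the real part
  of \<open>z\<close> is \<open>(z + 1/z) / 2\<close>, so the values of \<open>Q\<close> obey the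
  same recursion.\<close>

lemma funpow_pact_eq_cact:
  fixes a :: "'a::cstar_algebra"
  assumes U: "\<And>x y. U (x + y) = U x + U y" "\<And>c x. U (c *\<^sub>C x) = c *\<^sub>C U x"
    and aU: "\<And>x. U (a * x) = (1/2) *\<^sub>C (U (U x) + x)"
  shows "degree p \<le> N \<Longrightarrow> \<exists>Q. degree Q \<le> 2 * N \<and>
    (\<forall>z. cmod z = 1 \<longrightarrow> poly Q z = z ^ N * of_real (poly p (Re z))) \<and>
    (\<forall>x. (U ^^ N) (pact p a x) = cact Q U x)"
proof (induct N arbitrary: p)
  case 0
  then obtain c where p: "p = [:c:]" by (metis degree_0_id le_zero_eq)
  have "U 0 = 0" using U(2)[of 0 0] by (simp add: scaleC_zero_left)
  then show ?case
    by (intro exI[of _ "[:of_real c:]"]) (simp add: p cact_pCons[OF U] cact_0[OF U] scaleR_scaleC)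
next
  case (Suc N)
  obtain c q where p: "p = pCons c q" by (cases p)
  have "degree q \<le> N" using Suc.prems(1) by (auto simp: p split: if_splits)
  then obtain Q where Q: "degree Q \<le> 2 * N"
    "\<And>z. cmod z = 1 \<Longrightarrow> poly Q z = z ^ N * of_real (poly q (Re z))"
    "\<And>x. (U ^^ N) (pact q a x) = cact Q U x"
    using Suc.hyps by blast
  \<comment> \<open>From
    \<open>U^(N+1) (c + a q(a)) = c U^(N+1) + (1 + U^2) / 2 U^N q(a)\<close>.\<close>
  define Q' where "Q' = monom (of_real c) (Suc N) + (smult (1/2) Q + pCons 0 (pCons 0 (smult (1/2) Q)))"
  have d: "degree Q' \<le> 2 * Suc N"
    unfolding Q'_def
    by (intro degree_add_le order_trans[OF degree_monom_le] order_trans[OF degree_smult_le]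
        order_trans[OF degree_pCons_le] Suc_leI le_imp_less_Suc) (use Q(1) degree_smult_le[of "1/2" Q] in auto)
  have z: "poly Q' z = z ^ Suc N * of_real (poly p (Re z))" if z: "cmod z = 1" for z
  proof -
    have "z * cnj z = 1" using z by (simp add: complex_norm_square[symmetric])
    moreover have "complex_of_real (Re z) = (z + cnj z) / 2" by (simp add: complex_add_cnj)
    ultimately have "z * of_real (Re z) = 1/2 + z * z / 2" by (simp add: field_simps)
    moreover have "poly Q' z = of_real c * z ^ Suc N + (1/2 + z * z / 2) * (z ^ N * of_real (poly q (Re z)))"
      by (simp add: Q'_def Q(2)[OF z] poly_monom field_simps)
    ultimately have "poly Q' z = of_real c * z ^ Suc N + (z * of_real (Re z)) * (z ^ N * of_real (poly q (Re z)))"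
      by (simp only:)
    then show ?thesis
      by (simp add: p algebra_simps)
  qed
  have "(U ^^ Suc N) (pact p a x) = cact Q' U x" for x
  proof -
    let ?y = "pact q a x"
    have "(U ^^ Suc N) (pact p a x) = (U ^^ Suc N) (of_real c *\<^sub>C x) + (U ^^ N) (U (a * ?y))"
      by (simp only: p pact_pCons scaleR_scaleC funpow_U_add[OF U] funpow_Suc_right o_apply U(1))
    also have "\<dots> = of_real c *\<^sub>C (U ^^ Suc N) x + (1/2) *\<^sub>C (U (U ((U ^^ N) ?y)) + (U ^^ N) ?y)"
      by (simp add: aU funpow_U_add[OF U] funpow_U_scaleC[OF U] funpow_swap1 U)
    also have "\<dots> = cact Q' U x"
      by (simp add: Q'_def cact_add[OF U] cact_monom[OF U] cact_smult[OF U] cact_pCons[OF U] Q(3) U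
          scaleC_add_right scaleC_zero_left)
    finally show ?thesis .
  qed
  with d z show ?case by blast
qed

lemma norm_pact_le_degree:
  fixes a :: "'a::cstar_algebra"
  assumes a: "adj a = a" "norm a < 1" and S: "\<And>t. \<bar>t\<bar> \<le> 1 \<Longrightarrow> \<bar>poly p t\<bar> \<le> S"
    and N: "degree p \<le> N"
  shows "norm (pact p a x) \<le> (2 * real N + 1) * S * norm x"
proof -
  obtain \<sigma> where \<sigma>: "adj \<sigma> = \<sigma>" "a * \<sigma> = \<sigma> * a" "\<sigma> + \<sigma> = a * a + \<sigma> * \<sigma>"
    using exists_one_minus_sqrt[OF a] .
  define U where "U x = a * x + \<i> *\<^sub>C (x - \<sigma> * x)" for x
  have U: "U (x + y) = U x + U y" "U (c *\<^sub>C x) = c *\<^sub>C U x" for c x y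
    by (simp_all add: U_def algebra_simps scaleC_add_right scaleC_diff_right scaleC_scaleC mult_scaleC_right)
  have iso: "norm (U x) = norm x" for x
    unfolding U_def by (rule cos_sin_isometry[OF a(1) \<sigma>]) auto
  have aU: "U (a * x) = (1/2) *\<^sub>C (U (U x) + x)" for x
  proof -
    \<comment> \<open>\<open>v\<close> is \<open>s x\<close> for the square root \<open>s\<close> of
      \<open>1 - a a\<close>. Thus \<open>U (U x) = a a x + 2 i a s x - s s x\<close>, and
      \<open>s s = 1 - a a\<close> turns this into \<open>2 U (a x) - x\<close>.\<close>
    define v where "v = x - \<sigma> * x"
    have av: "a * v = a * x - \<sigma> * (a * x)" using \<sigma>(2)
      by (simp add: v_def right_diff_distrib flip: mult.assoc)
    have vv: "v - \<sigma> * v = x - a * (a * x)"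
    proof -
      have "v - \<sigma> * v = x - (\<sigma> + \<sigma>) * x + \<sigma> * \<sigma> * x" by (simp add: v_def algebra_simps)
      then show ?thesis by (simp add: \<sigma>(3) algebra_simps)
    qed
    have "U (U x) = a * (a * x) + \<i> *\<^sub>C (a * v) + \<i> *\<^sub>C (a * x - \<sigma> * (a * x)) + (\<i> * \<i>) *\<^sub>C (v - \<sigma> * v)"
      by (simp add: U_def v_def[symmetric] distrib_left mult_scaleC_right scaleC_add_right
          scaleC_diff_right scaleC_scaleC algebra_simps scaleC_minus_left)
    also have "\<dots> = 2 *\<^sub>R U (a * x) - x"
      unfolding av vv by (simp add: U_def scaleC_minus_left scaleC_one algebra_simps scaleR_2)
    finally show ?thesis by (simp add: scaleR_scaleC scaleC_scaleC scaleC_one)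
  qed
  obtain Q where Q: "degree Q \<le> 2 * N"
    "\<And>z. cmod z = 1 \<Longrightarrow> poly Q z = z ^ N * of_real (poly p (Re z))"
    "\<And>x. (U ^^ N) (pact p a x) = cact Q U x"
    using funpow_pact_eq_cact[OF U aU N] by blast
  have "cmod (coeff Q i) \<le> S" for i
  proof (rule coeff_le_sup_circle)
    fix z assume z: "cmod z = 1"
    then show "cmod (poly Q z) \<le> S"
      using S[of "Re z"] abs_Re_le_cmod[of z] by (simp add: Q(2)[OF z] norm_mult norm_power)
  qed
  then have "norm (cact Q U x) \<le> real (Suc (2 * N)) * S * norm x"
    by (rule norm_cact_le[OF U iso Q(1)])
  moreover have "norm ((U ^^ n) y) = norm y" for n y by (induct n) (auto simp: iso)
  then have "norm (cact Q U x) = norm (pact p a x)" by (simp flip: Q(3))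
  ultimately show ?thesis by (simp add: add.commute)
qed

text \<open>Otherwise \<open>(r / S) ^ (2 ^ k)\<close> would grow at most linearly in
  \<open>2 ^ k\<close>. This removes factors that come from degrees, and later from the number of
  orthogonal summands.\<close>

lemma le_if_powers_le_linear:
  fixes r S C :: real
  assumes "0 \<le> r" "0 \<le> S" and le: "\<And>k. r ^ (2 ^ k) \<le> (C * 2 ^ k + 1) * S ^ (2 ^ k)"
  shows "r \<le> S"
proof (rule ccontr)
  assume "\<not> r \<le> S"
  then have rS: "S < r" by simp
  show False
  proof (cases "S = 0")
    case True
    then show False using le[of 0] rS by simp
  next
    case False
    then have S: "S > 0" using assms by simp
    define q where "q = r / S"
    have q: "q > 1" using rS S by (simp add: q_def)
    have "(\<lambda>n. C * (real n / q ^ n) + inverse (q ^ n)) \<longlonglongrightarrow> C * 0 + 0"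
      using q by (intro tendsto_intros lim_n_over_pown LIMSEQ_inverse_realpow_zero) auto
    then have "\<forall>\<^sub>F n in sequentially. C * (real n / q ^ n) + inverse (q ^ n) < 1"
      by (rule order_tendstoD) simp
    then obtain N where N: "\<And>n. n \<ge> N \<Longrightarrow> C * (real n / q ^ n) + inverse (q ^ n) < 1"
      by (auto simp: eventually_sequentially)
    have "q ^ (2 ^ N) \<le> C * 2 ^ N + 1"
      using le[of N] S by (simp add: q_def power_divide divide_le_eq)
    moreover have "C * (real (2 ^ N) / q ^ (2 ^ N)) + inverse (q ^ (2 ^ N)) < 1"
      by (rule N) (simp add: less_imp_le)
    moreover have "q ^ (2 ^ N) > 0" using q by simp
    ultimately have "(C * 2 ^ N + 1) / q ^ (2 ^ N) < 1" "q ^ (2 ^ N) \<le> C * 2 ^ N + 1" "q ^ (2 ^ N) > 0"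
      by (simp_all add: add_divide_distrib inverse_eq_divide)
    then show False by (simp add: divide_less_eq)
  qed
qed

lemma norm_pact_le_unit:
  fixes a :: "'a::cstar_algebra"
  assumes a: "adj a = a" "norm a < 1" and S: "\<And>t. \<bar>t\<bar> \<le> 1 \<Longrightarrow> \<bar>poly p t\<bar> \<le> S"
    and x: "norm x \<le> 1"
  shows "norm (pact p a x) \<le> S"
proof (rule le_if_powers_le_linear)
  have S0: "0 \<le> S" using S[of 0] by simp
  then show "0 \<le> S" .
  fix k :: nat
  have "norm (pact p a x) ^ (2 ^ k) \<le> norm (pact (p ^ (2 ^ k)) a x)"
  proof (induct k)
    case (Suc k)
    have "norm (pact p a x) ^ (2 ^ Suc k) = (norm (pact p a x) ^ (2 ^ k))\<^sup>2"
      by (simp flip: power_mult add: mult.commute)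
    also have "\<dots> \<le> (norm (pact (p ^ (2 ^ k)) a x))\<^sup>2" using Suc by (intro power_mono) auto
    also have "\<dots> \<le> norm x * norm (pact (p ^ (2 ^ k) * p ^ (2 ^ k)) a x)"
      by (rule norm_pact_square_le[OF a(1)])
    also have "\<dots> \<le> norm (pact (p ^ (2 ^ k) * p ^ (2 ^ k)) a x)"
      using x by (intro mult_left_le_one_le) auto
    finally show ?case by (simp flip: power_add add: mult_2)
  qed simp
  also have "\<dots> \<le> (2 * real (degree p * 2 ^ k) + 1) * S ^ (2 ^ k) * norm x"
  proof (rule norm_pact_le_degree[OF a])
    show "\<bar>poly (p ^ (2 ^ k)) t\<bar> \<le> S ^ (2 ^ k)" if "\<bar>t\<bar> \<le> 1" for t
      using power_mono[OF S[OF that], of "2 ^ k"] by (simp add: poly_power power_abs)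
    show "degree (p ^ 2 ^ k) \<le> degree p * 2 ^ k" by (rule degree_power_le)
  qed
  also have "\<dots> \<le> (2 * real (degree p * 2 ^ k) + 1) * S ^ (2 ^ k) * 1"
    using x S0 by (intro mult_left_mono) auto
  finally show "norm (pact p a x) ^ 2 ^ k \<le> ((2 * real (degree p)) * 2 ^ k + 1) * S ^ 2 ^ k"
    by (simp add: mult.assoc)
qed auto

lemma pact_pcompose_scale: "pact (pcompose p [:0, r:]) a x = pact p (r *\<^sub>R a) x"
proof (induct p)
  case (pCons c p)
  then show ?case by (simp add: pcompose_pCons pact_add pact_smult)
qed simp

text \<open>Rescale \<open>a\<close> to a strict contraction and \<open>x\<close> to norm one. The
  strict bound \<open>norm a < \<rho>\<close> is what makes the fixed-point iteration for the square
  root contract.\<close>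

theorem norm_pact_le:
  fixes a :: "'a::cstar_algebra"
  assumes a: "adj a = a" "norm a < \<rho>" and S: "\<And>t. \<bar>t\<bar> \<le> \<rho> \<Longrightarrow> \<bar>poly p t\<bar> \<le> S"
  shows "norm (pact p a x) \<le> S * norm x"
proof (cases "x = 0")
  case False
  have \<rho>: "\<rho> > 0" using a(2) norm_ge_zero[of a] by linarith
  have "norm (pact (pcompose p [:0, \<rho>:]) ((1 / \<rho>) *\<^sub>R a) ((1 / norm x) *\<^sub>R x)) \<le> S"
  proof (rule norm_pact_le_unit)
    show "\<bar>poly (pcompose p [:0, \<rho>:]) t\<bar> \<le> S" if "\<bar>t\<bar> \<le> 1" for t
      using S[of "\<rho> * t"] that \<rho> by (simp add: poly_pcompose abs_mult mult.commute)
  qed (use a \<rho> False in \<open>auto simp: adj_scaleR\<close>)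
  then show ?thesis using False \<rho>
    by (simp add: pact_pcompose_scale pact_scaleR_right field_simps)
qed simp

text \<open>Test on \<open>adj y\<close> and use the C*-identity.\<close>

lemma norm_le_if_norm_mult_le:
  fixes y :: "'a::cstar_algebra"
  assumes "\<And>x. norm (y * x) \<le> B * norm x" "0 \<le> B"
  shows "norm y \<le> B"
proof (cases "y = 0")
  case False
  have "norm (adj y) * norm (adj y) \<le> B * norm (adj y)"
    using assms(1)[of "adj y"] cstar_identity[of "adj y"] by (simp add: adj_adj power2_eq_square)
  then show ?thesis using False by (simp add: norm_adj)
qed (use assms in simp)

text \<open>For a self-adjoint strict contraction \<open>a\<close>, the map \<open>h\<close> carries
  the equation for the square root along, so \<open>h a\<close> acts as the mean of two isometries
  and has norm at most one. Scaling and the C*-identity give the general case.\<close>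

lemma star_hom_contractive:
  fixes h :: "'a::cstar_algebra \<Rightarrow> 'b::cstar_algebra"
  assumes add: "\<And>x y. h (x + y) = h x + h y" and sc: "\<And>c x. h (c *\<^sub>C x) = c *\<^sub>C h x"
    and mult: "\<And>x y. h (x * y) = h x * h y" and adj: "\<And>x. h (adj x) = adj (h x)"
  shows "norm (h x) \<le> norm x"
proof -
  have scR: "h (r *\<^sub>R x) = r *\<^sub>R h x" for r x by (simp add: scaleR_scaleC sc)
  have unit: "norm (h a) \<le> 1" if a: "adj a = a" "norm a < 1" for a
  proof -
    obtain \<sigma> where \<sigma>: "adj \<sigma> = \<sigma>" "a * \<sigma> = \<sigma> * a" "\<sigma> + \<sigma> = a * a + \<sigma> * \<sigma>"
      using exists_one_minus_sqrt[OF a] .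
    have h: "adj (h a) = h a" "adj (h \<sigma>) = h \<sigma>" "h a * h \<sigma> = h \<sigma> * h a" "h \<sigma> + h \<sigma> = h a * h a + h \<sigma> * h \<sigma>"
      using \<sigma> a by (simp_all flip: add mult adj)
    show ?thesis
    proof (rule norm_le_if_norm_mult_le)
      fix x
      let ?y = "x - h \<sigma> * x"
      have "norm (h a * x + \<i> *\<^sub>C ?y) = norm x" "norm (h a * x + (- \<i>) *\<^sub>C ?y) = norm x"
        by (rule cos_sin_isometry[OF h]; simp)+
      then have "norm ((h a * x + \<i> *\<^sub>C ?y) + (h a * x + (- \<i>) *\<^sub>C ?y)) \<le> norm x + norm x"
        by (metis norm_triangle_ineq)
      moreover have "(h a * x + \<i> *\<^sub>C ?y) + (h a * x + (- \<i>) *\<^sub>C ?y) = 2 *\<^sub>R (h a * x)"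
        by (simp add: scaleC_minus_left scaleR_2)
      ultimately show "norm (h a * x) \<le> 1 * norm x" by simp
    qed simp
  qed
  have sa: "norm (h a) \<le> norm a" if a: "adj a = a" for a
  proof (rule field_le_epsilon)
    fix e :: real assume e: "e > 0"
    define r where "r = norm a + e"
    have r: "r > 0" "norm a < r" using e by (auto simp: r_def intro: add_nonneg_pos)
    have "norm (h ((1 / r) *\<^sub>R a)) \<le> 1"
      by (rule unit) (use a r in \<open>auto simp: adj_scaleR\<close>)
    then show "norm (h a) \<le> norm a + e" using r by (simp add: scR field_simps r_def)
  qed
  have "(norm (h x))\<^sup>2 = norm (h (adj x * x))" by (simp add: mult adj cstar_identity)
  also have "\<dots> \<le> norm (adj x * x)" by (rule sa) (simp add: adj_mult adj_adj)
  finally have "(norm (h x))\<^sup>2 \<le> (norm x)\<^sup>2" by (simp add: cstar_identity)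
  then show ?thesis by (rule power2_le_imp_le) simp
qed


section \<open>Continuous functional calculus\<close>

text \<open>\<open>pev q a\<close> is the value at \<open>a\<close> of the polynomial \<open>t * q(t)\<close>, which needs no unit.\<close>

definition pev :: "real poly \<Rightarrow> 'a::cstar_algebra \<Rightarrow> 'a" where
  "pev q a = pact q a a"

lemma pev_add: "pev (p + q) a = pev p a + pev q a"
  and pev_diff: "pev (p - q) a = pev p a - pev q a"
  and pev_smult: "pev (smult c p) a = c *\<^sub>R pev p a"
  by (simp_all add: pev_def pact_add pact_diff pact_smult)

lemma pev_mult: "pev (pCons 0 (p * q)) a = pev p a * pev q a"
  by (simp add: pev_def pact_mult pact_commute flip: pact_times_right)

lemma pact_intertwine:
  assumes "a * t = t * b"
  shows "pact q a (t * x) = t * pact q b x"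
proof (induct q)
  case (pCons c q)
  then show ?case
    using assms by (simp add: algebra_simps) (metis mult.assoc)
qed simp

lemma pev_intertwine: "a * t = t * b \<Longrightarrow> pev q a * t = t * pev q b"
  by (simp add: pev_def pact_intertwine flip: pact_times_right)

lemma pev_adj: "adj a = a \<Longrightarrow> adj (pev q a) = pev q a"
proof (induct q)
  case 0 then show ?case by (simp add: pev_def adj_zero)
next
  case (pCons c q)
  have "a * pact q a a = pact q a a * a"
    by (simp add: pact_commute pact_times_right)
  with pCons show ?case by (simp add: pev_def adj_add adj_mult adj_scaleR)
qed

lemma pev_uminus: "pev q (- a) = pev (- pcompose q [:0, -1:]) a"
proof -
  have "pact (pcompose q [:0, -1:]) a x = pact q (- a) x" for x
    using pact_pcompose_scale[of q "-1" a x] by simp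
  moreover have "pact q (- a) (- a) = - pact q (- a) a"
    using pact_scaleR_right[of q "- a" "-1" a] by simp
  ultimately show ?thesis by (simp add: pev_def pact_minus)
qed

lemma norm_pev_le:
  fixes a :: "'a::cstar_algebra"
  assumes a: "adj a = a" "norm a < \<rho>" and S: "\<And>t. \<bar>t\<bar> \<le> \<rho> \<Longrightarrow> \<bar>t * poly q t\<bar> \<le> S"
  shows "norm (pev q a) \<le> S"
proof (rule norm_le_if_norm_mult_le)
  show "0 \<le> S" using S[of 0] a(2) norm_ge_zero[of a] by (simp del: norm_ge_zero)
  have "pev q a * x = pact (pCons 0 q) a x" for x
    by (simp add: pev_def pact_commute flip: pact_times_right)
  then show "norm (pev q a * x) \<le> S * norm x" for x
    using norm_pact_le[OF a, of "pCons 0 q" S x] S by simp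
qed

definition approx_on :: "real \<Rightarrow> (nat \<Rightarrow> real poly) \<Rightarrow> (real \<Rightarrow> real) \<Rightarrow> bool" where
  "approx_on R q f \<longleftrightarrow> uniform_limit {-R..R} (\<lambda>n t. t * poly (q n) t) f sequentially"

text \<open>Vanishing at 0 allows approximation by polynomials without constant term, the only ones
  with values in a nonunital algebra.\<close>

definition fc_fun :: "(real \<Rightarrow> real) \<Rightarrow> bool" where
  "fc_fun f \<longleftrightarrow> continuous_on UNIV f \<and> f 0 = 0"

lemma exists_approx_on:
  assumes f: "fc_fun f" and R: "0 \<le> R"
  shows "\<exists>q. approx_on R q f"
proof -
  have "\<exists>q. \<forall>t\<in>{-R..R}. \<bar>f t - t * poly q t\<bar> < e" if e: "e > 0" for e
  proof -
    have c: "continuous_on {-R..R} f"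
      using f continuous_on_subset unfolding fc_fun_def by blast
    \<comment> \<open>Half of \<open>e\<close>, since dropping the constant term \<open>p 0\<close>,
      which is close to \<open>f 0 = 0\<close>, costs another half.\<close>
    obtain p where p: "real_polynomial_function p" "\<And>t. t \<in> {-R..R} \<Longrightarrow> \<bar>f t - p t\<bar> < e / 2"
      using Stone_Weierstrass_real_polynomial_function[OF compact_Icc c, of "e / 2"] e by auto
    obtain c n where pn: "p = (\<lambda>x. \<Sum>i\<le>n. c i * x ^ i)"
      using p(1) unfolding real_polynomial_function_iff_sum by blast
    define P where "P = (\<Sum>i\<le>n. monom (c i) i)"
    have P: "poly P t = p t" for t by (simp add: P_def pn poly_sum poly_monom)
    obtain d q where Pq: "P = pCons d q" by (cases P)
    have "\<bar>f t - t * poly q t\<bar> < e" if "t \<in> {-R..R}" for t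
    proof -
      have "p t = p 0 + t * poly q t" by (simp add: Pq flip: P)
      moreover have "\<bar>f 0 - p 0\<bar> < e / 2" "\<bar>f t - p t\<bar> < e / 2" using p(2) that R by auto
      moreover have "f 0 = 0" using f by (simp add: fc_fun_def)
      ultimately show ?thesis by linarith
    qed
    then show ?thesis by blast
  qed
  then have "\<forall>n. \<exists>q. \<forall>t\<in>{-R..R}. \<bar>f t - t * poly q t\<bar> < inverse (Suc n)" by simp
  then obtain q where q: "\<And>n t. t \<in> {-R..R} \<Longrightarrow> \<bar>f t - t * poly (q n) t\<bar> < inverse (Suc n)"
    by metis
  have "approx_on R q f" unfolding approx_on_def
  proof (rule uniform_limitI)
    fix e :: real assume "e > 0"
    then have "\<forall>\<^sub>F n in sequentially. inverse (real (Suc n)) < e"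
      using LIMSEQ_inverse_real_of_nat by (metis order_tendstoD(2))
    then show "\<forall>\<^sub>F n in sequentially. \<forall>t\<in>{-R..R}. dist (t * poly (q n) t) (f t) < e"
      by eventually_elim (use q in \<open>force simp: dist_real_def abs_minus_commute intro: less_trans\<close>)
  qed
  then show ?thesis by blast
qed

text \<open>The two sequences are compared on the smaller interval, whose radius still exceeds
  \<open>norm a\<close>. With \<open>q' = q\<close> this is the Cauchy property, in general the
  independence of the limit from the approximation.\<close>

lemma approx_on_diff_small:
  fixes a :: "'a::cstar_algebra"
  assumes a: "adj a = a" "norm a < R" "norm a < R'" and q: "approx_on R q f" "approx_on R' q' f"
    and e: "e > 0"
  shows "\<exists>N. \<forall>m\<ge>N. \<forall>n\<ge>N. norm (pev (q m) a - pev (q' n) a) < e"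
proof -
  have "\<forall>\<^sub>F n in sequentially. \<forall>t\<in>{-R..R}. dist (t * poly (q n) t) (f t) < e / 4"
    "\<forall>\<^sub>F n in sequentially. \<forall>t\<in>{-R'..R'}. dist (t * poly (q' n) t) (f t) < e / 4"
    using uniform_limitD[OF q(1)[unfolded approx_on_def], of "e / 4"]
      uniform_limitD[OF q(2)[unfolded approx_on_def], of "e / 4"] e by auto
  then obtain N N' where
    N: "\<And>n t. n \<ge> N \<Longrightarrow> t \<in> {-R..R} \<Longrightarrow> dist (t * poly (q n) t) (f t) < e / 4"
    "\<And>n t. n \<ge> N' \<Longrightarrow> t \<in> {-R'..R'} \<Longrightarrow> dist (t * poly (q' n) t) (f t) < e / 4"
    unfolding eventually_sequentially by blast
  have "norm (pev (q m) a - pev (q' n) a) \<le> e / 2" if "m \<ge> max N N'" "n \<ge> max N N'" for m n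
    unfolding pev_diff[symmetric]
  proof (rule norm_pev_le[OF a(1), of "min R R'"])
    fix t assume "\<bar>t\<bar> \<le> min R R'"
    then have "dist (t * poly (q m) t) (f t) < e / 4" "dist (t * poly (q' n) t) (f t) < e / 4"
      using N(1)[of m t] N(2)[of n t] that by (auto simp: abs_le_iff)
    then show "\<bar>t * poly (q m - q' n) t\<bar> \<le> e / 2"
      by (simp only: dist_real_def poly_diff right_diff_distrib)
  qed (use a in simp)
  then show ?thesis using e by (intro exI[of _ "max N N'"]) fastforce
qed

text \<open>One unit beyond \<open>norm a\<close>, since the norm estimate needs an interval of
  radius strictly larger than \<open>norm a\<close>. The arbitrary choice of the sequence is
  harmless by \<open>pev_tendsto_fc\<close>.\<close>

definition fc :: "(real \<Rightarrow> real) \<Rightarrow> 'a::cstar_algebra \<Rightarrow> 'a" where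
  "fc f a = lim (\<lambda>n. pev ((SOME q. approx_on (norm a + 1) q f) n) a)"

lemma pev_tendsto_fc:
  fixes a :: "'a::cstar_algebra"
  assumes f: "fc_fun f" and a: "adj a = a" "norm a < R" and q: "approx_on R q f"
  shows "(\<lambda>n. pev (q n) a) \<longlonglongrightarrow> fc f a"
proof -
  define q' where "q' = (SOME q. approx_on (norm a + 1) q f)"
  have q': "approx_on (norm a + 1) q' f"
    unfolding q'_def by (rule someI_ex[of "\<lambda>q. approx_on (norm a + 1) q f"], rule exists_approx_on[OF f]) simp
  have "Cauchy (\<lambda>n. pev (q' n) a)"
  proof (rule CauchyI)
    fix e :: real assume "e > 0"
    then show "\<exists>M. \<forall>m\<ge>M. \<forall>n\<ge>M. norm (pev (q' m) a - pev (q' n) a) < e"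
      by (intro approx_on_diff_small[OF a(1) _ _ q' q']) simp_all
  qed
  then have lim: "(\<lambda>n. pev (q' n) a) \<longlonglongrightarrow> fc f a"
    unfolding fc_def q'_def[symmetric] using Cauchy_convergent convergent_LIMSEQ_iff by blast
  have "(\<lambda>n. pev (q n) a - pev (q' n) a) \<longlonglongrightarrow> 0"
  proof (rule LIMSEQ_I)
    fix e :: real assume "e > 0"
    then have "\<exists>N. \<forall>m\<ge>N. \<forall>n\<ge>N. norm (pev (q m) a - pev (q' n) a) < e"
      by (intro approx_on_diff_small[OF a _ q q']) simp_all
    then show "\<exists>no. \<forall>n\<ge>no. norm (pev (q n) a - pev (q' n) a - 0) < e"
      by auto
  qed
  from tendsto_add[OF this lim] show ?thesis by simp
qed

lemma fc_approx:
  assumes f: "fc_fun f" and a: "adj a = a" "norm a < R"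
  obtains q where "approx_on R q f" "(\<lambda>n. pev (q n) a) \<longlonglongrightarrow> fc f a"
proof -
  have "0 \<le> R" using a(2) norm_ge_zero[of a] by linarith
  from exists_approx_on[OF f this] obtain q where q: "approx_on R q f" ..
  from that[OF q pev_tendsto_fc[OF f a q]] show thesis .
qed

lemma fc_eqI:
  assumes "fc_fun f" "adj a = a" "norm a < R" "approx_on R q f" "(\<lambda>n. pev (q n) a) \<longlonglongrightarrow> y"
  shows "fc f a = y"
  using pev_tendsto_fc[OF assms(1-4)] assms(5) by (rule LIMSEQ_unique)

named_theorems fc_intros

lemma fc_fun_id [fc_intros]: "fc_fun (\<lambda>t. t)"
  by (simp add: fc_fun_def)

lemma fc_fun_add [fc_intros]: "fc_fun f \<Longrightarrow> fc_fun g \<Longrightarrow> fc_fun (\<lambda>t. f t + g t)"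
  and fc_fun_diff [fc_intros]: "fc_fun f \<Longrightarrow> fc_fun g \<Longrightarrow> fc_fun (\<lambda>t. f t - g t)"
  and fc_fun_cmult [fc_intros]: "fc_fun f \<Longrightarrow> fc_fun (\<lambda>t. c * f t)"
  and fc_fun_mult [fc_intros]: "fc_fun f \<Longrightarrow> fc_fun g \<Longrightarrow> fc_fun (\<lambda>t. f t * g t)"
  and fc_fun_uminus [fc_intros]: "fc_fun f \<Longrightarrow> fc_fun (\<lambda>t. - f t)"
  and fc_fun_max [fc_intros]: "fc_fun f \<Longrightarrow> fc_fun (\<lambda>t. max (f t) 0)"
  and fc_fun_min [fc_intros]: "fc_fun f \<Longrightarrow> fc_fun (\<lambda>t. min (f t) 1)"
  and fc_fun_sqrt [fc_intros]: "fc_fun f \<Longrightarrow> fc_fun (\<lambda>t. sqrt (f t))"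
  and fc_fun_root [fc_intros]: "n > 0 \<Longrightarrow> fc_fun f \<Longrightarrow> fc_fun (\<lambda>t. root n (f t))"
  by (auto simp: fc_fun_def intro!: continuous_intros)

lemma fc_fun_reflect [fc_intros]: "fc_fun f \<Longrightarrow> fc_fun (\<lambda>t. f (- t))"
  unfolding fc_fun_def by (auto intro!: continuous_on_compose2[of UNIV f] continuous_intros)

context
  fixes a :: "'a::cstar_algebra"
  assumes a: "adj a = a"
begin

lemma fc_add:
  assumes f: "fc_fun f" and g: "fc_fun g"
  shows "fc (\<lambda>t. f t + g t) a = fc f a + fc g a"
proof -
  obtain p q where p: "approx_on (norm a + 1) p f" and q: "approx_on (norm a + 1) q g"
    using exists_approx_on f g by (metis add_nonneg_nonneg norm_ge_zero zero_le_one)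
  have ap: "approx_on (norm a + 1) (\<lambda>n. p n + q n) (\<lambda>t. f t + g t)"
    using uniform_limit_add[OF p[unfolded approx_on_def] q[unfolded approx_on_def]]
    by (simp add: approx_on_def algebra_simps)
  show ?thesis
    by (rule fc_eqI[OF fc_fun_add[OF f g] a _ ap])
       (auto simp: pev_add intro!: tendsto_add pev_tendsto_fc[OF f a _ p] pev_tendsto_fc[OF g a _ q])
qed

lemma fc_cmult:
  assumes f: "fc_fun f"
  shows "fc (\<lambda>t. c * f t) a = c *\<^sub>R fc f a"
proof -
  obtain p where p: "approx_on (norm a + 1) p f"
    using exists_approx_on f by (metis add_nonneg_nonneg norm_ge_zero zero_le_one)
  have ap: "approx_on (norm a + 1) (\<lambda>n. smult c (p n)) (\<lambda>t. c * f t)"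
    using bounded_linear_uniform_limit_intros(12)[OF p[unfolded approx_on_def], of c]
    by (simp add: approx_on_def algebra_simps)
  show ?thesis
    by (rule fc_eqI[OF fc_fun_cmult[OF f] a _ ap])
       (auto simp: pev_smult intro!: tendsto_intros pev_tendsto_fc[OF f a _ p])
qed

lemma fc_uminus: "fc_fun f \<Longrightarrow> fc (\<lambda>t. - f t) a = - fc f a"
  using fc_cmult[of f "-1"] by simp

lemma fc_diff: "fc_fun f \<Longrightarrow> fc_fun g \<Longrightarrow> fc (\<lambda>t. f t - g t) a = fc f a - fc g a"
  using fc_add[of f "\<lambda>t. - g t"] by (simp add: fc_uminus fc_fun_uminus)

lemma fc_mult:
  assumes f: "fc_fun f" and g: "fc_fun g"
  shows "fc (\<lambda>t. f t * g t) a = fc f a * fc g a"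
proof -
  let ?I = "{- (norm a + 1)..norm a + 1}"
  obtain p q where p: "approx_on (norm a + 1) p f" and q: "approx_on (norm a + 1) q g"
    using exists_approx_on f g by (metis add_nonneg_nonneg norm_ge_zero zero_le_one)
  have bd: "bounded (h ` ?I)" if "fc_fun h" for h
    using that compact_continuous_image[of ?I h] continuous_on_subset
    unfolding fc_fun_def by (blast intro: compact_imp_bounded)
  have ap: "approx_on (norm a + 1) (\<lambda>n. pCons 0 (p n * q n)) (\<lambda>t. f t * g t)"
    using uniform_lim_mult[OF p[unfolded approx_on_def] q[unfolded approx_on_def] bd[OF f] bd[OF g]]
    by (simp add: approx_on_def algebra_simps)
  show ?thesis
    by (rule fc_eqI[OF fc_fun_mult[OF f g] a _ ap])
       (auto simp: pev_mult intro!: tendsto_mult pev_tendsto_fc[OF f a _ p] pev_tendsto_fc[OF g a _ q])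
qed

lemma fc_id: "fc (\<lambda>t. t) a = a"
proof -
  have ap: "approx_on (norm a + 1) (\<lambda>n. [:1:]) (\<lambda>t. t)"
    by (simp add: approx_on_def uniform_limit_const)
  show ?thesis
    by (rule fc_eqI[OF fc_fun_id a _ ap]) (simp_all add: pev_def)
qed

lemma fc_selfadj:
  assumes f: "fc_fun f"
  shows "adj (fc f a) = fc f a"
proof -
  obtain q where "(\<lambda>n. pev (q n) a) \<longlonglongrightarrow> fc f a"
    using fc_approx[OF f a, of "norm a + 1"] by auto
  moreover from bounded_linear.tendsto[OF bounded_linear_adj this]
  have "(\<lambda>n. pev (q n) a) \<longlonglongrightarrow> adj (fc f a)" by (simp add: pev_adj a)
  ultimately show ?thesis by (rule LIMSEQ_unique[rotated])
qed

lemma fc_in_closed: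
  assumes f: "fc_fun f" and S: "closed S" "\<And>q. pev q a \<in> S"
  shows "fc f a \<in> S"
proof -
  obtain q where "(\<lambda>n. pev (q n) a) \<longlonglongrightarrow> fc f a"
    using fc_approx[OF f a, of "norm a + 1"] by auto
  then show ?thesis using S by (meson closed_sequentially)
qed

lemma norm_fc_le:
  assumes f: "fc_fun f" and \<rho>: "norm a < \<rho>" and S: "\<And>t. \<bar>t\<bar> \<le> \<rho> \<Longrightarrow> \<bar>f t\<bar> \<le> S"
  shows "norm (fc f a) \<le> S"
proof (rule field_le_epsilon)
  fix e :: real assume e: "e > 0"
  obtain q where q: "approx_on \<rho> q f" "(\<lambda>n. pev (q n) a) \<longlonglongrightarrow> fc f a"
    by (rule fc_approx[OF f a \<rho>])
  have "\<forall>\<^sub>F n in sequentially. \<forall>t\<in>{-\<rho>..\<rho>}. dist (t * poly (q n) t) (f t) < e"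
    by (rule uniform_limitD[OF q(1)[unfolded approx_on_def] e])
  then have "\<forall>\<^sub>F n in sequentially. norm (pev (q n) a) \<le> S + e"
  proof eventually_elim
    case (elim n)
    show ?case
    proof (rule norm_pev_le[OF a \<rho>])
      fix t :: real assume t: "\<bar>t\<bar> \<le> \<rho>"
      then have "dist (t * poly (q n) t) (f t) < e" using bspec[OF elim, of t] by (simp add: abs_le_iff)
      then show "\<bar>t * poly (q n) t\<bar> \<le> S + e" using S[OF t] by (simp add: dist_real_def)
    qed
  qed
  then show "norm (fc f a) \<le> S + e"
    using tendsto_upperbound[OF tendsto_norm[OF q(2)]] by simp
qed

lemma fc_reflect:
  assumes f: "fc_fun f"
  shows "fc f (- a) = fc (\<lambda>t. f (- t)) a"
proof -
  let ?R = "norm a + 1"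
  obtain q where q: "approx_on ?R q f" "(\<lambda>n. pev (q n) (- a)) \<longlonglongrightarrow> fc f (- a)"
    using fc_approx[OF f, of "- a" ?R] a by (auto simp: adj_uminus)
  have "(\<lambda>n. pev (- pcompose (q n) [:0, -1:]) a) \<longlonglongrightarrow> fc f (- a)"
    using q(2) by (simp add: pev_uminus)
  moreover have "approx_on ?R (\<lambda>n. - pcompose (q n) [:0, -1:]) (\<lambda>t. f (- t))"
    unfolding approx_on_def
  proof (rule uniform_limitI)
    fix e :: real assume "e > 0"
    then have "\<forall>\<^sub>F n in sequentially. \<forall>t\<in>{-?R..?R}. dist (t * poly (q n) t) (f t) < e"
      by (rule uniform_limitD[OF q(1)[unfolded approx_on_def]])
    then show "\<forall>\<^sub>F n in sequentially. \<forall>t\<in>{-?R..?R}. dist (t * poly (- pcompose (q n) [:0, -1:]) t) (f (- t)) < e"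
    proof eventually_elim
      case (elim n)
      show ?case
      proof
        fix t assume "t \<in> {-?R..?R}"
        then show "dist (t * poly (- pcompose (q n) [:0, -1:]) t) (f (- t)) < e"
          using bspec[OF elim, of "- t"] by (simp add: poly_pcompose)
      qed
    qed
  qed
  ultimately show ?thesis
    using fc_eqI[OF fc_fun_reflect[OF f] a, of ?R] by simp
qed

end

lemma fc_zero: "fc_fun f \<Longrightarrow> fc f 0 = (0::'a::cstar_algebra)"
  using fc_in_closed[of 0 f "{0}"] by (simp add: adj_zero pev_def)

text \<open>A single approximating sequence, on an interval large enough for both elements, serves
  \<open>a\<close> and \<open>b\<close>.\<close>

lemma fc_intertwine:
  assumes f: "fc_fun f" and ab: "adj a = a" "adj b = b" "a * t = t * b"
  shows "fc f a * t = t * fc f b"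
proof -
  let ?R = "max (norm a) (norm b) + 1"
  have R: "norm a < ?R" "norm b < ?R" by linarith+
  obtain q where q: "approx_on ?R q f" "(\<lambda>n. pev (q n) a) \<longlonglongrightarrow> fc f a"
    by (rule fc_approx[OF f ab(1) R(1)])
  note q(2) and pev_tendsto_fc[OF f ab(2) R(2) q(1)]
  then have "(\<lambda>n. pev (q n) a * t) \<longlonglongrightarrow> fc f a * t" "(\<lambda>n. t * pev (q n) b) \<longlonglongrightarrow> t * fc f b"
    by (intro tendsto_intros; simp)+
  then show ?thesis by (simp add: pev_intertwine[OF ab(3)] LIMSEQ_unique)
qed

text \<open>\<open>y * a = 0\<close> says that \<open>y\<close> intertwines \<open>0\<close> and
  \<open>a\<close>, and \<open>f\<close> vanishes at 0.\<close>

lemma mult_fc_eq_0: "fc_fun f \<Longrightarrow> adj a = a \<Longrightarrow> y * a = 0 \<Longrightarrow> y * fc f a = 0"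
  using fc_intertwine[of f 0 a y] by (simp add: adj_zero fc_zero)

lemma fc_mult_eq_0: "fc_fun f \<Longrightarrow> adj a = a \<Longrightarrow> a * y = 0 \<Longrightarrow> fc f a * y = 0"
  using fc_intertwine[of f a 0 y] by (simp add: adj_zero fc_zero)


section \<open>Positive elements\<close>

abbreviation pos_part :: "real \<Rightarrow> real" where "pos_part \<equiv> (\<lambda>t. max t 0)"
abbreviation neg_part :: "real \<Rightarrow> real" where "neg_part \<equiv> (\<lambda>t. max (- t) 0)"

lemma fc_fun_pos_part [fc_intros]: "fc_fun pos_part" and fc_fun_neg_part [fc_intros]: "fc_fun neg_part"
  by (intro fc_intros)+

text \<open>In the unitization this reads \<open>norm (r - a) \<le> r\<close>, a form of positivity
  that visibly passes to sums. For the form \<open>adj z * z\<close> this is not visible.\<close>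

definition op_bounded :: "'a::cstar_algebra \<Rightarrow> bool" where
  "op_bounded a \<longleftrightarrow> adj a = a \<and> (\<exists>r>0. \<forall>x. norm (r *\<^sub>R x - a * x) \<le> r * norm x)"

lemma op_bounded_add:
  assumes "op_bounded a" "op_bounded b"
  shows "op_bounded (a + b)"
proof -
  obtain r s where r: "r > 0" "\<And>x. norm (r *\<^sub>R x - a * x) \<le> r * norm x"
    and s: "s > 0" "\<And>x. norm (s *\<^sub>R x - b * x) \<le> s * norm x"
    using assms unfolding op_bounded_def by metis
  have "norm ((r + s) *\<^sub>R x - (a + b) * x) \<le> (r + s) * norm x" for x
    using norm_triangle_ineq[of "r *\<^sub>R x - a * x" "s *\<^sub>R x - b * x"] r(2)[of x] s(2)[of x]
    by (simp add: algebra_simps)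
  moreover have "r + s > 0" using r s by simp
  ultimately show ?thesis using assms unfolding op_bounded_def by (auto simp: adj_add)
qed

text \<open>With \<open>r = \<rho>^2\<close>, because \<open>\<rho>^2 - t^2\<close> lies between 0
  and \<open>\<rho>^2\<close> on the interval of radius \<open>\<rho>\<close>.\<close>

lemma op_bounded_square:
  assumes s: "adj s = s"
  shows "op_bounded (s * s)"
proof -
  define \<rho> where "\<rho> = norm s + 1"
  have \<rho>: "\<rho> > 0" "norm s < \<rho>" by (auto simp: \<rho>_def add_nonneg_pos)
  have "norm (\<rho>\<^sup>2 *\<^sub>R x - s * s * x) \<le> \<rho>\<^sup>2 * norm x" for x
  proof -
    have "norm (pact [:\<rho>\<^sup>2, 0, -1:] s x) \<le> \<rho>\<^sup>2 * norm x"
    proof (rule norm_pact_le[OF s \<rho>(2)])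
      fix t :: real assume "\<bar>t\<bar> \<le> \<rho>"
      then have "t * t \<le> \<rho>\<^sup>2" by (metis abs_le_square_iff abs_of_pos power2_eq_square \<rho>(1))
      moreover have "t * t \<ge> 0" by simp
      ultimately show "\<bar>poly [:\<rho>\<^sup>2, 0, - 1:] t\<bar> \<le> \<rho>\<^sup>2" by (simp add: abs_le_iff)
    qed
    then show ?thesis by (simp add: algebra_simps)
  qed
  moreover have "\<rho>\<^sup>2 > 0" using \<rho> by simp
  ultimately show ?thesis using s unfolding op_bounded_def by (intro conjI exI[of _ "\<rho>\<^sup>2"]) (auto simp: adj_mult)
qed

text \<open>
  If the negative part \<open>y\<close> of \<open>c\<close> were nonzero, then \<open>r - c\<close> would act on \<open>y\<close> as \<open>r + y\<close>, whose
  powers applied to \<open>y\<close> grow like \<open>n r\<^sup>n\<close>.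
\<close>

lemma op_bounded_neg_part:
  assumes "op_bounded c"
  shows "fc neg_part c = 0"
proof -
  obtain r where c: "adj c = c" and r: "r > 0" "\<And>x. norm (r *\<^sub>R x - c * x) \<le> r * norm x"
    using assms unfolding op_bounded_def by blast
  \<comment> \<open>As \<open>t * neg_part t\<close> is minus the square of
    \<open>neg_part t\<close>, this is \<open>(r - t)^n * neg_part t\<close>, the
    \<open>n\<close>-th power of \<open>r - c\<close> applied to the negative part.\<close>
  define g where "g n t = (r + neg_part t) ^ n * neg_part t" for n t
  have g: "fc_fun (g n)" for n unfolding g_def fc_fun_def by (auto intro!: continuous_intros)
  have step: "fc (g (Suc n)) c = r *\<^sub>R fc (g n) c - c * fc (g n) c" for n
  proof -
    have "g (Suc n) = (\<lambda>t. r * g n t - t * g n t)"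
      by (auto simp: g_def fun_eq_iff max_def algebra_simps)
    then show ?thesis
      using g c by (simp add: fc_diff fc_cmult fc_mult fc_id fc_intros)
  qed
  have bd: "norm (fc (g n) c) \<le> r ^ n * norm (fc neg_part c)" for n
  proof (induct n)
    case (Suc n)
    have "norm (fc (g (Suc n)) c) \<le> r * norm (fc (g n) c)" unfolding step by (rule r)
    also have "\<dots> \<le> r * (r ^ n * norm (fc neg_part c))" using Suc r by (intro mult_left_mono) auto
    finally show ?case by (simp add: mult.assoc)
  qed (simp add: g_def)
  let ?y = "fc neg_part c"
  have "real (Suc n) * (norm ?y)\<^sup>2 \<le> r * norm ?y" for n
  proof -
    \<comment> \<open>Chosen so that \<open>h\<close> times \<open>g (Suc n)\<close> is
      \<open>(n + 1) r^n\<close> times the square of \<open>neg_part\<close>. Bernoulli's inequality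
      bounds \<open>h\<close> by 1, so \<open>g (Suc n)\<close> at \<open>c\<close> has norm at
      least \<open>(n + 1) r^n (norm ?y)^2\<close>, against the upper bound
      \<open>r^(n+1) norm ?y\<close>.\<close>
    define h where "h t = real (Suc n) * r ^ n * neg_part t / (r + neg_part t) ^ Suc n" for t
    have pos: "r + neg_part t > 0" for t using r(1) by (auto simp: max_def)
    have h: "fc_fun h" unfolding h_def fc_fun_def
      using pos by (auto intro!: continuous_intros simp: power_eq_0_iff less_imp_neq[symmetric]) 
    have h1: "\<bar>h t\<bar> \<le> 1" for t
    proof -
      let ?u = "neg_part t"
      have "real (Suc n) * r ^ n * ?u \<le> (r + ?u) ^ Suc n"
      proof -
        have "1 + real (Suc n) * (?u / r) \<le> (1 + ?u / r) ^ Suc n"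
          by (rule Bernoulli_inequality) (use r in \<open>auto simp: le_divide_eq intro: order_trans[of _ 0]\<close>)
        then have "real (Suc n) * (?u / r) \<le> (1 + ?u / r) ^ Suc n" by linarith
        then have "r ^ Suc n * (real (Suc n) * (?u / r)) \<le> r ^ Suc n * (1 + ?u / r) ^ Suc n"
          using r(1) by (intro mult_left_mono) auto
        also have "\<dots> = (r + ?u) ^ Suc n"
          using r(1) by (simp only: power_mult_distrib[symmetric]) (simp add: algebra_simps)
        finally have "r ^ Suc n * (real (Suc n) * (?u / r)) \<le> (r + ?u) ^ Suc n" .
        moreover have "r ^ Suc n * (real (Suc n) * (?u / r)) = real (Suc n) * r ^ n * ?u"
          using r(1) by simp
        ultimately show ?thesis by (simp only:)
      qed
      then show ?thesis using pos[of t] r(1)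
        by (simp add: h_def abs_mult divide_le_eq zero_le_mult_iff del: power_Suc of_nat_Suc)
    qed
    have eq: "(\<lambda>t. real (Suc n) * r ^ n * (neg_part t * neg_part t)) = (\<lambda>t. h t * g (Suc n) t)"
      using pos by (auto simp: h_def g_def fun_eq_iff less_imp_neq[symmetric])
    have "real (Suc n) * r ^ n * (norm ?y)\<^sup>2 = norm ((real (Suc n) * r ^ n) *\<^sub>R (?y * ?y))"
      using r(1) norm_selfadj_square[OF fc_selfadj[OF c fc_fun_neg_part]] by simp
    also have "(real (Suc n) * r ^ n) *\<^sub>R (?y * ?y) =
        fc (\<lambda>t. real (Suc n) * r ^ n * (neg_part t * neg_part t)) c"
      by (simp only: fc_cmult[OF c fc_fun_mult] fc_mult[OF c] fc_fun_neg_part)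
    also have "\<dots> = fc h c * fc (g (Suc n)) c"
      unfolding eq by (rule fc_mult[OF c h g])
    also have "norm \<dots> \<le> norm (fc h c) * norm (fc (g (Suc n)) c)" by (rule norm_mult_ineq)
    also have "\<dots> \<le> 1 * (r ^ Suc n * norm ?y)"
      by (intro mult_mono norm_fc_le[OF c h, of "norm c + 1"] h1 bd) auto
    finally have "r ^ n * (real (Suc n) * (norm ?y)\<^sup>2) \<le> r ^ n * (r * norm ?y)"
      by (simp only: power_Suc mult_ac mult_1)
    then show ?thesis using r(1) by (simp del: of_nat_Suc)
  qed note * = this
  show ?thesis
  proof (rule ccontr)
    assume "?y \<noteq> 0"
    then have y: "norm ?y > 0" by simp
    have "real (Suc n) * norm ?y \<le> r" for n
      using *[of n] y by (simp add: power2_eq_square flip: mult.assoc del: of_nat_Suc)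
    moreover obtain n where "real n * norm ?y > r"
      using reals_Archimedean3[OF y] by blast
    ultimately show False using y by (smt (verit) mult_right_mono of_nat_Suc)
  qed
qed

section \<open>Positive and negative parts\<close>

lemma fc_pos_minus_neg: "adj a = a \<Longrightarrow> a = fc pos_part a - fc neg_part a"
proof -
  assume a: "adj a = a"
  have "(\<lambda>t. pos_part t - neg_part t) = (\<lambda>t. t)" by (auto simp: max_def)
  then show ?thesis using fc_diff[OF a fc_fun_pos_part fc_fun_neg_part] fc_id[OF a] by simp
qed

lemma fc_nonneg_square:
  assumes "adj a = a" "fc_fun f" "\<And>t. f t \<ge> 0"
  shows "fc f a = fc (\<lambda>t. sqrt (f t)) a * fc (\<lambda>t. sqrt (f t)) a"
  using fc_mult[OF assms(1), of "\<lambda>t. sqrt (f t)" "\<lambda>t. sqrt (f t)"] assms by (simp add: fc_intros)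

lemma cube_eq_0:
  assumes a: "adj a = a" and z: "a * a * a = (0::'a::cstar_algebra)"
  shows "a = 0"
proof -
  have "(norm (a * a))\<^sup>2 = norm (a * a * a * a)"
    using norm_selfadj_square[of "a * a"] a by (simp add: adj_mult mult.assoc)
  then have "a * a = 0" using z by simp
  then show ?thesis using norm_selfadj_square[OF a] by simp
qed

lemma positive_elem_selfadj: "positive_elem a \<Longrightarrow> adj a = a"
  by (auto simp: positive_elem_def adj_mult adj_adj)

lemma positive_elem_square: "adj s = s \<Longrightarrow> positive_elem (s * s)"
  unfolding positive_elem_def by metis

lemma positive_elem_fc:
  assumes "adj a = a" "fc_fun f" "\<And>t. f t \<ge> 0"
  shows "positive_elem (fc f a)"
  by (subst fc_nonneg_square[OF assms])
     (intro positive_elem_square fc_selfadj assms fc_intros)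

text \<open>
  For \<open>t = z n\<close> with \<open>n\<close> the negative part of \<open>z* z\<close> one has \<open>t* t = - n\<^sup>3\<close>, while
  \<open>t t* = 2 h\<^sup>2 + 2 k\<^sup>2 + n\<^sup>3\<close> has no negative part; intertwining the two by \<open>t\<close> gives \<open>t n\<^sup>3 = 0\<close>.
\<close>

theorem positive_elem_neg_part:
  assumes "positive_elem a"
  shows "fc neg_part a = 0"
proof -
  obtain z where z: "a = adj z * z" using assms by (auto simp: positive_elem_def)
  have a: "adj a = a" by (rule positive_elem_selfadj[OF assms])
  define n where "n = fc neg_part a"
  have n: "adj n = n" unfolding n_def by (rule fc_selfadj[OF a fc_fun_neg_part])
  have "(\<lambda>t. t * neg_part t) = (\<lambda>t. - (neg_part t * neg_part t))" by (auto simp: max_def)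
  then have an: "a * n = - (n * n)"
    using fc_mult[OF a fc_fun_id fc_fun_neg_part] fc_mult[OF a fc_fun_neg_part fc_fun_neg_part]
      fc_uminus[OF a fc_fun_mult[OF fc_fun_neg_part fc_fun_neg_part]]
    by (simp add: fc_id[OF a] n_def)
  define b where "b = n * n * n"
  define t where "t = z * n"
  have tt: "adj t * t = - b"
  proof -
    have "adj t * t = n * (a * n)" by (simp add: t_def z adj_mult n mult.assoc)
    then show ?thesis by (simp add: an b_def mult.assoc)
  qed
  have b: "adj b = b" by (simp add: b_def adj_mult n mult.assoc)
  \<comment> \<open>The cube of \<open>n\<close> is the square of \<open>n * s\<close> for the
    square root \<open>s\<close> of \<open>n\<close>.\<close>
  have bb: "op_bounded b"
  proof -
    define s where "s = fc (\<lambda>t. sqrt (neg_part t)) a"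
    have s: "adj s = s" unfolding s_def by (intro fc_selfadj a fc_intros)
    have ss: "s * s = n"
      unfolding s_def n_def by (rule fc_nonneg_square[symmetric]) (auto simp: a fc_fun_neg_part)
    have sn: "s * n = n * s" by (metis ss mult.assoc)
    have "b = (n * s) * (n * s)"
    proof -
      have "(n * s) * (n * s) = n * (s * n) * s" by (simp add: mult.assoc)
      also have "\<dots> = n * n * (s * s)" by (simp add: sn mult.assoc)
      finally show ?thesis by (simp add: ss b_def)
    qed
    moreover have "adj (n * s) = n * s" by (simp add: adj_mult n s sn)
    ultimately show ?thesis using op_bounded_square by metis
  qed
  \<comment> \<open>Real and imaginary part of \<open>t\<close>, so that
    \<open>t * adj t + adj t * t\<close> is twice \<open>h * h + k * k\<close>.\<close>
  define h where "h = (1/2) *\<^sub>R (t + adj t)"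
  define k where "k = (- \<i> / 2) *\<^sub>C (t - adj t)"
  have hk: "adj h = h" "adj k = k"
    by (simp_all add: h_def k_def adj_scaleR adj_add adj_adj adj_scaleC adj_minus add.commute)
       (simp add: scaleC_minus_left scaleC_diff_right)
  have h2: "h * h = (1/4) *\<^sub>R ((t + adj t) * (t + adj t))" by (simp add: h_def)
  have "k * k = (- (1/4)) *\<^sub>R ((t - adj t) * (t - adj t))"
    by (simp add: k_def mult_scaleC_left mult_scaleC_right scaleC_scaleC scaleR_scaleC)
  with h2 have "4 *\<^sub>R (h * h + k * k) = (t + adj t) * (t + adj t) - (t - adj t) * (t - adj t)"
    by (simp add: scaleR_right_distrib scaleR_right_diff_distrib)
  also have "\<dots> = 2 *\<^sub>R (t * adj t + adj t * t)" by (simp add: algebra_simps scaleR_2)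
  finally have "2 *\<^sub>R (2 *\<^sub>R (h * h + k * k)) = 2 *\<^sub>R (t * adj t + adj t * t)" by simp
  then have "t * adj t + adj t * t = 2 *\<^sub>R (h * h + k * k)" by (metis scaleR_cancel_left zero_neq_numeral)
  then have "t * adj t = (h * h + k * k) + (h * h + k * k) + b"
    by (simp add: tt scaleR_2 algebra_simps)
  then have "op_bounded (t * adj t)"
    using bb hk by (simp add: op_bounded_add op_bounded_square)
  then have tn: "fc neg_part (t * adj t) = 0" by (rule op_bounded_neg_part)
  have "fc neg_part (t * adj t) * t = t * fc neg_part (adj t * t)"
    by (rule fc_intertwine[OF fc_fun_neg_part]) (simp_all add: adj_mult adj_adj mult.assoc)
  moreover have "fc neg_part (- b) = b"
    using fc_reflect[OF b fc_fun_neg_part] fc_pos_minus_neg[OF b] op_bounded_neg_part[OF bb]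
    by simp
  ultimately have "t * b = 0" by (simp add: tn tt)
  then have "adj t * t * b = 0" by (simp add: mult.assoc)
  then have "b = 0" using norm_selfadj_square[OF b] by (simp add: tt)
  then show ?thesis using cube_eq_0[OF n] by (simp add: b_def n_def)
qed

lemma positive_elem_fc_pos_part: "positive_elem a \<Longrightarrow> fc pos_part a = a"
  using fc_pos_minus_neg[OF positive_elem_selfadj] positive_elem_neg_part by fastforce

lemma positive_elem_sqrt:
  assumes "positive_elem a"
  shows "fc (\<lambda>t. sqrt (pos_part t)) a * fc (\<lambda>t. sqrt (pos_part t)) a = a"
  using fc_nonneg_square[OF positive_elem_selfadj[OF assms] fc_fun_pos_part]
    positive_elem_fc_pos_part[OF assms] by simp

text \<open>The criterion \<open>op_bounded\<close> is additive and kills the negative part, so the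
  sum equals its positive part, which is a square.\<close>

lemma positive_elem_add:
  assumes "positive_elem a" "positive_elem b"
  shows "positive_elem (a + b)"
proof -
  have "op_bounded a" "op_bounded b"
    using op_bounded_square[OF fc_selfadj[OF positive_elem_selfadj], of _ "\<lambda>t. sqrt (pos_part t)"]
      positive_elem_sqrt assms by (metis fc_fun_sqrt fc_fun_pos_part)+
  then have ab: "op_bounded (a + b)" by (rule op_bounded_add)
  then have s: "adj (a + b) = a + b" by (simp add: op_bounded_def)
  have "fc neg_part (a + b) = 0" using ab by (rule op_bounded_neg_part)
  then have "a + b = fc pos_part (a + b)" using fc_pos_minus_neg[OF s] by simp
  then show ?thesis using positive_elem_fc[OF s fc_fun_pos_part] by simp
qed

lemma positive_elem_0: "positive_elem 0"
  unfolding positive_elem_def by (metis mult_zero_right)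

lemma positive_elem_sum: "(\<And>i. i \<in> I \<Longrightarrow> positive_elem (f i)) \<Longrightarrow> positive_elem (\<Sum>i\<in>I. f i)"
  by (induct I rule: infinite_finite_induct) (auto simp: positive_elem_0 positive_elem_add)

lemma positive_elem_scaleR:
  assumes "positive_elem a" "0 \<le> r"
  shows "positive_elem (r *\<^sub>R a)"
proof -
  obtain z where "a = adj z * z" using assms by (auto simp: positive_elem_def)
  then have "r *\<^sub>R a = adj (sqrt r *\<^sub>R z) * (sqrt r *\<^sub>R z)" using assms(2) by (simp add: adj_scaleR)
  then show ?thesis unfolding positive_elem_def by blast
qed


section \<open>Lifting orthogonal positive elements\<close>

lemma cstar_subalgebra_minus: "cstar_subalgebra C \<Longrightarrow> x \<in> C \<Longrightarrow> - x \<in> C"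
  unfolding cstar_subalgebra_def by (metis scaleC_minus_left scaleC_one)

lemma cstar_subalgebra_diff: "cstar_subalgebra C \<Longrightarrow> x \<in> C \<Longrightarrow> y \<in> C \<Longrightarrow> x - y \<in> C"
  unfolding diff_conv_add_uminus using cstar_subalgebra_minus cstar_subalgebra_def by blast

lemma cstar_subalgebra_scaleR: "cstar_subalgebra C \<Longrightarrow> x \<in> C \<Longrightarrow> r *\<^sub>R x \<in> C"
  unfolding cstar_subalgebra_def scaleR_scaleC by blast

lemma cstar_subalgebra_sum: "cstar_subalgebra C \<Longrightarrow> (\<And>i. i \<in> I \<Longrightarrow> f i \<in> C) \<Longrightarrow> (\<Sum>i\<in>I. f i) \<in> C"
  by (induct I rule: infinite_finite_induct) (auto simp: cstar_subalgebra_def)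

lemma pact_in_subalgebra: "cstar_subalgebra C \<Longrightarrow> a \<in> C \<Longrightarrow> x \<in> C \<Longrightarrow> pact q a x \<in> C"
  by (induct q) (auto simp: cstar_subalgebra_def cstar_subalgebra_scaleR)

lemma fc_in_subalgebra:
  assumes "cstar_subalgebra C" "a \<in> C" "adj a = a" "fc_fun f"
  shows "fc f a \<in> C"
  using assms by (intro fc_in_closed) (auto simp: pev_def pact_in_subalgebra cstar_subalgebra_def)

text \<open>The quotient by \<open>J\<close> is not formed; relations in it are expressed by
  differences lying in \<open>J\<close>, which keeps all elements in one type.\<close>

locale closed_ideal =
  fixes C J :: "'a::cstar_algebra set"
  assumes C: "cstar_subalgebra C" and J_subset: "J \<subseteq> C" and J_closed: "closed J"
    and J_0: "0 \<in> J" and J_add: "x \<in> J \<Longrightarrow> y \<in> J \<Longrightarrow> x + y \<in> J"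
    and J_scaleR: "x \<in> J \<Longrightarrow> r *\<^sub>R x \<in> J" and J_adj: "x \<in> J \<Longrightarrow> adj x \<in> J"
    and J_mult_right: "x \<in> J \<Longrightarrow> c \<in> C \<Longrightarrow> x * c \<in> J"
    and J_mult_left: "x \<in> J \<Longrightarrow> c \<in> C \<Longrightarrow> c * x \<in> J"
begin

lemma C_add: "x \<in> C \<Longrightarrow> y \<in> C \<Longrightarrow> x + y \<in> C" and C_mult: "x \<in> C \<Longrightarrow> y \<in> C \<Longrightarrow> x * y \<in> C"
  and C_adj: "x \<in> C \<Longrightarrow> adj x \<in> C"
  using C by (auto simp: cstar_subalgebra_def)

lemma J_minus: "x \<in> J \<Longrightarrow> - x \<in> J"
  using J_scaleR[of x "-1"] by simp

lemma J_sum: "(\<And>i. i \<in> I \<Longrightarrow> f i \<in> J) \<Longrightarrow> (\<Sum>i\<in>I. f i) \<in> J"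
  by (induct I rule: infinite_finite_induct) (auto simp: J_0 J_add)

lemma J_trans: "x - y \<in> J \<Longrightarrow> y - z \<in> J \<Longrightarrow> x - z \<in> J"
  using J_add[of "x - y" "y - z"] by simp

lemma J_sym: "x - y \<in> J \<Longrightarrow> y - x \<in> J"
  using J_minus[of "x - y"] by simp

lemma J_mult_cong:
  assumes "x - x' \<in> J" "y - y' \<in> J" "x' \<in> C" "y \<in> C"
  shows "x * y - x' * y' \<in> J"
proof -
  have "(x - x') * y + x' * (y - y') \<in> J"
    using assms by (intro J_add J_mult_right J_mult_left)
  then show ?thesis by (simp add: algebra_simps)
qed

lemma mult_pact_in_J:
  assumes "a \<in> C" "x \<in> C" "y * x \<in> J" "y * a \<in> J"
  shows "y * pact q a x \<in> J"
proof (induct q)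
  case (pCons c q)
  have "c *\<^sub>R (y * x) + (y * a) * pact q a x \<in> J"
    using assms by (intro J_add J_scaleR J_mult_right[OF _ pact_in_subalgebra[OF C]])
  then show ?case by (simp add: algebra_simps)
qed (simp add: J_0)

lemma pact_cong:
  assumes "u - v \<in> J" "x - y \<in> J" "u \<in> C" "v \<in> C" "x \<in> C"
  shows "pact q u x - pact q v y \<in> J"
proof (induct q)
  case (pCons c q)
  have "u * pact q u x - v * pact q v y \<in> J"
    using assms pCons by (intro J_mult_cong pact_in_subalgebra[OF C])
  then have "c *\<^sub>R (x - y) + (u * pact q u x - v * pact q v y) \<in> J"
    using assms by (intro J_add J_scaleR)
  then show ?case by (simp add: algebra_simps)
qed (simp add: J_0)

lemma fc_cong:
  assumes f: "fc_fun f" and uv: "u - v \<in> J" "u \<in> C" "v \<in> C" "adj u = u" "adj v = v"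
  shows "fc f u - fc f v \<in> J"
proof -
  let ?R = "max (norm u) (norm v) + 1"
  have R: "norm u < ?R" "norm v < ?R" by linarith+
  obtain q where q: "approx_on ?R q f" "(\<lambda>n. pev (q n) u) \<longlonglongrightarrow> fc f u"
    by (rule fc_approx[OF f uv(4) R(1)])
  have "(\<lambda>n. pev (q n) u - pev (q n) v) \<longlonglongrightarrow> fc f u - fc f v"
    by (intro tendsto_diff q(2) pev_tendsto_fc[OF f uv(5) R(2) q(1)])
  moreover have "pev (q n) u - pev (q n) v \<in> J" for n
    unfolding pev_def using uv by (intro pact_cong)
  ultimately show ?thesis using J_closed by (meson closed_sequentially)
qed

text \<open>The cross terms lie in \<open>J\<close>, so polynomials without constant term are
  additive modulo \<open>J\<close>; closedness of \<open>J\<close> passes this to the limit.\<close>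

lemma fc_add_orthogonal:
  assumes f: "fc_fun f" and C: "u \<in> C" "v \<in> C" and s: "adj u = u" "adj v = v"
    and o: "u * v \<in> J" "v * u \<in> J"
  shows "fc f (u + v) - (fc f u + fc f v) \<in> J"
proof -
  let ?R = "norm u + norm v + 1"
  have R: "norm u < ?R" "norm v < ?R" "norm (u + v) < ?R"
    using norm_triangle_ineq[of u v] by (auto simp: add_nonneg_pos add_pos_nonneg)
  have suv: "adj (u + v) = u + v" by (simp add: adj_add s)
  obtain q where q: "approx_on ?R q f" "(\<lambda>n. pev (q n) u) \<longlonglongrightarrow> fc f u"
    by (rule fc_approx[OF f s(1) R(1)])
  have "(\<lambda>n. pev (q n) (u + v) - (pev (q n) u + pev (q n) v)) \<longlonglongrightarrow> fc f (u + v) - (fc f u + fc f v)"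
    by (intro tendsto_diff tendsto_add q(2) pev_tendsto_fc[OF f suv R(3) q(1)]
        pev_tendsto_fc[OF f s(2) R(2) q(1)])
  moreover have "pev q (u + v) - (pev q u + pev q v) \<in> J" for q
    unfolding pev_def
  proof (induct q)
    case (pCons c q)
    let ?p = "\<lambda>a. pact q a a"
    have m: "u * ?p v \<in> J" "v * ?p u \<in> J" using C o by (auto intro: mult_pact_in_J)
    have "(u + v) * (?p (u + v) - (?p u + ?p v)) + (u * ?p v + v * ?p u) \<in> J"
      using C by (intro J_add m J_mult_left[OF pCons(2)] C_add)
    then show ?case by (simp add: algebra_simps)
  qed (simp add: J_0)
  ultimately show ?thesis using J_closed by (meson closed_sequentially)
qed

lemma fc_sum_orthogonal:
  assumes f: "fc_fun f" and b: "finite I" "\<And>i. i \<in> I \<Longrightarrow> b i \<in> C" "\<And>i. i \<in> I \<Longrightarrow> adj (b i) = b i"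
    "\<And>i j. i \<in> I \<Longrightarrow> j \<in> I \<Longrightarrow> i \<noteq> j \<Longrightarrow> b i * b j \<in> J"
  shows "fc f (\<Sum>i\<in>I. b i) - (\<Sum>i\<in>I. fc f (b i)) \<in> J"
  using b
proof (induct I rule: finite_induct)
  case empty
  then show ?case by (simp add: fc_zero[OF f] J_0)
next
  case (insert k I)
  let ?s = "\<Sum>i\<in>I. b i"
  have "fc f ?s - (\<Sum>i\<in>I. fc f (b i)) \<in> J" using insert by auto
  moreover have "fc f (b k + ?s) - (fc f (b k) + fc f ?s) \<in> J"
  proof (rule fc_add_orthogonal[OF f])
    show "?s \<in> C" using insert.prems by (intro cstar_subalgebra_sum[OF C]) auto
    show "adj ?s = ?s" using insert.prems by (simp add: adj_sum)
    show "b k * ?s \<in> J" unfolding sum_distrib_left using insert by (intro J_sum) auto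
    show "?s * b k \<in> J" unfolding sum_distrib_right using insert by (intro J_sum) auto
  qed (use insert.prems in auto)
  ultimately have "(fc f (b k + ?s) - (fc f (b k) + fc f ?s)) + (fc f ?s - (\<Sum>i\<in>I. fc f (b i))) \<in> J"
    by (intro J_add)
  then show ?case using insert.hyps by (simp add: algebra_simps)
qed

text \<open>
  With cube roots \<open>b\<^sub>i\<close> of the given elements, the positive and negative parts \<open>p, m\<close> of
  \<open>b\<^sub>k - (\<Sum>i\<noteq>k. b\<^sub>i)\<close> are orthogonal lifts of \<open>b\<^sub>k\<close> and \<open>\<Sum>i\<noteq>k. b\<^sub>i\<close>. Then \<open>p\<^sup>3\<close> lifts the
  \<open>k\<close>-th element and the elements \<open>m b\<^sub>i m\<close>, all orthogonal to \<open>p\<close>, are congruent to the other ones.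
\<close>

lemma lift_orthogonal_positive:
  assumes "finite I" "\<And>i. i \<in> I \<Longrightarrow> a i \<in> C" "\<And>i. i \<in> I \<Longrightarrow> positive_elem (a i)"
    "\<And>i j. i \<in> I \<Longrightarrow> j \<in> I \<Longrightarrow> i \<noteq> j \<Longrightarrow> a i * a j \<in> J"
  shows "\<exists>e. (\<forall>i\<in>I. e i \<in> C \<and> positive_elem (e i) \<and> e i - a i \<in> J) \<and>
    (\<forall>i\<in>I. \<forall>j\<in>I. i \<noteq> j \<longrightarrow> e i * e j = 0) \<and>
    (\<forall>y. (\<forall>i\<in>I. y * a i = 0) \<longrightarrow> (\<forall>i\<in>I. y * e i = 0))"
  using assms
proof (induct I arbitrary: a rule: finite_induct)
  case empty
  then show ?case by simp
next
  case (insert k I)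
  note aC = insert.prems(1) and ap = insert.prems(2) and ao = insert.prems(3)
  \<comment> \<open>Cube roots, because compressing \<open>b i\<close> by \<open>m\<close> from both
    sides below gives its cube modulo \<open>J\<close>.\<close>
  define cr where "cr t = root 3 (pos_part t)" for t
  have cr: "fc_fun cr" "fc_fun (\<lambda>t. sqrt (cr t))" "\<And>t. cr t \<ge> 0"
    unfolding cr_def by (auto intro!: fc_intros)
  define b where "b i = fc cr (a i)" for i
  let ?I = "insert k I"
  have as: "adj (a i) = a i" if "i \<in> ?I" for i using ap[OF that] by (rule positive_elem_selfadj)
  have bC: "b i \<in> C" if "i \<in> ?I" for i
    unfolding b_def using fc_in_subalgebra[OF C] aC as cr(1) that by blast
  have bs: "adj (b i) = b i" if "i \<in> ?I" for i
    unfolding b_def using fc_selfadj as cr(1) that by blast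
  have bp: "positive_elem (b i)" if "i \<in> ?I" for i
    unfolding b_def using positive_elem_fc as cr that by blast
  have cube: "b i * b i * b i = a i" if "i \<in> ?I" for i
  proof -
    have "(\<lambda>t. cr t * cr t * cr t) = pos_part"
    proof
      fix t show "cr t * cr t * cr t = pos_part t"
        using real_root_pow_pos2[of 3 "pos_part t"] by (simp add: cr_def power3_eq_cube)
    qed
    then have "fc (\<lambda>t. cr t * cr t * cr t) (a i) = a i"
      using positive_elem_fc_pos_part[OF ap[OF that]] by simp
    then show ?thesis
      by (simp add: b_def fc_mult[OF as[OF that]] fc_fun_mult cr)
  qed
  have bo: "b i * b j \<in> J" if ij: "i \<in> ?I" "j \<in> ?I" "i \<noteq> j" for i j
  proof -
    \<comment> \<open>Orthogonality modulo \<open>J\<close> is carried from the \<open>a i\<close>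
      to the \<open>b i\<close> one factor at a time: each set is closed and contains the relevant
      polynomials.\<close>
    have cl: "closed {z. a i * z \<in> J}" "closed {z. z * b j \<in> J}"
      by (rule closed_vimage[OF J_closed, unfolded vimage_def]; intro continuous_intros)+
    have "b j \<in> {z. a i * z \<in> J}" unfolding b_def
      using ij aC as ao cr by (intro fc_in_closed cl) (auto simp: pev_def intro: mult_pact_in_J)
    then have aib: "a i * b j \<in> J" by simp
    have pJ: "pact q (a i) z \<in> J" if "z \<in> J" for q z
      using that aC ij by (induct q) (auto simp: J_0 intro: J_add J_scaleR J_mult_left)
    have "b i \<in> {z. z * b j \<in> J}" unfolding b_def[of i]
      using ij as cr aib by (intro fc_in_closed cl) (auto simp: pev_def pJ simp flip: pact_times_right)
    then show ?thesis by simp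
  qed
  define c where "c = b k - (\<Sum>i\<in>I. b i)"
  have sC: "(\<Sum>i\<in>I. b i) \<in> C" using bC by (intro cstar_subalgebra_sum[OF C]) auto
  have cC: "c \<in> C" unfolding c_def using bC sC by (intro cstar_subalgebra_diff[OF C]) auto
  have cs: "adj c = c" using bs by (simp add: c_def adj_minus adj_sum)
  \<comment> \<open>The elements \<open>b k\<close> and \<open>- b i\<close> are pairwise orthogonal
    modulo \<open>J\<close>, so \<open>f\<close> acts on them separately; the reflection accounts
    for the sign.\<close>
  have split: "fc f c - (fc f (b k) + (\<Sum>i\<in>I. fc (\<lambda>t. f (- t)) (b i))) \<in> J" if f: "fc_fun f" for f
  proof -
    define b' where "b' i = (if i = k then b i else - b i)" for i
    have "fc f (\<Sum>i\<in>?I. b' i) - (\<Sum>i\<in>?I. fc f (b' i)) \<in> J"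
    proof (rule fc_sum_orthogonal[OF f])
      show "b' i * b' j \<in> J" if "i \<in> ?I" "j \<in> ?I" "i \<noteq> j" for i j
        using bo[OF that] by (auto simp: b'_def intro: J_minus)
    qed (use insert.hyps bC bs in \<open>auto simp: b'_def adj_uminus cstar_subalgebra_minus[OF C]\<close>)
    moreover have "(\<Sum>i\<in>I. b' i) = - (\<Sum>i\<in>I. b i)"
      unfolding sum_negf[symmetric] using insert.hyps by (intro sum.cong) (auto simp: b'_def)
    moreover have "(\<Sum>i\<in>I. fc f (b' i)) = (\<Sum>i\<in>I. fc (\<lambda>t. f (- t)) (b i))"
      using insert.hyps by (intro sum.cong) (auto simp: b'_def fc_reflect bs f)
    ultimately show ?thesis using insert.hyps by (simp add: c_def b'_def)
  qed
  define p where "p = fc pos_part c"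
  define m where "m = fc neg_part c"
  have pm: "adj p = p" "adj m = m" "p \<in> C" "m \<in> C"
    unfolding p_def m_def
    by (simp_all add: fc_selfadj[OF cs] fc_in_subalgebra[OF C cC cs] fc_intros)
  have "p * m = fc (\<lambda>t. pos_part t * neg_part t) c"
    by (simp add: p_def m_def fc_mult[OF cs] fc_intros)
  also have "(\<lambda>t. pos_part t * neg_part t) = (\<lambda>t. 0 * t)" by (auto simp: max_def)
  also have "fc (\<lambda>t. 0 * t) c = 0" using fc_cmult[OF cs fc_fun_id, of 0] by simp
  finally have p_m: "p * m = 0" .
  have pJ: "p - b k \<in> J" and mJ: "m - (\<Sum>i\<in>I. b i) \<in> J"
    using split[OF fc_fun_pos_part] split[OF fc_fun_neg_part] bp
    by (simp_all add: p_def m_def positive_elem_neg_part positive_elem_fc_pos_part)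
  define a' where "a' i = m * b i * m" for i
  have a'C: "a' i \<in> C" if "i \<in> I" for i unfolding a'_def using pm bC that by (intro C_mult) auto
  have a'J: "a' i - a i \<in> J" if i: "i \<in> I" for i
  proof -
    let ?s = "\<Sum>j\<in>I. b j"
    have l: "?s * b i - b i * b i \<in> J"
    proof -
      have "?s * b i - b i * b i = (\<Sum>j\<in>I - {i}. b j * b i)"
        using insert.hyps i by (simp add: sum.remove[of I i] distrib_right sum_distrib_right)
      then show ?thesis using bo i by (auto intro!: J_sum)
    qed
    have r: "b i * ?s - b i * b i \<in> J"
    proof -
      have "b i * ?s - b i * b i = (\<Sum>j\<in>I - {i}. b i * b j)"
        using insert.hyps i by (simp add: sum.remove[of I i] distrib_left sum_distrib_left)
      then show ?thesis using bo i by (auto intro!: J_sum)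
    qed
    have "m * b i - ?s * b i \<in> J"
      using mJ bC i by (simp flip: left_diff_distrib add: J_mult_right)
    then have 1: "m * b i - b i * b i \<in> J" using l by (rule J_trans)
    have "m * b i * m - b i * b i * ?s \<in> J"
      using bC i pm by (intro J_mult_cong[OF 1 mJ] C_mult) auto
    moreover have "b i * (b i * ?s - b i * b i) \<in> J" using r bC i by (intro J_mult_left) auto
    then have "b i * b i * ?s - b i * b i * b i \<in> J" by (simp add: algebra_simps)
    ultimately have "m * b i * m - b i * b i * b i \<in> J" by (rule J_trans)
    then show ?thesis using cube i by (simp add: a'_def)
  qed
  have a'p: "positive_elem (a' i)" if i: "i \<in> I" for i
  proof -
    obtain r where "b i = adj r * r" using bp[of i] i by (auto simp: positive_elem_def)
    then have "a' i = adj (r * m) * (r * m)" by (simp add: a'_def adj_mult pm mult.assoc)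
    then show ?thesis unfolding positive_elem_def by blast
  qed
  have a'o: "a' i * a' j \<in> J" if "i \<in> I" "j \<in> I" "i \<noteq> j" for i j
  proof -
    have "a' i * a' j - a i * a j \<in> J"
      using a'J a'C aC that by (intro J_mult_cong) auto
    from J_add[OF this ao[of i j]] that show ?thesis by auto
  qed
  have "\<exists>e. (\<forall>i\<in>I. e i \<in> C \<and> positive_elem (e i) \<and> e i - a' i \<in> J) \<and>
    (\<forall>i\<in>I. \<forall>j\<in>I. i \<noteq> j \<longrightarrow> e i * e j = 0) \<and>
    (\<forall>y. (\<forall>i\<in>I. y * a' i = 0) \<longrightarrow> (\<forall>i\<in>I. y * e i = 0))"
    by (rule insert.hyps(3)) (fact a'C a'p a'o)+
  then obtain e where e1: "\<forall>i\<in>I. e i \<in> C \<and> positive_elem (e i) \<and> e i - a' i \<in> J"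
    and e2: "\<forall>i\<in>I. \<forall>j\<in>I. i \<noteq> j \<longrightarrow> e i * e j = 0"
    and e3: "\<forall>y. (\<forall>i\<in>I. y * a' i = 0) \<longrightarrow> (\<forall>i\<in>I. y * e i = 0)"
    by (elim exE conjE)
  note e = bspec[OF e1] e2[rule_format] e3[rule_format]
  \<comment> \<open>\<open>p * m = 0\<close> makes \<open>p\<close> annihilate every
    \<open>a' i\<close>, and the last clause of the induction hypothesis carries this over to the
    lifts. This is what that clause is for.\<close>
  have pe: "p * e i = 0" if "i \<in> I" for i
    using e(3)[of p] p_m that by (simp add: a'_def flip: mult.assoc)
  have ep: "e i * p = 0" if "i \<in> I" for i
    using pe[OF that] adj_mult[of p "e i"] e(1)[OF that]
    by (simp add: positive_elem_selfadj pm adj_zero)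
  define e' where "e' i = (if i = k then p * p * p else e i)" for i
  have "p * p * p = adj (fc (\<lambda>t. sqrt (pos_part t)) c * p) * (fc (\<lambda>t. sqrt (pos_part t)) c * p)"
  proof -
    let ?s = "fc (\<lambda>t. sqrt (pos_part t)) c"
    have "adj ?s = ?s" by (rule fc_selfadj[OF cs]) (intro fc_intros)
    moreover have "?s * ?s = p"
      unfolding p_def by (rule fc_nonneg_square[symmetric]) (auto simp: cs fc_fun_pos_part)
    ultimately show ?thesis by (simp add: adj_mult pm mult.assoc) (metis mult.assoc)
  qed
  then have ppp: "positive_elem (p * p * p)" unfolding positive_elem_def by blast
  have "p * p * p - b k * b k * b k \<in> J"
    using pm bC by (intro J_mult_cong[OF J_mult_cong[OF pJ pJ] pJ] C_mult) auto
  then have pa: "p * p * p - a k \<in> J" using cube by simp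
  have "e' i \<in> C \<and> positive_elem (e' i) \<and> e' i - a i \<in> J" if "i \<in> ?I" for i
    using that e(1)[of i] pm ppp pa J_trans[OF _ a'J] C_mult by (auto simp: e'_def)
  moreover have "e' i * e' j = 0" if "i \<in> ?I" "j \<in> ?I" "i \<noteq> j" for i j
  proof -
    have "p * p * p * e j = 0" if "j \<in> I" for j using pe[OF that] by (simp add: mult.assoc)
    moreover have "e i * (p * p * p) = 0" if "i \<in> I" for i using ep[OF that] by (simp flip: mult.assoc)
    ultimately show ?thesis using that e(2) by (auto simp: e'_def)
  qed
  moreover have "y * e' i = 0" if y: "\<forall>i\<in>?I. y * a i = 0" and i: "i \<in> ?I" for y i
  proof -
    have yb: "y * b i = 0" if "i \<in> ?I" for i
      unfolding b_def using mult_fc_eq_0[OF cr(1) as[OF that]] y that by blast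
    then have "y * c = 0" by (simp add: c_def right_diff_distrib sum_distrib_left)
    then have "y * p = 0" "y * m = 0"
      unfolding p_def m_def using mult_fc_eq_0[OF _ cs] fc_intros by blast+
    then show ?thesis using e(3)[of y] i by (auto simp: e'_def a'_def simp flip: mult.assoc)
  qed
  ultimately show ?case by (intro exI[of _ e']) blast
qed

text \<open>Truncating the lifts at 1 preserves orthogonality. It does not change them modulo
  \<open>J\<close>, because \<open>small\<close> says that each \<open>a i\<close> has norm at most
  one in the quotient.\<close>

theorem lift_orthogonal_contractions:
  assumes "finite I" "\<And>i. i \<in> I \<Longrightarrow> a i \<in> C" "\<And>i. i \<in> I \<Longrightarrow> positive_elem (a i)"
    "\<And>i j. i \<in> I \<Longrightarrow> j \<in> I \<Longrightarrow> i \<noteq> j \<Longrightarrow> a i * a j \<in> J"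
    and small: "\<And>i \<delta>. i \<in> I \<Longrightarrow> \<delta> > 0 \<Longrightarrow> \<exists>y. y - a i \<in> J \<and> norm y < 1 + \<delta>"
  obtains e where "\<And>i. i \<in> I \<Longrightarrow> e i \<in> C" "\<And>i. i \<in> I \<Longrightarrow> positive_contraction (e i)"
    "\<And>i. i \<in> I \<Longrightarrow> e i - a i \<in> J" "\<And>i j. i \<in> I \<Longrightarrow> j \<in> I \<Longrightarrow> i \<noteq> j \<Longrightarrow> e i * e j = 0"
proof -
  have "\<exists>e. (\<forall>i\<in>I. e i \<in> C \<and> positive_elem (e i) \<and> e i - a i \<in> J) \<and>
    (\<forall>i\<in>I. \<forall>j\<in>I. i \<noteq> j \<longrightarrow> e i * e j = 0) \<and>
    (\<forall>y. (\<forall>i\<in>I. y * a i = 0) \<longrightarrow> (\<forall>i\<in>I. y * e i = 0))"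
    by (rule lift_orthogonal_positive) (fact assms(1-4))+
  then obtain e where e1: "\<forall>i\<in>I. e i \<in> C \<and> positive_elem (e i) \<and> e i - a i \<in> J"
    and e2: "\<forall>i\<in>I. \<forall>j\<in>I. i \<noteq> j \<longrightarrow> e i * e j = 0"
    by (elim exE conjE)
  have e: "e i \<in> C" "positive_elem (e i)" "e i - a i \<in> J" if "i \<in> I" for i
    using bspec[OF e1 that] by simp_all
  note e = this and eo = e2[rule_format]
  define h where "h t = min (pos_part t) 1" for t
  have h: "fc_fun h" "\<And>t. h t \<ge> 0" unfolding h_def by (auto intro!: fc_intros)
  have es: "adj (e i) = e i" if "i \<in> I" for i using e(2)[OF that] by (rule positive_elem_selfadj)
  have "fc h (e i) \<in> C" if i: "i \<in> I" for i
    using fc_in_subalgebra[OF C e(1) es h(1)] i by blast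
  moreover have "positive_contraction (fc h (e i))" if i: "i \<in> I" for i
    unfolding positive_contraction_def
  proof
    show "norm (fc h (e i)) \<le> 1"
      by (rule norm_fc_le[OF es[OF i] h(1) less_add_one]) (simp add: h_def)
  qed (rule positive_elem_fc[OF es[OF i] h])
  moreover have "fc h (e i) * fc h (e j) = 0" if ij: "i \<in> I" "j \<in> I" "i \<noteq> j" for i j
    using ij eo es h(1) by (intro mult_fc_eq_0 fc_mult_eq_0) auto
  moreover have "fc h (e i) - a i \<in> J" if i: "i \<in> I" for i
  proof -
    have "fc h (e i) - e i \<in> J"
    proof (rule iffD1[OF closed_approachable[OF J_closed]], intro allI impI)
      fix \<delta> :: real assume \<delta>: "\<delta> > 0"
      obtain y where y: "y - a i \<in> J" "norm y < 1 + \<delta> / 2" using small[OF i, of "\<delta> / 2"] \<delta> by auto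
      \<comment> \<open>A self-adjoint element congruent to \<open>e i\<close> of norm below
        \<open>1 + \<delta> / 2\<close>; on an interval of that radius \<open>h\<close> and
        \<open>pos_part\<close> differ by at most \<open>\<delta> / 2\<close>. Hence
        \<open>fc h (e i) - e i\<close> is within \<open>\<delta>\<close> of
        \<open>J\<close>.\<close>
      define z where "z = (1/2) *\<^sub>R (y + adj y)"
      have zs: "adj z = z" by (simp add: z_def adj_scaleR adj_add adj_adj add.commute)
      have ye: "y - e i \<in> J" using J_trans[OF y(1) J_sym[OF e(3)[OF i]]] .
      have "(1/2) *\<^sub>R ((y - e i) + adj (y - e i)) \<in> J" using ye by (intro J_scaleR J_add J_adj)
      moreover have "(1/2) *\<^sub>R ((y - e i) + adj (y - e i)) = z - (1/2) *\<^sub>R (e i + e i)"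
        by (simp add: z_def adj_minus es[OF i] algebra_simps)
      ultimately have ze: "z - e i \<in> J" by (simp flip: scaleR_2)
      have zC: "z \<in> C" using C_add[OF subsetD[OF J_subset ze] e(1)[OF i]] by simp
      have zn: "norm z < 1 + \<delta> / 2"
        using norm_triangle_ineq[of y "adj y"] y(2) by (simp add: z_def norm_adj)
      have "fc h (e i) - fc h z \<in> J" "fc pos_part z - fc pos_part (e i) \<in> J"
        using ze zC zs e(1)[OF i] es[OF i] h(1) by (auto intro!: fc_cong J_sym[OF ze] fc_fun_pos_part)
      then have "(fc h (e i) - fc h z) + (fc pos_part z - fc pos_part (e i)) \<in> J" by (rule J_add)
      moreover have "norm (fc (\<lambda>t. h t - pos_part t) z) \<le> \<delta> / 2"
        by (rule norm_fc_le[OF zs _ zn]) (use h \<delta> in \<open>auto simp: h_def intro!: fc_intros\<close>)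
      then have "norm (fc h z - fc pos_part z) < \<delta>"
        using \<delta> by (simp add: fc_diff[OF zs h(1) fc_fun_pos_part])
      ultimately show "\<exists>x\<in>J. dist x (fc h (e i) - e i) < \<delta>"
        using e(2)[OF i]
        by (intro bexI[of _ "(fc h (e i) - fc h z) + (fc pos_part z - fc pos_part (e i))"])
           (simp_all add: dist_norm positive_elem_fc_pos_part norm_minus_commute)
    qed
    then show ?thesis using e(3)[OF i] by (rule J_trans)
  qed
  ultimately show thesis by (intro that[of "\<lambda>i. fc h (e i)"])
qed

end


section \<open>Norms of orthogonal sums\<close>

text \<open>Squaring kills the cross terms, so the exponent doubles while only two summands remain.
  The resulting factor two disappears for large exponents.\<close>

lemma norm_add_orthogonal_power:
  fixes u v :: "'a::cstar_algebra"
  shows "adj u = u \<Longrightarrow> adj v = v \<Longrightarrow> u * v = 0 \<Longrightarrow> norm (u + v) ^ (2 ^ k) \<le> norm u ^ (2 ^ k) + norm v ^ (2 ^ k)"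
proof (induct k arbitrary: u v)
  case 0
  then show ?case by (simp add: norm_triangle_ineq)
next
  case (Suc k)
  have vu: "v * u = 0" using adj_mult[of u v] Suc.prems by (simp add: adj_zero)
  have sq: "(norm x)\<^sup>2 = norm (x * x)" if "adj x = x" for x :: 'a
    using norm_selfadj_square[OF that] by simp
  have pw: "norm x ^ 2 ^ Suc k = norm (x * x) ^ 2 ^ k" if "adj x = x" for x :: 'a
    by (simp add: power_mult flip: sq[OF that])
  have "(u + v) * (u + v) = u * u + v * v"
    using Suc.prems vu by (simp add: algebra_simps)
  moreover have "norm (u * u + v * v) ^ 2 ^ k \<le> norm (u * u) ^ 2 ^ k + norm (v * v) ^ 2 ^ k"
  proof (rule Suc.hyps)
    have "u * u * (v * v) = u * (u * v) * v" by (simp add: mult.assoc)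
    then show "u * u * (v * v) = 0" by (simp add: Suc.prems)
  qed (simp_all add: adj_mult Suc.prems)
  ultimately show ?case using Suc.prems by (simp add: pw adj_add del: power_Suc)
qed

lemma norm_add_orthogonal_le:
  fixes u v :: "'a::cstar_algebra"
  assumes "adj u = u" "adj v = v" "u * v = 0" "norm u \<le> B" "norm v \<le> B"
  shows "norm (u + v) \<le> B"
proof (rule le_if_powers_le_linear[where C = 1])
  show B: "0 \<le> B" using assms(4) norm_ge_zero order_trans by blast
  fix k :: nat
  have "norm (u + v) ^ 2 ^ k \<le> norm u ^ (2 ^ k) + norm v ^ (2 ^ k)"
    by (rule norm_add_orthogonal_power[OF assms(1-3)])
  also have "\<dots> \<le> B ^ 2 ^ k + B ^ 2 ^ k" using assms by (intro add_mono power_mono) auto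
  also have "\<dots> \<le> (1 * 2 ^ k + 1) * B ^ 2 ^ k"
    using mult_right_mono[of 1 "2 ^ k" "B ^ 2 ^ k"] B by (simp add: algebra_simps)
  finally show "norm (u + v) ^ 2 ^ k \<le> (1 * 2 ^ k + 1) * B ^ 2 ^ k" .
qed simp

lemma norm_sum_orthogonal_le:
  fixes u :: "'i \<Rightarrow> 'a::cstar_algebra"
  assumes "finite I" "\<And>i. i \<in> I \<Longrightarrow> adj (u i) = u i" "\<And>i. i \<in> I \<Longrightarrow> norm (u i) \<le> B" "0 \<le> B"
    "\<And>i j. i \<in> I \<Longrightarrow> j \<in> I \<Longrightarrow> i \<noteq> j \<Longrightarrow> u i * u j = 0"
  shows "norm (\<Sum>i\<in>I. u i) \<le> B"
  using assms
proof (induct I rule: finite_induct)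
  case (insert k I)
  have "norm (u k + (\<Sum>i\<in>I. u i)) \<le> B"
  proof (rule norm_add_orthogonal_le)
    show "adj (\<Sum>i\<in>I. u i) = (\<Sum>i\<in>I. u i)" using insert.prems by (simp add: adj_sum)
    show "u k * (\<Sum>i\<in>I. u i) = 0" unfolding sum_distrib_left
      using insert by (intro sum.neutral) auto
  qed (use insert in auto)
  then show ?case using insert.hyps by simp
qed simp

lemma sum_mult_sum_orthogonal:
  fixes u :: "'i \<Rightarrow> 'a::cstar_algebra"
  assumes "finite I" "\<And>i j. i \<in> I \<Longrightarrow> j \<in> I \<Longrightarrow> i \<noteq> j \<Longrightarrow> u i * v j = 0"
  shows "(\<Sum>i\<in>I. u i) * (\<Sum>i\<in>I. v i) = (\<Sum>i\<in>I. u i * v i)"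
proof -
  have "(\<Sum>i\<in>I. u i) * (\<Sum>i\<in>I. v i) = (\<Sum>i\<in>I. \<Sum>j\<in>I. u i * v j)"
    by (rule sum_product)
  also have "\<dots> = (\<Sum>i\<in>I. \<Sum>j\<in>I. if j = i then u i * v i else 0)"
    using assms by (intro sum.cong refl) auto
  finally show ?thesis using assms(1) by simp
qed

text \<open>Complex coefficients destroy self-adjointness; the product \<open>adj ?x * ?x\<close>
  restores it and is again an orthogonal sum. The bound does not grow with the number of
  summands.\<close>

lemma norm_scaled_sum_orthogonal_le:
  fixes e :: "'i \<Rightarrow> 'a::cstar_algebra"
  assumes I: "finite I" and e: "\<And>i. i \<in> I \<Longrightarrow> adj (e i) = e i" "\<And>i. i \<in> I \<Longrightarrow> norm (e i) \<le> 1"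
    "\<And>i j. i \<in> I \<Longrightarrow> j \<in> I \<Longrightarrow> i \<noteq> j \<Longrightarrow> e i * e j = 0"
    and c: "\<And>i. i \<in> I \<Longrightarrow> cmod (c i) \<le> B" "0 \<le> B"
  shows "norm (\<Sum>i\<in>I. c i *\<^sub>C e i) \<le> B"
proof -
  let ?x = "\<Sum>i\<in>I. c i *\<^sub>C e i"
  have "adj ?x * ?x = (\<Sum>i\<in>I. cnj (c i) *\<^sub>C e i) * ?x" by (simp add: adj_sum adj_scaleC e)
  also have "\<dots> = (\<Sum>i\<in>I. (cnj (c i) *\<^sub>C e i) * (c i *\<^sub>C e i))"
    by (rule sum_mult_sum_orthogonal[OF I]) (simp add: mult_scaleC_left mult_scaleC_right e scaleC_zero)
  also have "\<dots> = (\<Sum>i\<in>I. (cmod (c i))\<^sup>2 *\<^sub>R (e i * e i))"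
    by (simp only: mult_scaleC_left mult_scaleC_right scaleC_scaleC scaleR_scaleC complex_norm_square mult.commute)
  finally have "(norm ?x)\<^sup>2 = norm (\<Sum>i\<in>I. (cmod (c i))\<^sup>2 *\<^sub>R (e i * e i))"
    by (metis cstar_identity)
  also have "\<dots> \<le> B\<^sup>2"
  proof (rule norm_sum_orthogonal_le[OF I])
    fix i assume i: "i \<in> I"
    have "(cmod (c i))\<^sup>2 * (norm (e i))\<^sup>2 \<le> B\<^sup>2 * 1"
      using c(1)[OF i] c(2) e(2)[OF i] by (intro mult_mono power_mono) (auto simp: power_le_one)
    then show "norm ((cmod (c i))\<^sup>2 *\<^sub>R (e i * e i)) \<le> B\<^sup>2"
      using norm_selfadj_square[OF e(1)[OF i]] by simp
  next
    fix i j assume ij: "i \<in> I" "j \<in> I" "i \<noteq> j"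
    have "e i * e i * (e j * e j) = e i * (e i * e j) * e j" by (simp add: mult.assoc)
    then show "(cmod (c i))\<^sup>2 *\<^sub>R (e i * e i) * ((cmod (c j))\<^sup>2 *\<^sub>R (e j * e j)) = 0"
      using e(3)[OF ij] by simp
  qed (auto simp: adj_scaleR adj_mult e)
  finally show ?thesis using c(2) by (rule power2_le_imp_le)
qed


section \<open>Partitions of unity from the asymptotic dimension of the box space\<close>

lemma (in group) lcoset_eqI:
  assumes "subgroup H G" "x \<in> carrier G" "y \<in> x <# H"
  shows "y <# H = x <# H"
  using l_repr_independence[OF assms(3,2,1)] by simp

lemma (in group) lcosets_subset_carrier: "subgroup H G \<Longrightarrow> X \<in> lcosets H \<Longrightarrow> X \<subseteq> carrier G"
  using subgroup.lcosets_carrier is_group by metis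

lemma (in group) lcosets_eq_lcoset: "subgroup H G \<Longrightarrow> X \<in> lcosets H \<Longrightarrow> x \<in> X \<Longrightarrow> X = x <# H"
  unfolding LCOSETS_def using lcoset_eqI by fastforce

lemma (in group) lcosets_memI: "x \<in> carrier G \<Longrightarrow> x <# H \<in> lcosets H"
  unfolding LCOSETS_def by blast

locale proper_metric_group = group G + Metric_space "carrier G" d
  for G :: "('g, 'm) monoid_scheme" (structure) and d +
  assumes proper: "x \<in> carrier G \<Longrightarrow> finite {y \<in> carrier G. d x y \<le> r}"
    and right_invariant: "x \<in> carrier G \<Longrightarrow> y \<in> carrier G \<Longrightarrow> g \<in> carrier G \<Longrightarrow> d (x \<otimes> g) (y \<otimes> g) = d x y"
begin

text \<open>With a right-invariant metric, moving \<open>x\<close> from the right by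
  \<open>t\<close> is measured by a conjugate of \<open>t\<close>; this is where the conjugacy
  classes come in.\<close>

lemma dist_right_mult:
  assumes "x \<in> carrier G" "t \<in> carrier G"
  shows "d x (x \<otimes> t) = d \<one> (x \<otimes> t \<otimes> inv x)"
  using right_invariant[of x "x \<otimes> t" "inv x"] assms by simp

lemma quotient_metric_le:
  assumes "X \<subseteq> carrier G" "Y \<subseteq> carrier G" "x \<in> X" "y \<in> Y"
  shows "quotient_metric d X Y \<le> d x y"
  unfolding quotient_metric_def using assms by (intro cInf_lower bdd_belowI[of _ 0]) auto

lemma quotient_metric_less:
  assumes "X \<noteq> {}" "Y \<noteq> {}" "quotient_metric d X Y < r"
  obtains x y where "x \<in> X" "y \<in> Y" "d x y < r"
  using assms cInf_lessD[of "{d x y |x y. x \<in> X \<and> y \<in> Y}" r] unfolding quotient_metric_def by auto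

text \<open>If \<open>t\<close> moves some \<open>x\<close> by at most \<open>\<rho>\<close>, a
  conjugate of \<open>t\<close> lies in a finite ball. For each nontrivial element of the ball some
  level contains none of its conjugates, and as the levels decrease the largest of these finitely
  many indices works for all.\<close>

lemma exists_injective_level:
  assumes \<sigma>: "regular_approximation G \<sigma>"
  shows "\<exists>n. \<forall>x\<in>carrier G. \<forall>t\<in>\<sigma> n. d x (x \<otimes> t) \<le> \<rho> \<longrightarrow> t = \<one>"
proof -
  define S where "S = {y \<in> carrier G. d \<one> y \<le> \<rho>} - {\<one>}"
  have "\<forall>g\<in>S. \<exists>n. \<sigma> n \<inter> (conj_class G g <#> \<sigma> n) = {}"
    using \<sigma> unfolding regular_approximation_def S_def by blast
  then obtain N where N: "\<And>g. g \<in> S \<Longrightarrow> \<sigma> (N g) \<inter> (conj_class G g <#> \<sigma> (N g)) = {}" by metis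
  have sub: "subgroup (\<sigma> n) G" for n
    using \<sigma> by (auto simp: regular_approximation_def finite_index_subgroup_def)
  have dec: "\<sigma> n \<subseteq> \<sigma> m" if "m \<le> n" for m n
    using \<sigma> lift_Suc_antimono_le[of \<sigma>] that by (auto simp: regular_approximation_def)
  have fin: "finite S" using proper[of \<one>] by (simp add: S_def)
  define n where "n = Max (insert 0 (N ` S))"
  have n: "N g \<le> n" if "g \<in> S" for g using fin that by (simp add: n_def)
  have "t = \<one>" if x: "x \<in> carrier G" and t: "t \<in> \<sigma> n" and le: "d x (x \<otimes> t) \<le> \<rho>" for x t
  proof (rule ccontr)
    assume t1: "t \<noteq> \<one>"
    have tc: "t \<in> carrier G" using t sub subgroup.subset by blast
    define g where "g = x \<otimes> t \<otimes> inv x"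
    have g: "g \<in> carrier G" using x tc by (simp add: g_def)
    have tg: "t = inv x \<otimes> g \<otimes> inv (inv x)" using x tc by (simp add: g_def m_assoc inv_solve_left)
    then have "g \<noteq> \<one>" using x t1 by auto
    then have gS: "g \<in> S" using g le x tc by (simp add: S_def g_def dist_right_mult)
    have "t \<in> conj_class G g" unfolding conj_class_def using tg x by blast
    moreover have "\<one> \<in> \<sigma> (N g)" using sub subgroup.one_closed by blast
    ultimately have "t \<in> conj_class G g <#> \<sigma> (N g)" unfolding set_mult_def using tc by force
    moreover have "t \<in> \<sigma> (N g)" using t dec[OF n[OF gS]] by blast
    ultimately show False using N[OF gS] by blast
  qed
  then show ?thesis by blast
qed

text \<open>
  A cover of the box space gives bounded sets in \<open>G / \<sigma> n\<close>, which lift to disjoint translates of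
  finite sets in \<open>G\<close> once \<open>\<sigma> n\<close> meets no conjugate of a large ball. The weight of a point is the
  number \<open>depth\<close> of radii \<open>k r\<close>, \<open>1 \<le> k \<le> K\<close>, for which the ball around it lies in one set of the cover.
\<close>

theorem box_partition_of_unity:
  assumes \<sigma>: "regular_approximation G \<sigma>" and dB: "box_space_metric G d \<sigma> dB"
    and asd: "asdim_le (box_space G \<sigma>) dB s"
    and M: "finite M" "M \<subseteq> carrier G" and \<epsilon>: "\<epsilon> > 0"
  obtains n and \<nu> :: "nat \<Rightarrow> 'g \<Rightarrow> real" where
    "\<And>l g. 0 \<le> \<nu> l g" "\<And>l g. \<nu> l g \<le> 1"
    "\<And>l. finite {g \<in> carrier G. \<nu> l g \<noteq> 0}"
    "\<And>l g h. g \<in> carrier G \<Longrightarrow> h \<in> carrier G \<Longrightarrow> g <# \<sigma> n = h <# \<sigma> n \<Longrightarrow>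
       \<nu> l g \<noteq> 0 \<Longrightarrow> \<nu> l h \<noteq> 0 \<Longrightarrow> g = h"
    "\<And>X. X \<in> lcosets (\<sigma> n) \<Longrightarrow> (\<Sum>l\<le>s. \<Sum>g\<in>{g \<in> X. \<nu> l g \<noteq> 0}. \<nu> l g) = 1"
    "\<And>l k g. k \<in> M \<Longrightarrow> g \<in> carrier G \<Longrightarrow> \<bar>\<nu> l g - \<nu> l (k \<otimes> g)\<bar> \<le> \<epsilon>"
proof -
  \<comment> \<open>Bounds how far \<open>M\<close> moves any point.\<close>
  define r where "r = Max (insert 1 (d \<one> ` M))"
  have r1: "r \<ge> 1" and rM: "k \<in> M \<Longrightarrow> d \<one> k \<le> r" for k
    using M(1) by (auto simp: r_def)
  have rk: "d g (k \<otimes> g) \<le> r" if "k \<in> M" "g \<in> carrier G" for k g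
    using right_invariant[of \<one> k g] rM[of k] that M(2) by auto
  \<comment> \<open>Makes \<open>(s + 2) / K\<close> at most \<open>\<epsilon>\<close>, the amount
    by which a normalised weight changes in one step of length \<open>r\<close>.\<close>
  define K where "K = nat \<lceil>(real s + 2) / \<epsilon>\<rceil>"
  have "(real s + 2) / \<epsilon> > 0" using \<epsilon> by simp
  then have K: "K > 0" "real K \<ge> (real s + 2) / \<epsilon>" by (simp_all add: K_def)
  \<comment> \<open>Strictly above \<open>2 K r\<close>, which bounds the diameter of the largest
    ball.\<close>
  define R where "R = 2 * (real K * r) + 1"
  have R: "R > 0" using r1 by (simp add: R_def add_nonneg_pos)
  obtain V :: "nat \<Rightarrow> (nat \<times> 'g set) set set" where V:
    "\<Union> (\<Union>l\<le>s. V l) = box_space G \<sigma>"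
    "\<exists>B. \<forall>U\<in>(\<Union>l\<le>s. V l). \<forall>x\<in>U. \<forall>y\<in>U. dB x y \<le> B"
    "lebesgue_number_at_least (box_space G \<sigma>) dB (\<Union>l\<le>s. V l) R"
    "\<forall>l\<le>s. pairwise disjnt (V l)"
    using asd R unfolding asdim_le_def by metis
  obtain B0 where B0: "\<And>U x y l. l \<le> s \<Longrightarrow> U \<in> V l \<Longrightarrow> x \<in> U \<Longrightarrow> y \<in> U \<Longrightarrow> dB x y \<le> B0"
    using V(2) by blast
  \<comment> \<open>Above the diameters of the cover with room to spare: the quotient metric is an
    infimum, so representatives are found only below a strict bound.\<close>
  define B where "B = max B0 0 + 1"
  have B: "B > 0" by (simp add: B_def add_nonneg_pos)
  \<comment> \<open>Two points within \<open>B\<close> of a base point are \<open>2 B\<close> apart,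
    and \<open>r\<close> leaves room for one translation by \<open>M\<close>. The bound
    \<open>B\<close> holds at all levels at once, so \<open>n\<close> may be chosen after
    it.\<close>
  obtain n where n: "\<And>x t. x \<in> carrier G \<Longrightarrow> t \<in> \<sigma> n \<Longrightarrow> d x (x \<otimes> t) \<le> 2 * B + r \<Longrightarrow> t = \<one>"
    using exists_injective_level[OF \<sigma>, of "2 * B + r"] by blast
  define H where "H = \<sigma> n"
  have H: "subgroup H G" "finite (lcosets H)"
    using \<sigma> by (auto simp: H_def regular_approximation_def finite_index_subgroup_def)
  have dq: "dB (n, X) (n, Y) = quotient_metric d X Y" if "X \<in> lcosets H" "Y \<in> lcosets H" for X Y
    using dB that unfolding box_space_metric_def H_def by blast
  have lc: "g <# H \<in> lcosets H" if "g \<in> carrier G" for g using that by (rule lcosets_memI)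
  have self: "g \<in> g <# H" if "g \<in> carrier G" for g using lcos_self[OF that H(1)] .
  have sub: "X \<subseteq> carrier G" if "X \<in> lcosets H" for X using lcosets_subset_carrier[OF H(1) that] .
  have inj: "g = h" if gh: "g \<in> carrier G" "h \<in> carrier G" "g <# H = h <# H" "d g h \<le> 2 * B + r" for g h
  proof -
    have "h \<in> g <# H" using gh self by simp
    then obtain t where t: "t \<in> H" "h = g \<otimes> t" unfolding l_coset_def by blast
    with n[OF gh(1), of t] gh(4) have "t = \<one>" by (simp add: H_def)
    with t gh show ?thesis by simp
  qed
  have disj: "U = U'" if "l \<le> s" "U \<in> V l" "U' \<in> V l" "x \<in> U" "x \<in> U'" for l U U' x
    using V(4) that unfolding pairwise_def disjnt_iff by blast
  define ball where "ball k g = {(n, y <# H) |y. y \<in> carrier G \<and> d g y \<le> real k * r}" for k :: nat and g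
  have ball_self: "(n, g <# H) \<in> ball k g" if "g \<in> carrier G" for k g
    unfolding ball_def using that r1 by auto
  have ball_cong: "ball k g \<subseteq> ball k h" if gh: "g \<in> carrier G" "h \<in> carrier G" "g <# H = h <# H" for k g h
  proof -
    have "h \<in> g <# H" using gh self by simp
    then obtain t where t: "t \<in> H" "h = g \<otimes> t" unfolding l_coset_def by blast
    have tc: "t \<in> carrier G" using t(1) H(1) subgroup.subset by blast
    show ?thesis
    proof
      fix z assume "z \<in> ball k g"
      then obtain y where y: "z = (n, y <# H)" "y \<in> carrier G" "d g y \<le> real k * r"
        by (auto simp: ball_def)
      have "y \<otimes> t \<in> y <# H" using t(1) unfolding l_coset_def by blast
      then have "(y \<otimes> t) <# H = y <# H" by (rule lcoset_eqI[OF H(1) y(2)])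
      moreover have "d h (y \<otimes> t) \<le> real k * r" using y gh(1) tc t(2) by (simp add: right_invariant)
      ultimately show "z \<in> ball k h" using y tc by (auto simp: ball_def intro!: exI[of _ "y \<otimes> t"])
    qed
  qed
  have ball_step: "ball k h \<subseteq> ball (Suc k) g" if "g \<in> carrier G" "h \<in> carrier G" "d g h \<le> r" for k g h
  proof
    fix z assume "z \<in> ball k h"
    then obtain y where y: "z = (n, y <# H)" "y \<in> carrier G" "d h y \<le> real k * r" by (auto simp: ball_def)
    have "d g y \<le> real (Suc k) * r" using triangle[OF that(1,2) y(2)] that(3) y(3) by (simp add: algebra_simps)
    then show "z \<in> ball (Suc k) g" using y by (auto simp: ball_def)
  qed
  define D where "D l g = {k \<in> {1..K}. \<exists>U\<in>V l. ball k g \<subseteq> U}" for l g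
  define depth where "depth l g = card (D l g)" for l g
  have Dfin: "finite (D l g)" for l g by (simp add: D_def)
  have depth_cong: "depth l g = depth l h" if "g \<in> carrier G" "h \<in> carrier G" "g <# H = h <# H" for l g h
    using ball_cong[of g h] ball_cong[of h g] that unfolding depth_def D_def by (metis (no_types, opaque_lifting) order_trans)
  \<comment> \<open>A step of length \<open>r\<close> shifts the admissible radii by one and loses
    at most the smallest of them.\<close>
  have depth_step: "depth l g \<le> Suc (depth l h)" if gh: "g \<in> carrier G" "h \<in> carrier G" "d g h \<le> r" for l g h
  proof -
    have "D l g \<subseteq> insert 1 (Suc ` D l h)"
    proof
      fix k assume k: "k \<in> D l g"
      then obtain U where U: "U \<in> V l" "ball k g \<subseteq> U" by (auto simp: D_def)
      show "k \<in> insert 1 (Suc ` D l h)"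
      proof (cases "k = 1")
        case False
        with k obtain j where j: "k = Suc j" "j \<ge> 1" "j \<le> K" by (cases k) (auto simp: D_def)
        have "ball j h \<subseteq> U" using ball_step[OF gh, of j] U j by auto
        with U j have "j \<in> D l h" by (auto simp: D_def)
        with j show ?thesis by blast
      qed simp
    qed
    then have "card (D l g) \<le> card (insert 1 (Suc ` D l h))" by (rule card_mono[rotated]) (simp add: Dfin)
    also have "\<dots> \<le> Suc (card (Suc ` D l h))" by (simp add: card_insert_if Dfin)
    also have "card (Suc ` D l h) = card (D l h)" by (rule card_image) simp
    finally show ?thesis by (simp add: depth_def)
  qed
  have depth_pos: "\<exists>U\<in>V l. ball 1 g \<subseteq> U" if d0: "depth l g \<noteq> 0" and g: "g \<in> carrier G" for l g
  proof -
    have "D l g \<noteq> {}" using d0 by (auto simp: depth_def)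
    then obtain k U where k: "k \<ge> 1" "U \<in> V l" "ball k g \<subseteq> U" by (auto simp: D_def)
    have "real 1 * r \<le> real k * r" using k r1 by (intro mult_right_mono) auto
    then have "ball 1 g \<subseteq> ball k g" by (auto simp: ball_def intro: order_trans)
    with k show ?thesis by blast
  qed
  define S where "S g = (\<Sum>l\<le>s. real (depth l g))" for g
  \<comment> \<open>The Lebesgue number puts the largest ball into one set, whose colour then has
    full depth.\<close>
  have S_ge: "S g \<ge> real K" if g: "g \<in> carrier G" for g
  proof -
    have "ball K g \<subseteq> box_space G \<sigma>" using lc by (auto simp: ball_def box_space_def H_def)
    moreover have "ball K g \<noteq> {}" using ball_self[OF g] by blast
    moreover have "dB x y \<le> 2 * (real K * r)" if xy: "x \<in> ball K g" "y \<in> ball K g" for x y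
    proof -
      obtain a b where ab: "x = (n, a <# H)" "y = (n, b <# H)" "a \<in> carrier G" "b \<in> carrier G"
        "d g a \<le> real K * r" "d g b \<le> real K * r" using xy by (auto simp: ball_def)
      have "dB x y = quotient_metric d (a <# H) (b <# H)" using ab lc by (simp add: dq)
      also have "\<dots> \<le> d a b" using ab lc sub self by (intro quotient_metric_le) auto
      also have "\<dots> \<le> d g a + d g b" using triangle[of a g b] ab g by (simp add: commute)
      finally show ?thesis using ab by simp
    qed
    ultimately obtain U where "U \<in> (\<Union>l\<le>s. V l)" "ball K g \<subseteq> U"
      using V(3) unfolding lebesgue_number_at_least_def R_def by (metis less_add_one)
    then obtain l where l: "l \<le> s" "\<exists>U\<in>V l. ball K g \<subseteq> U" by blast
    have "{1..K} \<subseteq> D l g"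
    proof
      fix k assume k: "k \<in> {1..K}"
      then have "real k * r \<le> real K * r" using r1 by (intro mult_right_mono) auto
      then have "ball k g \<subseteq> ball K g" by (auto simp: ball_def intro: order_trans)
      with k l show "k \<in> D l g" by (auto simp: D_def)
    qed
    from card_mono[OF Dfin this] have "real K \<le> real (depth l g)" by (simp add: depth_def)
    also have "\<dots> \<le> S g" unfolding S_def using l(1) by (intro member_le_sum) auto
    finally show ?thesis .
  qed
  have S_pos: "S g > 0" if "g \<in> carrier G" for g using S_ge[OF that] K by simp
  have S_cong: "S g = S h" if "g \<in> carrier G" "h \<in> carrier G" "g <# H = h <# H" for g h
    unfolding S_def using depth_cong[OF that] by simp
  define weight where "weight l g = real (depth l g) / S g" for l g
  have weight_diff: "\<bar>weight l g - weight l h\<bar> \<le> \<epsilon>"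
    if l: "l \<le> s" and gh: "g \<in> carrier G" "h \<in> carrier G" "d g h \<le> r" for l g h
  proof -
    have ddiff: "\<bar>real (depth l g) - real (depth l h)\<bar> \<le> 1" for l
      using depth_step[OF gh, of l] depth_step[of h g l] gh by (auto simp: commute)
    have "\<bar>S g - S h\<bar> \<le> (\<Sum>l\<le>s. \<bar>real (depth l g) - real (depth l h)\<bar>)"
      unfolding S_def sum_subtractf[symmetric] by (rule sum_abs)
    also have "\<dots> \<le> (\<Sum>l\<le>s. 1)" by (intro sum_mono ddiff)
    finally have Sdiff: "\<bar>S h - S g\<bar> \<le> real s + 1" by simp
    have Sg: "S g > 0" "S h > 0" using S_pos gh by auto
    have dh: "real (depth l h) \<le> S h" unfolding S_def using l by (intro member_le_sum) auto
    have "weight l g - weight l h = (real (depth l g) - real (depth l h)) / S g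
        + (real (depth l h) / S h) * ((S h - S g) / S g)"
      using Sg by (simp add: weight_def field_simps)
    also have "\<bar>\<dots>\<bar> \<le> 1 / S g + 1 * ((real s + 1) / S g)"
    proof (rule order_trans[OF abs_triangle_ineq], rule add_mono)
      show "\<bar>(real (depth l g) - real (depth l h)) / S g\<bar> \<le> 1 / S g"
        using ddiff Sg by (simp add: abs_divide divide_right_mono)
      show "\<bar>real (depth l h) / S h * ((S h - S g) / S g)\<bar> \<le> 1 * ((real s + 1) / S g)"
        unfolding abs_mult using Sdiff Sg dh by (intro mult_mono) (auto simp: abs_divide divide_right_mono)
    qed
    also have "\<dots> = (real s + 2) / S g" by (simp add: add_divide_distrib)
    also have "\<dots> \<le> (real s + 2) / K" using S_ge[OF gh(1)] K(1) by (intro divide_left_mono) auto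
    also have "\<dots> \<le> \<epsilon>" using K \<epsilon> by (simp add: field_simps)
    finally show ?thesis .
  qed
  define base where "base U = (SOME x. x \<in> carrier G \<and> (n, x <# H) \<in> U)" for U :: "(nat \<times> 'g set) set"
  have base: "base U \<in> carrier G \<and> (n, base U <# H) \<in> U" if "x \<in> carrier G" "(n, x <# H) \<in> U" for U x
    unfolding base_def by (rule someI[of _ x]) (use that in blast)
  \<comment> \<open>In each coset belonging to a set of the cover, this singles out the
    representative near the base point chosen for that set.\<close>
  define lifted where "lifted l g \<longleftrightarrow> (\<exists>U\<in>V l. (n, g <# H) \<in> U \<and> d (base U) g \<le> B)" for l g
  have exists_lift: "\<exists>y\<in>g <# H. d (base U) y \<le> B"
    if l: "l \<le> s" and U: "U \<in> V l" and g: "g \<in> carrier G" "(n, g <# H) \<in> U" for l U g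
  proof -
    note b = base[OF g]
    have "dB (n, base U <# H) (n, g <# H) \<le> B0" using B0[OF l U] b g by blast
    then have "quotient_metric d (base U <# H) (g <# H) < B"
      using dq lc b g by (auto simp: B_def)
    then obtain x y where xy: "x \<in> base U <# H" "y \<in> g <# H" "d x y < B"
      using quotient_metric_less self b g by (metis empty_iff)
    then obtain t where t: "t \<in> H" "x = base U \<otimes> t" unfolding l_coset_def by blast
    have tc: "t \<in> carrier G" using t(1) H(1) subgroup.subset by blast
    have yc: "y \<in> carrier G" using xy(2) sub[OF lc[OF g(1)]] by blast
    have "d (base U) (y \<otimes> inv t) = d x y"
      using right_invariant[of "base U" "y \<otimes> inv t" t] b yc tc by (simp add: t(2) m_assoc)
    moreover have "y \<otimes> inv t \<in> y <# H"
      unfolding l_coset_def using subgroup.m_inv_closed[OF H(1) t(1)] by blast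
    then have "y \<otimes> inv t \<in> g <# H" using lcoset_eqI[OF H(1) g(1) xy(2)] by simp
    ultimately show ?thesis using xy(3) by (intro bexI[of _ "y \<otimes> inv t"]) auto
  qed
  have lifted_unique: "g = h"
    if l: "l \<le> s" and gh: "g \<in> carrier G" "h \<in> carrier G" "g <# H = h <# H" "lifted l g" "lifted l h" for l g h
  proof -
    obtain U where U: "U \<in> V l" "(n, g <# H) \<in> U" "d (base U) g \<le> B" using gh(4) by (auto simp: lifted_def)
    obtain U' where U': "U' \<in> V l" "(n, h <# H) \<in> U'" "d (base U') h \<le> B" using gh(5) by (auto simp: lifted_def)
    have "U' = U" using disj[OF l U'(1) U(1) U'(2)] U(2) gh(3) by simp
    then have "d g h \<le> B + B"
      using triangle[of g "base U" h] base[OF gh(1) U(2)] U(3) U'(3) gh by (simp add: commute)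
    then show ?thesis using inj gh r1 by auto
  qed
  \<comment> \<open>Positive depth keeps the coset of \<open>h\<close> in the same set of the cover.
    Its representative near the base point is within \<open>2 B + r\<close> of \<open>h\<close>,
    hence equal to \<open>h\<close>.\<close>
  have lifted_step: "lifted l h"
    if l: "l \<le> s" and gh: "g \<in> carrier G" "h \<in> carrier G" "d g h \<le> r" "lifted l g" "depth l g \<noteq> 0" for l g h
  proof -
    obtain U where U: "U \<in> V l" "(n, g <# H) \<in> U" "d (base U) g \<le> B" using gh(4) by (auto simp: lifted_def)
    obtain U' where U': "U' \<in> V l" "ball 1 g \<subseteq> U'" using depth_pos[OF gh(5,1)] by blast
    have "U' = U" using disj[OF l U'(1) U(1) subsetD[OF U'(2) ball_self[OF gh(1)]] U(2)] .
    moreover have "(n, h <# H) \<in> ball 1 g" unfolding ball_def using gh by auto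
    ultimately have hU: "(n, h <# H) \<in> U" using U' by blast
    obtain y where y: "y \<in> h <# H" "d (base U) y \<le> B" using exists_lift[OF l U(1) gh(2) hU] by blast
    have yc: "y \<in> carrier G" using y(1) sub[OF lc[OF gh(2)]] by blast
    note b = base[OF gh(1) U(2)]
    have "d y h \<le> d y (base U) + (d (base U) g + d g h)"
      using triangle[of y "base U" h] triangle[of "base U" g h] b yc gh by auto
    also have "\<dots> \<le> 2 * B + r" using y U gh by (simp add: commute)
    finally have "y = h" using inj yc gh(2) lcoset_eqI[OF H(1) gh(2) y(1)] by blast
    then show ?thesis using y U hU by (auto simp: lifted_def)
  qed
  define \<nu> where "\<nu> l g = (if l \<le> s \<and> g \<in> carrier G \<and> lifted l g then weight l g else 0)" for l g
  have w01: "0 \<le> weight l g" "l \<le> s \<Longrightarrow> g \<in> carrier G \<Longrightarrow> weight l g \<le> 1" for l g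
  proof -
    have "0 \<le> S g" unfolding S_def by (intro sum_nonneg) simp
    then show "0 \<le> weight l g" by (simp add: weight_def)
    assume "l \<le> s" "g \<in> carrier G"
    then have "real (depth l g) \<le> S g" unfolding S_def by (intro member_le_sum) auto
    then show "weight l g \<le> 1" using S_pos[OF \<open>g \<in> carrier G\<close>] by (simp add: weight_def)
  qed
  have \<nu>_inj: "g = h" if "g \<in> carrier G" "h \<in> carrier G" "g <# H = h <# H" "\<nu> l g \<noteq> 0" "\<nu> l h \<noteq> 0" for l g h
    using lifted_unique[of l g h] that by (auto simp: \<nu>_def split: if_splits)
  have fin: "finite {g \<in> carrier G. \<nu> l g \<noteq> 0}" for l
  proof (rule finite_imageD)
    show "finite ((\<lambda>g. g <# H) ` {g \<in> carrier G. \<nu> l g \<noteq> 0})"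
      using lc by (intro finite_subset[OF _ H(2)]) blast
    show "inj_on (\<lambda>g. g <# H) {g \<in> carrier G. \<nu> l g \<noteq> 0}"
      using \<nu>_inj by (intro inj_onI) blast
  qed
  have sum: "(\<Sum>l\<le>s. \<Sum>g\<in>{g \<in> X. \<nu> l g \<noteq> 0}. \<nu> l g) = 1" if X: "X \<in> lcosets H" for X
  proof -
    obtain x where x: "x \<in> carrier G" "X = x <# H" using X by (auto simp: LCOSETS_def)
    have Xc: "g \<in> carrier G \<and> g <# H = x <# H" if "g \<in> X" for g
      using that sub[OF X] lcoset_eqI[OF H(1) x(1)] x(2) by blast
    have "(\<Sum>g\<in>{g \<in> X. \<nu> l g \<noteq> 0}. \<nu> l g) = weight l x" if l: "l \<le> s" for l
    proof (cases "depth l x = 0")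
      case True
      then have "weight l g = 0" if "g \<in> X" for g
        using Xc[OF that] depth_cong[of g x l] x by (simp add: weight_def)
      then have "{g \<in> X. \<nu> l g \<noteq> 0} = {}" by (auto simp: \<nu>_def split: if_splits)
      then show ?thesis using True by (simp add: weight_def)
    next
      case False
      obtain U where U: "U \<in> V l" "ball 1 x \<subseteq> U" using depth_pos[OF False x(1)] by blast
      then have xU: "(n, x <# H) \<in> U" using ball_self[OF x(1)] by blast
      obtain y where y: "y \<in> X" "d (base U) y \<le> B" using exists_lift[OF l U(1) x(1) xU] x(2) by blast
      have yw: "weight l y = weight l x"
        using Xc[OF y(1)] depth_cong[of y x l] S_cong[of y x] x by (simp add: weight_def)
      have "lifted l y" using U xU y Xc by (auto simp: lifted_def)
      then have \<nu>y: "\<nu> l y = weight l x" using l Xc[OF y(1)] yw by (simp add: \<nu>_def)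
      have "\<nu> l y \<noteq> 0" using False S_pos[OF x(1)] by (simp add: \<nu>y weight_def)
      then have "{g \<in> X. \<nu> l g \<noteq> 0} = {y}" using \<nu>_inj[of _ y l] Xc y(1) by auto
      then show ?thesis by (simp add: \<nu>y)
    qed
    then have "(\<Sum>l\<le>s. \<Sum>g\<in>{g \<in> X. \<nu> l g \<noteq> 0}. \<nu> l g) = (\<Sum>l\<le>s. weight l x)" by simp
    also have "\<dots> = 1" using S_pos[OF x(1)] by (simp add: weight_def S_def flip: sum_divide_distrib)
    finally show ?thesis .
  qed
  \<comment> \<open>Passing from lifted to not lifted happens only where the depth is zero, so
    cutting off outside the lifts creates no jump.\<close>
  have lip: "\<bar>\<nu> l g - \<nu> l h\<bar> \<le> \<epsilon>" if gh: "g \<in> carrier G" "h \<in> carrier G" "d g h \<le> r" for l g h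
  proof (cases "l \<le> s")
    case l: True
    have z: "\<nu> l g = weight l g \<and> \<nu> l h = weight l h \<or> \<nu> l g = 0 \<and> \<nu> l h = 0"
    proof (cases "lifted l g \<longleftrightarrow> lifted l h")
      case False
      have "depth l g = 0" if "lifted l g" using lifted_step[OF l gh that] False that by blast
      moreover have "depth l h = 0" if "lifted l h"
        using lifted_step[OF l gh(2,1) _ that] False that gh(3) by (auto simp: commute)
      ultimately show ?thesis using False by (auto simp: \<nu>_def weight_def)
    qed (use l gh in \<open>auto simp: \<nu>_def\<close>)
    then show ?thesis using weight_diff[OF l gh] \<epsilon> by auto
  qed (use \<epsilon> in \<open>simp add: \<nu>_def\<close>)
  show thesis
  proof (rule that[of \<nu> n])
    show "0 \<le> \<nu> l g" "\<nu> l g \<le> 1" for l g using w01[of l g] by (auto simp: \<nu>_def)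
    show "\<bar>\<nu> l g - \<nu> l (k \<otimes> g)\<bar> \<le> \<epsilon>" if "k \<in> M" "g \<in> carrier G" for l k g
      using lip rk that M(2) by (meson m_closed subsetD)
  qed (use fin \<nu>_inj sum in \<open>simp_all add: H_def\<close>)
qed

end


section \<open>Sequences representing the relative central sequence algebra\<close>

lemma exists_bcontfun_seq:
  fixes f :: "nat \<Rightarrow> 'a::real_normed_vector"
  assumes "\<And>n. norm (f n) \<le> B"
  shows "\<exists>x :: nat \<Rightarrow>\<^sub>C 'a. apply_bcontfun x = f"
proof -
  have "f \<in> bcontfun" using assms by (intro bcontfun_normI[of f B]) auto
  then show ?thesis by (metis Bcontfun_inverse)
qed

lemma seq_class_add: "seq_class x + seq_class y = seq_class (x + y)"
  and seq_class_diff: "seq_class x - seq_class y = seq_class (x - y)"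
  and seq_class_mult: "seq_class x * seq_class y = seq_class (x * y)"
  and seq_class_scaleC: "c *\<^sub>C seq_class x = seq_class (c *\<^sub>C x)"
  and seq_class_scaleR: "r *\<^sub>R seq_class x = seq_class (r *\<^sub>R x)"
  and seq_class_adj: "adj (seq_class x) = seq_class (adj x)"
  by (simp_all add: plus_seq_alg.abs_eq minus_seq_alg.abs_eq times_seq_alg.abs_eq
      scaleC_seq_alg.abs_eq scaleR_seq_alg.abs_eq adj_seq_alg.abs_eq)

lemma seq_class_zero: "seq_class 0 = 0"
  by (simp add: zero_seq_alg_def)

lemma seq_class_eq_iff: "seq_class x = seq_class y \<longleftrightarrow> (\<lambda>n. x n - y n) \<longlonglongrightarrow> 0"
  by (simp add: seq_alg.abs_eq_iff null_equiv_def)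

lemma seq_class_eq_0_iff: "seq_class x = 0 \<longleftrightarrow> x \<longlonglongrightarrow> 0"
  using seq_class_eq_iff[of x 0] by (simp add: seq_class_zero)

lemma sum_bcontfun: "apply_bcontfun (\<Sum>i\<in>I. f i) n = (\<Sum>i\<in>I. apply_bcontfun (f i) n)"
  by (induct I rule: infinite_finite_induct) auto

lemma const_seq_adj: "adj (const_seq d) = const_seq (adj d)"
proof -
  have "adj (const_bcontfun d) = (const_bcontfun (adj d) :: nat \<Rightarrow>\<^sub>C 'a)"
    by (rule bcontfun_eqI) simp
  then show ?thesis by (simp add: const_seq_def seq_class_adj)
qed

lemma seq_map_class:
  fixes x y :: "nat \<Rightarrow>\<^sub>C 'a::cstar_algebra"
  assumes f: "bounded_linear f" and y: "\<And>n. y n = f (x n)"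
  shows "seq_map f (seq_class x) = seq_class y"
proof -
  have "(\<lambda>n. f (x n)) = apply_bcontfun y" using y by auto
  then show ?thesis using f by (simp add: seq_map.abs_eq apply_bcontfun_inverse)
qed

text \<open>The relative commutant pulled back to bounded sequences. Lifting takes place at this
  level, above the quotient by null sequences, so that orthogonality holds in every
  component.\<close>

definition central_seqs :: "'a::cstar_algebra set \<Rightarrow> (nat \<Rightarrow>\<^sub>C 'a) set" where
  "central_seqs D = {x :: nat \<Rightarrow>\<^sub>C 'a. \<forall>d\<in>D. (\<lambda>n. x n * d - d * x n) \<longlonglongrightarrow> 0}"

definition null_seqs :: "'a::cstar_algebra set \<Rightarrow> (nat \<Rightarrow>\<^sub>C 'a) set" where
  "null_seqs D = {x :: nat \<Rightarrow>\<^sub>C 'a. \<forall>d\<in>D. (\<lambda>n. x n * d) \<longlonglongrightarrow> 0 \<and> (\<lambda>n. d * x n) \<longlonglongrightarrow> 0}"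

lemma central_seqs_iff: "x \<in> central_seqs D \<longleftrightarrow> seq_class x \<in> rel_commutant (const_seq ` D)"
  by (auto simp: central_seqs_def rel_commutant_def const_seq_def seq_class_mult seq_class_eq_iff)

lemma null_seqs_iff: "x \<in> null_seqs D \<longleftrightarrow> seq_class x \<in> annihilator (const_seq ` D)"
  by (auto simp: null_seqs_def annihilator_def const_seq_def seq_class_mult seq_class_eq_0_iff)

lemma closed_rel_commutant: "closed (rel_commutant D)"
proof -
  have "rel_commutant D = (\<Inter>d\<in>D. {x. x * d = d * x})" by (auto simp: rel_commutant_def)
  then show ?thesis by (auto intro!: closed_Collect_eq continuous_intros)
qed

lemma closed_annihilator: "closed (annihilator D)"
proof -
  have "annihilator D = (\<Inter>d\<in>D. {x. x * d = 0} \<inter> {x. d * x = 0})" by (auto simp: annihilator_def)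
  then show ?thesis by (auto intro!: closed_INT closed_Int closed_Collect_eq continuous_intros)
qed

lemma closed_ideal_rel_commutant:
  assumes adj: "adj ` D \<subseteq> D"
  shows "closed_ideal (rel_commutant D) (annihilator D)"
proof -
  have aD: "adj d \<in> D" if "d \<in> D" for d using adj that by blast
  have rc_adj: "adj x \<in> rel_commutant D" if "x \<in> rel_commutant D" for x
    unfolding rel_commutant_def
  proof (intro CollectI ballI)
    fix d assume "d \<in> D"
    then have "adj d * x = x * adj d" using that aD by (simp add: rel_commutant_def)
    then have "adj (adj d * x) = adj (x * adj d)" by simp
    then show "adj x * d = d * adj x" by (simp add: adj_mult adj_adj)
  qed
  have "cstar_subalgebra (rel_commutant D)"
    unfolding cstar_subalgebra_def using closed_rel_commutant rc_adj
    by (auto simp: rel_commutant_def algebra_simps mult_scaleC_left mult_scaleC_right)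
       (metis mult.assoc)
  moreover have "adj x \<in> annihilator D" if "x \<in> annihilator D" for x
    unfolding annihilator_def
  proof (intro CollectI ballI)
    fix d assume "d \<in> D"
    then have "x * adj d = 0" "adj d * x = 0" using that aD by (auto simp: annihilator_def)
    then have "adj (x * adj d) = 0" "adj (adj d * x) = 0" by (simp_all add: adj_zero)
    then show "adj x * d = 0 \<and> d * adj x = 0" by (simp add: adj_mult adj_adj)
  qed
  moreover have "x * c \<in> annihilator D \<and> c * x \<in> annihilator D"
    if "x \<in> annihilator D" "c \<in> rel_commutant D" for x c
    unfolding annihilator_def
  proof (intro CollectI conjI ballI)
    fix d assume "d \<in> D"
    then have d: "x * d = 0" "d * x = 0" "c * d = d * c"
      using that by (auto simp: annihilator_def rel_commutant_def)
    show "x * c * d = 0" by (simp add: mult.assoc d(3)) (simp add: d flip: mult.assoc)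
    show "d * (x * c) = 0" by (simp add: d flip: mult.assoc)
    show "c * x * d = 0" by (simp add: mult.assoc d)
    have "d * (c * x) = c * (d * x)" by (simp only: d(3) mult.assoc[symmetric])
    then show "d * (c * x) = 0" by (simp add: d)
  qed
  ultimately show ?thesis
    unfolding closed_ideal_def using closed_annihilator
    by (auto simp: annihilator_def rel_commutant_def algebra_simps)
qed

lemma closed_ideal_seqs:
  assumes "adj ` D \<subseteq> D"
  shows "closed_ideal (central_seqs D) (null_seqs D)"
proof -
  have "adj ` const_seq ` D \<subseteq> const_seq ` D" using assms by (auto simp: const_seq_adj)
  then interpret I: closed_ideal "rel_commutant (const_seq ` D)" "annihilator (const_seq ` D)"
    by (rule closed_ideal_rel_commutant)
  have cont: "continuous_on UNIV (seq_class :: (nat \<Rightarrow>\<^sub>C 'a) \<Rightarrow> _)"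
    using bounded_linear_seq_class by (rule bounded_linear.continuous_on) simp
  have vim: "central_seqs D = seq_class -` rel_commutant (const_seq ` D)"
    "null_seqs D = seq_class -` annihilator (const_seq ` D)"
    using central_seqs_iff null_seqs_iff by blast+
  have cl: "closed (central_seqs D)" "closed (null_seqs D)"
    unfolding vim using cont closed_rel_commutant I.J_closed by (metis closed_vimage)+
  show ?thesis
    unfolding closed_ideal_def cstar_subalgebra_def
    using I.C I.J_subset cl
    by (auto simp: central_seqs_iff null_seqs_iff I.J_0 seq_class_zero I.J_add I.J_scaleR I.J_adj
        I.J_mult_right I.J_mult_left cstar_subalgebra_def
        simp flip: seq_class_add seq_class_mult seq_class_scaleC seq_class_scaleR seq_class_adj)
qed

definition F_class :: "'a::cstar_algebra set \<Rightarrow> (nat \<Rightarrow>\<^sub>C 'a) \<Rightarrow> 'a seq_alg set" where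
  "F_class D x = ann_coset (const_seq ` D) (seq_class x)"

abbreviation central_alg :: "'a::cstar_algebra set \<Rightarrow> 'a seq_alg set star_ring" where
  "central_alg D \<equiv> F_alg (const_seq ` D)"

lemma F_class_eq_iff: "F_class D x = F_class D y \<longleftrightarrow> x - y \<in> null_seqs D"
  by (simp add: F_class_def ann_coset_eq_iff null_seqs_iff seq_class_diff)

lemma F_class_exhaust:
  assumes "X \<in> carrier (central_alg D)"
  obtains x where "x \<in> central_seqs D" "X = F_class D x"
proof -
  obtain y where "y \<in> rel_commutant (const_seq ` D)" "X = ann_coset (const_seq ` D) y"
    using assms by (auto simp: F_alg_def)
  moreover obtain x where "y = seq_class x" by (rule seq_class_exhaust)
  ultimately show thesis using that by (simp add: central_seqs_iff F_class_def)
qed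

lemma F_class_carrier: "x \<in> central_seqs D \<Longrightarrow> F_class D x \<in> carrier (central_alg D)"
  by (auto simp: F_alg_def F_class_def central_seqs_iff)

lemma F_class_add: "F_class D x \<oplus>\<^bsub>central_alg D\<^esub> F_class D y = F_class D (x + y)"
  by (simp add: F_class_def F_alg_add seq_class_add)

lemma F_class_zero: "\<zero>\<^bsub>central_alg D\<^esub> = F_class D 0"
  by (simp add: F_class_def F_alg_def ann_coset_def seq_class_zero)

lemma F_class_scale: "cscale (central_alg D) c (F_class D x) = F_class D (c *\<^sub>C x)"
  by (simp add: F_class_def F_alg_scale seq_class_scaleC)

lemma F_class_star: "adj ` D \<subseteq> D \<Longrightarrow> star_op (central_alg D) (F_class D x) = F_class D (adj x)"
  unfolding F_class_def by (subst F_alg_star) (auto simp: const_seq_adj seq_class_adj)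

lemma F_class_mult:
  "x \<in> central_seqs D \<Longrightarrow> y \<in> central_seqs D \<Longrightarrow> F_class D x \<otimes>\<^bsub>central_alg D\<^esub> F_class D y = F_class D (x * y)"
  by (simp add: F_class_def F_alg_mult central_seqs_iff seq_class_mult)

lemma F_class_finsum:
  assumes "finite I" "\<And>i. i \<in> I \<Longrightarrow> x i \<in> central_seqs D"
  shows "(\<Oplus>\<^bsub>central_alg D\<^esub>i\<in>I. F_class D (x i)) = F_class D (\<Sum>i\<in>I. x i)"
proof -
  interpret abelian_group "central_alg D" by (rule abelian_group_F_alg)
  show ?thesis using assms
  proof (induct I rule: finite_induct)
    case (insert i I)
    then show ?case by (simp add: F_class_carrier F_class_add Pi_def)
  qed (simp add: F_class_zero)
qed

lemma F_class_rnorm_le: "rnorm (central_alg D) (F_class D x) \<le> norm x"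
proof -
  have "seq_class x \<in> F_class D x" by (simp add: F_class_def in_ann_coset_iff ann_zero)
  then have "rnorm (central_alg D) (F_class D x) \<le> norm (seq_class x)"
    unfolding F_alg_def by (auto intro!: cInf_lower bdd_belowI[of _ 0])
  also have "\<dots> \<le> norm x" unfolding norm_seq_alg_def by (rule seq_norm_class_le)
  finally show ?thesis .
qed

lemma F_class_rnorm_less:
  assumes "rnorm (central_alg D) (F_class D x) < r"
  obtains y where "y - x \<in> null_seqs D" "norm y < r"
proof -
  have "seq_class x \<in> F_class D x" by (simp add: F_class_def in_ann_coset_iff ann_zero)
  then have "norm ` F_class D x \<noteq> {}" by blast
  then obtain Y where Y: "Y \<in> F_class D x" "norm Y < r"
    using assms cInf_lessD[of "norm ` F_class D x" r] by (auto simp: F_alg_def)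
  obtain y where "Y = seq_class y" "norm y < r" using seq_class_lift[OF Y(2)] by blast
  with Y(1) that show thesis
    by (simp add: F_class_def in_ann_coset_iff null_seqs_iff seq_class_diff)
qed


section \<open>Functions on a finite set\<close>

lemma fun_alg_finsum:
  assumes "finite I" "\<And>i. i \<in> I \<Longrightarrow> f i \<in> carrier (fun_alg L)"
  shows "(\<Oplus>\<^bsub>fun_alg L\<^esub>i\<in>I. f i) = (\<lambda>x. \<Sum>i\<in>I. f i x)"
proof -
  interpret abelian_group "fun_alg L" by (rule abelian_group_fun_alg)
  have "zero (fun_alg L) = (\<lambda>x. 0)" "f \<oplus>\<^bsub>fun_alg L\<^esub> g = (\<lambda>x. f x + g x)" for f g
    by (simp_all add: fun_alg_def)
  note ops = this
  show ?thesis using assms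
    by (induct I rule: finite_induct) (simp_all add: ops Pi_def)
qed

lemma fun_alg_rnorm_ge:
  assumes "finite L" "x \<in> L"
  shows "cmod (f x) \<le> rnorm (fun_alg L) f"
  unfolding fun_alg_def using assms by (auto intro!: cSUP_upper bdd_above_finite)


section \<open>Approximate units\<close>

lemma norm_one_minus_square_le:
  fixes s x :: "'a::cstar_algebra"
  assumes s: "adj s = s" "norm s \<le> 1"
  shows "norm (x - s * s * x) \<le> norm x"
proof -
  have "norm (pact [:1, 0, -1:] s x) \<le> 1 * norm x"
  proof (rule norm_pact_le[OF s(1)])
    \<comment> \<open>The estimate needs a radius strictly above \<open>norm s\<close>, and
      \<open>1 - t * t\<close> stays between -1 and 1 up to \<open>sqrt 2\<close>.\<close>
    show "norm s < sqrt 2" using s(2) by (rule order_le_less_trans) simp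
    fix t :: real assume "\<bar>t\<bar> \<le> sqrt 2"
    then have "t * t \<le> 2" by (metis abs_le_square_iff abs_of_nonneg power2_eq_square real_sqrt_ge_zero real_sqrt_pow2 zero_le_numeral)
    moreover have "0 \<le> t * t" by simp
    ultimately show "\<bar>poly [:1, 0, -1:] t\<bar> \<le> 1" by (simp add: abs_le_iff)
  qed
  then show ?thesis by (simp add: algebra_simps)
qed

text \<open>With \<open>v = f(b)\<close> for \<open>b = a * adj a\<close>, the squared norm of
  \<open>a - v * a\<close> is that of \<open>(1 - v) b (1 - v)\<close>. The function
  \<open>f\<close> equals 1 as soon as \<open>t\<close> exceeds \<open>\<delta>^2\<close>.\<close>

lemma exists_left_unit_single:
  fixes a :: "'a::cstar_algebra"
  assumes \<delta>: "\<delta> > 0"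
  shows "\<exists>v. norm (a - v * a) \<le> \<delta> \<and> (\<forall>x. norm (x - v * x) \<le> norm x)"
proof -
  define b where "b = a * adj a"
  have "b = adj (adj a) * adj a" by (simp add: b_def adj_adj)
  then have bp: "positive_elem b" unfolding positive_elem_def by blast
  have b: "adj b = b" using bp by (rule positive_elem_selfadj)
  define f where "f t = min (1 / \<delta>\<^sup>2 * pos_part t) 1" for t
  have f: "fc_fun f" "\<And>t. f t \<ge> 0" "\<And>t. f t \<le> 1"
    unfolding f_def by (intro fc_intros) simp_all
  define v where "v = fc f b"
  have v: "adj v = v" unfolding v_def by (rule fc_selfadj[OF b f(1)])
  have bb: "b = fc pos_part b" using positive_elem_fc_pos_part[OF bp] by simp
  have "(a - v * a) * adj (a - v * a) = b - v * b - (b * v - v * b * v)"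
    by (simp add: b_def adj_minus adj_mult v algebra_simps)
  also have "\<dots> = fc (\<lambda>t. (pos_part t - f t * pos_part t) - (pos_part t * f t - f t * pos_part t * f t)) b"
    unfolding v_def by (simp only: fc_diff[OF b] fc_mult[OF b] fc_intros f(1) bb[symmetric])
  finally have "(norm (adj (a - v * a)))\<^sup>2 =
      norm (fc (\<lambda>t. (pos_part t - f t * pos_part t) - (pos_part t * f t - f t * pos_part t * f t)) b)"
    using cstar_identity[of "adj (a - v * a)"] by (simp add: adj_adj)
  also have "\<dots> \<le> \<delta>\<^sup>2"
  proof (rule norm_fc_le[OF b _ less_add_one])
    show "fc_fun (\<lambda>t. (pos_part t - f t * pos_part t) - (pos_part t * f t - f t * pos_part t * f t))"
      by (intro fc_intros f(1))
    fix t :: real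
    have eq: "(pos_part t - f t * pos_part t) - (pos_part t * f t - f t * pos_part t * f t)
      = pos_part t * (1 - f t)\<^sup>2" by (simp add: power2_eq_square algebra_simps)
    show "\<bar>(pos_part t - f t * pos_part t) - (pos_part t * f t - f t * pos_part t * f t)\<bar> \<le> \<delta>\<^sup>2"
    proof (cases "pos_part t \<le> \<delta>\<^sup>2")
      case True
      have "(1 - f t)\<^sup>2 \<le> 1" using f(2,3)[of t] by (intro power_le_one) auto
      then have "pos_part t * (1 - f t)\<^sup>2 \<le> \<delta>\<^sup>2 * 1" using True by (intro mult_mono) auto
      then show ?thesis unfolding eq by (simp add: abs_mult)
    next
      case False
      then have "f t = 1" using \<delta> by (simp add: f_def min_def field_simps)
      then show ?thesis unfolding eq by simp
    qed
  qed
  finally have "(norm (a - v * a))\<^sup>2 \<le> \<delta>\<^sup>2" by (simp only: norm_adj)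
  then have "norm (a - v * a) \<le> \<delta>" using \<delta> by (rule power2_le_imp_le[OF _ less_imp_le])
  moreover have "norm (x - v * x) \<le> norm x" for x
  proof -
    have "v = fc (\<lambda>t. sqrt (f t)) b * fc (\<lambda>t. sqrt (f t)) b"
      unfolding v_def by (rule fc_nonneg_square[OF b f(1,2)])
    moreover have "norm (fc (\<lambda>t. sqrt (f t)) b) \<le> 1"
      by (rule norm_fc_le[OF b _ less_add_one]) (use f in \<open>auto intro!: fc_intros\<close>)
    moreover have "adj (fc (\<lambda>t. sqrt (f t)) b) = fc (\<lambda>t. sqrt (f t)) b"
      by (rule fc_selfadj[OF b]) (intro fc_intros f(1))
    ultimately show ?thesis using norm_one_minus_square_le by metis
  qed
  ultimately show ?thesis by blast
qed

text \<open>One factor \<open>1 - v\<close> per element: \<open>(1 - v) (1 - u)\<close> is again a contraction.\<close>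

lemma exists_left_unit:
  fixes S :: "'a::cstar_algebra set"
  assumes "finite S" and \<delta>: "\<delta> > 0"
  shows "\<exists>u. (\<forall>a\<in>S. norm (a - u * a) \<le> \<delta>) \<and> (\<forall>x. norm (x - u * x) \<le> norm x)"
  using assms(1)
proof (induct S rule: finite_induct)
  case empty
  show ?case by (rule exI[of _ 0]) simp
next
  case (insert b S)
  then obtain u where u: "\<And>a. a \<in> S \<Longrightarrow> norm (a - u * a) \<le> \<delta>" "\<And>x. norm (x - u * x) \<le> norm x" by blast
  obtain v where v: "norm ((b - u * b) - v * (b - u * b)) \<le> \<delta>" "\<And>x. norm (x - v * x) \<le> norm x"
    using exists_left_unit_single[OF \<delta>] by blast
  define w where "w = u + v - v * u"
  have w: "x - w * x = (x - u * x) - v * (x - u * x)" for x by (simp add: w_def algebra_simps)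
  have "norm (x - w * x) \<le> norm (x - u * x)" for x unfolding w by (rule v)
  then have "norm (x - w * x) \<le> norm x" "a \<in> S \<Longrightarrow> norm (a - w * a) \<le> \<delta>" for x a
    using u by (meson order_trans)+
  moreover have "norm (b - w * b) \<le> \<delta>" using v(1) by (simp only: w)
  ultimately show ?case by blast
qed

text \<open>In the unitization \<open>1 - e = (1 - adj u) (1 - u)\<close>, which works on both sides
  once \<open>u\<close> works from the left for \<open>S\<close> and its adjoints. The bound 8 is
  \<open>2 + 2 + 2 * 2\<close>.\<close>

lemma exists_two_sided_unit:
  fixes S :: "'a::cstar_algebra set"
  assumes "finite S" and \<delta>: "\<delta> > 0"
  shows "\<exists>e. norm e \<le> 8 \<and> (\<forall>a\<in>S. norm (e * a - a) \<le> \<delta> \<and> norm (a * e - a) \<le> \<delta>)"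
proof -
  obtain u where u: "\<And>a. a \<in> S \<union> adj ` S \<Longrightarrow> norm (a - u * a) \<le> \<delta> / 3"
    "\<And>x. norm (x - u * x) \<le> norm x"
    using exists_left_unit[of "S \<union> adj ` S" "\<delta> / 3"] assms by auto
  have un: "norm u \<le> 2"
  proof (rule norm_le_if_norm_mult_le)
    show "norm (u * x) \<le> 2 * norm x" for x
      using norm_triangle_ineq4[of x "x - u * x"] u(2)[of x] by simp
  qed simp
  define e where "e = adj u + u - adj u * u"
  have uu: "norm (adj u * u) \<le> 2 * 2"
    using un by (intro order_trans[OF norm_mult_ineq] mult_mono) (auto simp: norm_adj)
  have "norm e \<le> norm (adj u) + norm u + norm (adj u * u)"
    unfolding e_def using norm_triangle_ineq4[of "adj u + u" "adj u * u"] norm_triangle_ineq[of "adj u" u]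
    by linarith
  then have "norm e \<le> 8" using un uu by (simp add: norm_adj)
  moreover have "norm (e * a - a) \<le> \<delta> \<and> norm (a * e - a) \<le> \<delta>" if a: "a \<in> S" for a
  proof -
    define y where "y = a - u * a"
    define z where "z = a - a * adj u"
    have y: "norm y \<le> \<delta> / 3" unfolding y_def using u(1) a by blast
    have "z = adj (adj a - u * adj a)" by (simp add: z_def adj_minus adj_mult adj_adj)
    then have z: "norm z \<le> \<delta> / 3" using u(1)[of "adj a"] a by (simp add: norm_adj)
    have "norm (adj u * y) \<le> 2 * (\<delta> / 3)"
      using un y by (intro order_trans[OF norm_mult_ineq] mult_mono) (auto simp: norm_adj)
    moreover have "norm (z * u) \<le> (\<delta> / 3) * 2"
      using un z \<delta> by (intro order_trans[OF norm_mult_ineq] mult_mono) auto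
    moreover have "e * a - a = adj u * y - y" "a * e - a = z * u - z"
      by (simp_all add: e_def y_def z_def algebra_simps)
    ultimately show ?thesis
      using y z norm_triangle_ineq4[of "adj u * y" y] norm_triangle_ineq4[of "z * u" z] by simp
  qed
  ultimately show ?thesis by blast
qed

section \<open>Limits tested on a dense set\<close>

lemma tendsto_zero_dense:
  fixes T :: "nat \<Rightarrow> 'a::real_normed_vector \<Rightarrow> 'b::real_normed_vector"
  assumes diff: "\<And>n x y. T n (x - y) = T n x - T n y" and bd: "\<And>n x. norm (T n x) \<le> B * norm x"
    and U: "\<And>c. c \<in> U \<Longrightarrow> (\<lambda>n. T n c) \<longlonglongrightarrow> 0" and d: "d \<in> closure U"
  shows "(\<lambda>n. T n d) \<longlonglongrightarrow> 0"
proof (rule tendstoI)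
  fix e :: real assume e: "e > 0"
  define B' where "B' = max B 0 + 1"
  have B': "B' > 0" "B \<le> B'" by (auto simp: B'_def)
  obtain c where c: "c \<in> U" "dist c d < e / (2 * B')"
    using d closure_approachable[of d U] e B' by (metis divide_pos_pos mult_pos_pos zero_less_numeral)
  have "\<forall>\<^sub>F n in sequentially. dist (T n c) 0 < e / 2" using tendstoD[OF U[OF c(1)], of "e / 2"] e by simp
  then show "\<forall>\<^sub>F n in sequentially. dist (T n d) 0 < e"
  proof eventually_elim
    case (elim n)
    have "norm (T n (d - c)) \<le> B' * norm (d - c)"
      using bd[of n "d - c"] mult_right_mono[OF B'(2), of "norm (d - c)"] by simp
    also have "\<dots> < B' * (e / (2 * B'))"
      using c(2) B'(1) by (intro mult_strict_left_mono) (auto simp: dist_norm norm_minus_commute)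
    finally have "norm (T n (d - c)) < e / 2" using B' by simp
    then show ?case using elim norm_triangle_ineq[of "T n (d - c)" "T n c"] by (simp add: diff)
  qed
qed

lemma separable_dense_sequence:
  fixes D :: "'a::metric_space set"
  assumes "separable_space (top_of_set D)" "D \<noteq> {}"
  obtains c :: "nat \<Rightarrow> 'a" where "range c \<subseteq> D" "D \<subseteq> closure (range c)"
proof -
  obtain U where U: "countable U" "U \<subseteq> D" "top_of_set D closure_of U = D"
    using assms(1) by (auto simp: separable_space_def)
  then have "D \<subseteq> closure U"
    using closure_mono[of "D \<inter> U" U] by (auto simp: closure_of_subtopology)
  moreover from this have "U \<noteq> {}" using assms(2) by auto
  ultimately show thesis
    using that[of "from_nat_into U"] U by (simp add: range_from_nat_into)
qed

lemma commutator_tendsto_dense: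
  fixes x :: "nat \<Rightarrow> 'a::cstar_algebra"
  assumes "\<And>n. norm (x n) \<le> B" "\<And>c. c \<in> U \<Longrightarrow> (\<lambda>n. x n * c - c * x n) \<longlonglongrightarrow> 0" "d \<in> closure U"
  shows "(\<lambda>n. x n * d - d * x n) \<longlonglongrightarrow> 0"
proof (rule tendsto_zero_dense[where T = "\<lambda>n d. x n * d - d * x n" and B = "B + B" and U = U])
  fix n d
  have "norm (x n * d) \<le> B * norm d" "norm (d * x n) \<le> norm d * B"
    using assms(1)[of n] order_trans[OF norm_ge_zero assms(1)[of n]]
    by (auto intro!: order_trans[OF norm_mult_ineq] mult_mono)
  then show "norm (x n * d - d * x n) \<le> (B + B) * norm d"
    using norm_triangle_ineq4[of "x n * d" "d * x n"] by (simp add: algebra_simps)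
qed (use assms in \<open>auto simp: algebra_simps\<close>)

lemma mult_tendsto_dense:
  fixes x :: "nat \<Rightarrow> 'a::cstar_algebra"
  assumes "\<And>n. norm (x n) \<le> B" "\<And>c. c \<in> U \<Longrightarrow> (\<lambda>n. x n * c) \<longlonglongrightarrow> 0" "d \<in> closure U"
  shows "(\<lambda>n. x n * d) \<longlonglongrightarrow> 0"
proof (rule tendsto_zero_dense[where T = "\<lambda>n d. x n * d" and B = B and U = U])
  show "norm (x n * d) \<le> B * norm d" for n d
    using assms(1)[of n] order_trans[OF norm_ge_zero assms(1)[of n]]
    by (auto intro!: order_trans[OF norm_mult_ineq] mult_mono)
qed (use assms in \<open>auto simp: algebra_simps\<close>)

lemma unit_tendsto_dense:
  fixes x :: "nat \<Rightarrow> 'a::cstar_algebra"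
  assumes "\<And>n. norm (x n) \<le> B" "\<And>c. c \<in> U \<Longrightarrow> (\<lambda>n. x n * c - c) \<longlonglongrightarrow> 0" "d \<in> closure U"
  shows "(\<lambda>n. x n * d - d) \<longlonglongrightarrow> 0"
proof (rule tendsto_zero_dense[where T = "\<lambda>n d. x n * d - d" and B = "B + 1" and U = U])
  fix n d
  have "norm (x n * d) \<le> B * norm d"
    using assms(1)[of n] order_trans[OF norm_ge_zero assms(1)[of n]]
    by (auto intro!: order_trans[OF norm_mult_ineq] mult_mono)
  then show "norm (x n * d - d) \<le> (B + 1) * norm d"
    using norm_triangle_ineq4[of "x n * d" d] by (simp add: algebra_simps)
qed (use assms in \<open>auto simp: algebra_simps\<close>)

lemma F_one:
  fixes x :: "nat \<Rightarrow>\<^sub>C 'a::cstar_algebra"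
  assumes x: "x \<in> central_seqs D" and d: "\<And>d. d \<in> D \<Longrightarrow> (\<lambda>n. x n * d - d) \<longlonglongrightarrow> 0"
  shows "\<one>\<^bsub>central_alg D\<^esub> = F_class D x"
  unfolding F_class_def
proof (rule F_alg_one)
  show "seq_class x \<in> rel_commutant (const_seq ` D)" using x by (simp add: central_seqs_iff)
  show "seq_class x * c = c" if "c \<in> const_seq ` D" for c
    using that d by (auto simp: const_seq_def seq_class_mult seq_class_eq_iff)
qed

text \<open>Approximate units for growing pieces of a dense sequence in \<open>D\<close>. They give
  a concrete representative of the unit, which is defined only by a description.\<close>

lemma exists_F_unit:
  fixes D :: "'a::cstar_algebra set"
  assumes D: "separable_space (top_of_set D)" "D \<noteq> {}"
  obtains x :: "nat \<Rightarrow>\<^sub>C 'a" where "x \<in> central_seqs D" "\<And>d. d \<in> D \<Longrightarrow> (\<lambda>n. x n * d - d) \<longlonglongrightarrow> 0"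
proof -
  obtain c :: "nat \<Rightarrow> 'a" where c: "range c \<subseteq> D" "D \<subseteq> closure (range c)"
    by (rule separable_dense_sequence[OF D])
  have "\<forall>n. \<exists>e. norm e \<le> 8 \<and> (\<forall>a\<in>c ` {..n}. norm (e * a - a) \<le> inverse (Suc n) \<and> norm (a * e - a) \<le> inverse (Suc n))"
    by (rule allI, rule exists_two_sided_unit) simp_all
  from choice[OF this] obtain e where
    "\<forall>n. norm (e n) \<le> 8 \<and> (\<forall>a\<in>c ` {..n}. norm (e n * a - a) \<le> inverse (Suc n) \<and> norm (a * e n - a) \<le> inverse (Suc n))" ..
  then have e: "\<And>n. norm (e n) \<le> 8"
    "\<And>n k. k \<le> n \<Longrightarrow> norm (e n * c k - c k) \<le> inverse (Suc n) \<and> norm (c k * e n - c k) \<le> inverse (Suc n)"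
    by auto
  obtain x where x: "apply_bcontfun x = e" using exists_bcontfun_seq[of e, OF e(1)] by blast
  have lim0: "(\<lambda>n. f n) \<longlonglongrightarrow> 0" if "\<And>n. k \<le> n \<Longrightarrow> norm (f n) \<le> inverse (real (Suc n))"
    for f :: "nat \<Rightarrow> 'a" and k
    by (rule Lim_null_comparison[OF _ LIMSEQ_inverse_real_of_nat])
       (use that in \<open>auto simp: eventually_sequentially\<close>)
  have l: "(\<lambda>n. e n * c k - c k) \<longlonglongrightarrow> 0" and r: "(\<lambda>n. c k * e n - c k) \<longlonglongrightarrow> 0" for k
    using e(2) by (auto intro!: lim0[where k = k])
  have lr: "(\<lambda>n. e n * c k - c k * e n) \<longlonglongrightarrow> 0" for k
    using tendsto_diff[OF l[of k] r[of k]] by simp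
  have "(\<lambda>n. e n * d - d * e n) \<longlonglongrightarrow> 0" if "d \<in> D" for d
    by (rule commutator_tendsto_dense[OF e(1) _ subsetD[OF c(2) that]]) (use lr in blast)
  then have "x \<in> central_seqs D" by (simp add: central_seqs_def x)
  moreover have "(\<lambda>n. e n * d - d) \<longlonglongrightarrow> 0" if "d \<in> D" for d
    by (rule unit_tendsto_dense[OF e(1) _ subsetD[OF c(2) that]]) (use l in blast)
  ultimately show thesis using that[of x] by (simp add: x)
qed


section \<open>Rokhlin towers\<close>

text \<open>
  The functions \<open>e l X n\<close> are componentwise representatives, exactly orthogonal in \<open>A\<close>, of the
  images of the indicator functions of the points \<open>X\<close> of \<open>G/H\<close> under the order zero maps.
\<close>

definition rokhlin_towers ::
    "('g, 'm) monoid_scheme \<Rightarrow> ('g \<Rightarrow> 'a::cstar_algebra \<Rightarrow> 'a) \<Rightarrow> 'a set \<Rightarrow> 'g set \<Rightarrow> nat \<Rightarrow>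
     (nat \<Rightarrow> 'g set \<Rightarrow> nat \<Rightarrow> 'a) \<Rightarrow> bool" where
  "rokhlin_towers G \<alpha> D H d e \<longleftrightarrow>
     (\<forall>l\<le>d. \<forall>X\<in>lcosets\<^bsub>G\<^esub> H. \<forall>n. positive_contraction (e l X n)) \<and>
     (\<forall>l\<le>d. \<forall>X\<in>lcosets\<^bsub>G\<^esub> H. \<forall>Y\<in>lcosets\<^bsub>G\<^esub> H. X \<noteq> Y \<longrightarrow> (\<forall>n. e l X n * e l Y n = 0)) \<and>
     (\<forall>l\<le>d. \<forall>X\<in>lcosets\<^bsub>G\<^esub> H. \<forall>a\<in>D. (\<lambda>n. e l X n * a - a * e l X n) \<longlonglongrightarrow> 0) \<and>
     (\<forall>l\<le>d. \<forall>X\<in>lcosets\<^bsub>G\<^esub> H. \<forall>g\<in>carrier G. \<forall>a\<in>D.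
        (\<lambda>n. (\<alpha> g (e l X n) - e l (g <#\<^bsub>G\<^esub> X) n) * a) \<longlonglongrightarrow> 0) \<and>
     (\<forall>a\<in>D. (\<lambda>n. (\<Sum>l\<le>d. \<Sum>X\<in>lcosets\<^bsub>G\<^esub> H. e l X n) * a - a) \<longlonglongrightarrow> 0)"

lemma rokhlin_towersD:
  assumes "rokhlin_towers G \<alpha> D H d e"
  shows "l \<le> d \<Longrightarrow> X \<in> lcosets\<^bsub>G\<^esub> H \<Longrightarrow> positive_contraction (e l X n)"
    and "l \<le> d \<Longrightarrow> X \<in> lcosets\<^bsub>G\<^esub> H \<Longrightarrow> Y \<in> lcosets\<^bsub>G\<^esub> H \<Longrightarrow> X \<noteq> Y \<Longrightarrow> e l X n * e l Y n = 0"
    and "l \<le> d \<Longrightarrow> X \<in> lcosets\<^bsub>G\<^esub> H \<Longrightarrow> a \<in> D \<Longrightarrow> (\<lambda>n. e l X n * a - a * e l X n) \<longlonglongrightarrow> 0"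
    and "l \<le> d \<Longrightarrow> X \<in> lcosets\<^bsub>G\<^esub> H \<Longrightarrow> g \<in> carrier G \<Longrightarrow> a \<in> D \<Longrightarrow>
      (\<lambda>n. (\<alpha> g (e l X n) - e l (g <#\<^bsub>G\<^esub> X) n) * a) \<longlonglongrightarrow> 0"
    and "a \<in> D \<Longrightarrow> (\<lambda>n. (\<Sum>l\<le>d. \<Sum>X\<in>lcosets\<^bsub>G\<^esub> H. e l X n) * a - a) \<longlonglongrightarrow> 0"
  using assms unfolding rokhlin_towers_def by simp_all

section \<open>Automorphisms and their action on an admissible subalgebra\<close>

lemma star_automorphism_bounded_linear:
  assumes "star_automorphism f"
  shows "bounded_linear f" "norm (f x) \<le> norm x"
proof -
  have f: "f (x + y) = f x + f y" "f (c *\<^sub>C x) = c *\<^sub>C f x" "f (x * y) = f x * f y"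
    "f (adj x) = adj (f x)" for x y c
    using assms by (auto simp: star_automorphism_def clinear_map_def)
  show n: "norm (f x) \<le> norm x" for x by (rule star_hom_contractive[OF f])
  show "bounded_linear f"
    by (rule bounded_linear_intro[where K = 1]) (simp_all add: f n scaleR_scaleC)
qed

lemma Ad_surj_on:
  assumes u: "u \<in> unitary_multipliers"
  shows "Ad u (mult_right (mult_left (mlt_adj u) x) u) = x"
proof -
  obtain L R where uLR: "u = (L, R)" by (cases u)
  have m: "L (x * y) = L x * y" "R (x * y) = x * R y" "R x * y = x * L y" for x y
    using u by (auto simp: uLR unitary_multipliers_def multipliers_def)
  have "mlt_times u (mlt_adj u) = mlt_one" using u by (simp add: unitary_multipliers_def)
  then have LL: "L (mult_left (mlt_adj u) x) = x" and RR: "mult_right (R x) (mlt_adj u) = x" for x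
    by (auto simp: mlt_times_def mlt_one_def uLR fun_eq_iff)
  \<comment> \<open>The two sides agree after multiplication by any \<open>y\<close> from the left;
    taking for \<open>y\<close> the adjoint of their difference shows that it vanishes.\<close>
  have LR: "L (R z) = R (L z)" for z
  proof -
    have "y * (L (R z) - R (L z)) = 0" for y
      by (simp add: right_diff_distrib flip: m(2) m(3))
    then have "norm (adj (L (R z) - R (L z)) * (L (R z) - R (L z))) = 0" by simp
    then show ?thesis by (simp add: cstar_identity)
  qed
  show ?thesis by (simp add: Ad_def uLR[symmetric]) (simp add: uLR LR LL[unfolded uLR] RR[unfolded uLR])
qed

text \<open>The composite of \<open>\<alpha> g\<close> and \<open>\<alpha> (inv g)\<close> is
  \<open>Ad\<close> of a cocycle value after \<open>\<alpha> \<one>\<close>, and \<open>Ad\<close>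
  is inverted within \<open>D\<close>. Invariance of \<open>D\<close> alone would not let
  \<open>\<alpha> g\<close> preserve the annihilator of \<open>D\<close>.\<close>

lemma cocycle_action_surj_on:
  fixes G (structure)
  assumes G: "group G" and c: "cocycle_action G \<alpha> w" and D: "admissible_subalgebra G \<alpha> w D"
    and g: "g \<in> carrier G" and d: "d \<in> D"
  shows "\<exists>d'\<in>D. \<alpha> g d' = d"
proof -
  interpret group G by fact
  have w: "w r s \<in> unitary_multipliers" if "r \<in> carrier G" "s \<in> carrier G" for r s
    using c that by (simp add: cocycle_action_def)
  have Dw: "mult_right (mult_left (mlt_adj (w r s)) x) (w r s) \<in> D"
    if "r \<in> carrier G" "s \<in> carrier G" "x \<in> D" for r s x
  proof -
    have "adj y \<in> D" if "y \<in> D" for y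
      using D that by (auto simp: admissible_subalgebra_def cstar_subalgebra_def)
    then show ?thesis using D that by (auto simp: admissible_subalgebra_def mlt_adj_def)
  qed
  have comp: "\<alpha> r (\<alpha> s x) = Ad (w r s) (\<alpha> (r \<otimes> s) x)" if "r \<in> carrier G" "s \<in> carrier G" for r s x
  proof -
    have "\<alpha> r \<circ> \<alpha> s = Ad (w r s) \<circ> \<alpha> (r \<otimes> s)" using c that by (simp add: cocycle_action_def)
    then show ?thesis by (simp add: fun_eq_iff)
  qed
  \<comment> \<open>The cocycle is not normalised; cancelling the surjection
    \<open>\<alpha> \<one>\<close> in \<open>\<alpha> \<one> \<circ> \<alpha> \<one>\<close>
    identifies \<open>\<alpha> \<one>\<close>.\<close>
  have one: "\<alpha> \<one> x = Ad (w \<one> \<one>) x" for x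
  proof -
    have "surj (\<alpha> \<one>)" using c by (simp add: cocycle_action_def star_automorphism_def bij_is_surj)
    then obtain y where "x = \<alpha> \<one> y" by auto
    then show ?thesis using comp[of \<one> \<one> y] by simp
  qed
  define y where "y = mult_right (mult_left (mlt_adj (w g (inv g))) d) (w g (inv g))"
  define z where "z = mult_right (mult_left (mlt_adj (w \<one> \<one>)) y) (w \<one> \<one>)"
  have "z \<in> D" unfolding z_def y_def using g d by (intro Dw) auto
  then have "\<alpha> (inv g) z \<in> D" using D g by (auto simp: admissible_subalgebra_def)
  moreover have "\<alpha> g (\<alpha> (inv g) z) = Ad (w g (inv g)) (Ad (w \<one> \<one>) z)"
    using comp[of g "inv g" z] g by (simp add: one)
  then have "\<alpha> g (\<alpha> (inv g) z) = d"
    unfolding z_def y_def using w g by (simp add: Ad_surj_on)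
  ultimately show ?thesis by blast
qed

lemma lcoset_action:
  assumes "group G" "subgroup H G" "g \<in> carrier G" "X \<in> lcosets\<^bsub>G\<^esub> H"
  shows "g <#\<^bsub>G\<^esub> X \<in> lcosets\<^bsub>G\<^esub> H" "inv\<^bsub>G\<^esub> g <#\<^bsub>G\<^esub> (g <#\<^bsub>G\<^esub> X) = X" "g <#\<^bsub>G\<^esub> (inv\<^bsub>G\<^esub> g <#\<^bsub>G\<^esub> X) = X"
proof -
  interpret group G by fact
  have X: "X \<subseteq> carrier G" using lcosets_subset_carrier[OF assms(2,4)] .
  obtain x where x: "x \<in> carrier G" "X = x <#\<^bsub>G\<^esub> H" using assms(4) by (auto simp: LCOSETS_def)
  have "g <#\<^bsub>G\<^esub> X = (g \<otimes>\<^bsub>G\<^esub> x) <#\<^bsub>G\<^esub> H"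
    using lcos_m_assoc[OF subgroup.subset[OF assms(2)] assms(3) x(1)] x(2) by simp
  then show "g <#\<^bsub>G\<^esub> X \<in> lcosets\<^bsub>G\<^esub> H" using x assms(3) by (simp add: lcosets_memI)
  show "inv\<^bsub>G\<^esub> g <#\<^bsub>G\<^esub> (g <#\<^bsub>G\<^esub> X) = X" "g <#\<^bsub>G\<^esub> (inv\<^bsub>G\<^esub> g <#\<^bsub>G\<^esub> X) = X"
    using assms(3) X by (simp_all add: lcos_m_assoc lcos_mult_one)
qed

abbreviation ind :: "'x set \<Rightarrow> 'x \<Rightarrow> complex" where
  "ind S \<equiv> (\<lambda>x. if x \<in> S then 1 else 0)"

lemma ind_carrier: "S \<subseteq> L \<Longrightarrow> ind S \<in> carrier (fun_alg L)"
  by (auto simp: fun_alg_def)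

lemma cpc_order_zero_additive:
  assumes \<phi>: "cpc_order_zero (fun_alg L) (central_alg D) \<phi>"
    and e: "\<And>X. X \<in> L \<Longrightarrow> e X \<in> central_seqs D" "\<And>X. X \<in> L \<Longrightarrow> \<phi> (ind {X}) = F_class D (e X)"
    and S: "finite S" "S \<subseteq> L"
  shows "\<phi> (ind S) = F_class D (\<Sum>X\<in>S. e X)"
proof -
  have lin: "linear_between (fun_alg L) (central_alg D) \<phi>"
    using \<phi> by (simp add: cpc_order_zero_def completely_positive_def)
  show ?thesis using S
  proof (induct S rule: finite_induct)
    case empty
    have c0: "ind {} \<in> carrier (fun_alg L)" by (simp add: fun_alg_def)
    then obtain x where x: "x \<in> central_seqs D" "\<phi> (ind {}) = F_class D x"
      using lin unfolding linear_between_def by (metis F_class_exhaust)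
    have "\<phi> (cscale (fun_alg L) 0 (ind {})) = cscale (central_alg D) 0 (\<phi> (ind {}))"
      using lin c0 unfolding linear_between_def by blast
    moreover have "cscale (fun_alg L) 0 (ind {}) = ind {}" by (simp add: fun_alg_def)
    ultimately have "\<phi> (ind {}) = F_class D (0 *\<^sub>C x)" by (simp only: x(2) F_class_scale)
    then show ?case by (simp add: scaleC_zero_left)
  next
    case (insert X S)
    have "ind (insert X S) = ind {X} \<oplus>\<^bsub>fun_alg L\<^esub> ind S"
      using insert.hyps by (auto simp: fun_alg_def fun_eq_iff)
    moreover have "ind {X} \<in> carrier (fun_alg L)" "ind S \<in> carrier (fun_alg L)"
      using insert.prems by (intro ind_carrier; blast)+
    ultimately have "\<phi> (ind (insert X S)) = \<phi> (ind {X}) \<oplus>\<^bsub>central_alg D\<^esub> \<phi> (ind S)"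
      using lin unfolding linear_between_def by metis
    then show ?case using insert e by (simp add: F_class_add)
  qed
qed

text \<open>The hypotheses of the lifting theorem come from the three properties of
  \<open>\<phi>\<close>: positivity on 1 by 1 matrices gives positive representatives, contractivity
  the norm bound in the quotient, and the order zero property orthogonality modulo
  \<open>null_seqs D\<close>.\<close>

lemma cpc_order_zero_lift:
  fixes \<phi> :: "('x \<Rightarrow> complex) \<Rightarrow> 'a::cstar_algebra seq_alg set"
  assumes \<phi>: "cpc_order_zero (fun_alg L) (central_alg D) \<phi>" and L: "finite L" and D: "adj ` D \<subseteq> D"
  obtains e :: "'x \<Rightarrow> nat \<Rightarrow>\<^sub>C 'a" where "\<And>X. X \<in> L \<Longrightarrow> e X \<in> central_seqs D"
    "\<And>X. X \<in> L \<Longrightarrow> positive_contraction (e X)" "\<And>X. X \<in> L \<Longrightarrow> \<phi> (ind {X}) = F_class D (e X)"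
    "\<And>X Y. X \<in> L \<Longrightarrow> Y \<in> L \<Longrightarrow> X \<noteq> Y \<Longrightarrow> e X * e Y = 0"
proof -
  interpret I: closed_ideal "central_seqs D" "null_seqs D" by (rule closed_ideal_seqs[OF D])
  have sq: "star_op (fun_alg L) (ind {X}) \<otimes>\<^bsub>fun_alg L\<^esub> ind {X} = ind {X}" for X
    by (auto simp: fun_alg_def)
  have pos: "\<exists>z. z \<in> central_seqs D \<and> \<phi> (ind {X}) = F_class D (adj z * z)" if X: "X \<in> L" for X
  proof -
    have c: "ind {X} \<in> carrier (fun_alg L)" using X by (intro ind_carrier) simp
    have "mat_positive (fun_alg L) 1 (\<lambda>i j. ind {X})"
      unfolding mat_positive_def
    proof (intro exI[of _ "\<lambda>i j. ind {X}"] conjI allI impI)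
      show "ind {X} = (\<Oplus>\<^bsub>fun_alg L\<^esub>k\<in>{..<1::nat}. star_op (fun_alg L) (ind {X}) \<otimes>\<^bsub>fun_alg L\<^esub> ind {X})"
        unfolding sq using c by (subst fun_alg_finsum) auto
    qed (rule c)
    then have "mat_positive (central_alg D) 1 (\<lambda>i j. \<phi> (ind {X}))"
      using \<phi> unfolding cpc_order_zero_def completely_positive_def by blast
    then obtain Z where Z: "Z 0 0 \<in> carrier (central_alg D)"
      "\<phi> (ind {X}) = (\<Oplus>\<^bsub>central_alg D\<^esub>k\<in>{..<1::nat}. star_op (central_alg D) (Z k 0) \<otimes>\<^bsub>central_alg D\<^esub> Z k 0)"
      unfolding mat_positive_def by auto
    obtain z where z: "z \<in> central_seqs D" "Z 0 0 = F_class D z" using F_class_exhaust[OF Z(1)] .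
    have zz: "star_op (central_alg D) (Z 0 0) \<otimes>\<^bsub>central_alg D\<^esub> Z 0 0 = F_class D (adj z * z)"
      using z I.C_adj by (simp add: F_class_star[OF D] F_class_mult)
    have zC: "adj z * z \<in> central_seqs D" using z I.C_adj I.C_mult by blast
    interpret A: abelian_group "central_alg D" by (rule abelian_group_F_alg)
    have "\<phi> (ind {X}) = (\<Oplus>\<^bsub>central_alg D\<^esub>k\<in>{..<1::nat}. F_class D (adj z * z))"
      unfolding Z(2) by (rule A.finsum_cong') (auto simp: zz F_class_carrier zC)
    also have "\<dots> = F_class D (adj z * z)"
      using F_class_finsum[of "{..<1::nat}" "\<lambda>_. adj z * z" D] zC by simp
    finally have "\<phi> (ind {X}) = F_class D (adj z * z)" .
    with z show ?thesis by blast
  qed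
  then obtain z where z: "\<And>X. X \<in> L \<Longrightarrow> z X \<in> central_seqs D"
    "\<And>X. X \<in> L \<Longrightarrow> \<phi> (ind {X}) = F_class D (adj (z X) * z X)" by metis
  define a where "a X = adj (z X) * z X" for X
  have a: "a X \<in> central_seqs D" "positive_elem (a X)" "\<phi> (ind {X}) = F_class D (a X)" if "X \<in> L" for X
    using z that I.C_adj I.C_mult by (auto simp: a_def positive_elem_def)
  have small: "\<exists>y. y - a X \<in> null_seqs D \<and> norm y < 1 + \<delta>" if X: "X \<in> L" and \<delta>: "\<delta> > 0" for X \<delta>
  proof -
    have "rnorm (central_alg D) (\<phi> (ind {X})) \<le> rnorm (fun_alg L) (ind {X})"
      using \<phi> ind_carrier[of "{X}" L] X unfolding cpc_order_zero_def contractive_def by auto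
    also have "\<dots> \<le> 1" unfolding fun_alg_def using X by (auto intro!: cSUP_least)
    finally have "rnorm (central_alg D) (F_class D (a X)) < 1 + \<delta>" using \<delta> a(3)[OF X] by simp
    then show ?thesis by (rule F_class_rnorm_less) blast
  qed
  have orth: "a X * a Y \<in> null_seqs D" if XY: "X \<in> L" "Y \<in> L" "X \<noteq> Y" for X Y
  proof -
    have rp: "ring_positive (fun_alg L) (ind {X})" if "X \<in> L" for X
      unfolding ring_positive_def using ind_carrier[of "{X}" L] that by (intro bexI[of _ "ind {X}"]) (simp_all only: sq, auto)
    have "ind {X} \<otimes>\<^bsub>fun_alg L\<^esub> ind {Y} = \<zero>\<^bsub>fun_alg L\<^esub>" using XY(3) by (auto simp: fun_alg_def)
    then have "\<phi> (ind {X}) \<otimes>\<^bsub>central_alg D\<^esub> \<phi> (ind {Y}) = \<zero>\<^bsub>central_alg D\<^esub>"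
      using \<phi> rp XY unfolding cpc_order_zero_def order_zero_def by blast
    then show ?thesis using a XY by (simp add: F_class_mult F_class_zero F_class_eq_iff)
  qed
  obtain e where e: "\<And>X. X \<in> L \<Longrightarrow> e X \<in> central_seqs D" "\<And>X. X \<in> L \<Longrightarrow> positive_contraction (e X)"
    "\<And>X. X \<in> L \<Longrightarrow> e X - a X \<in> null_seqs D" "\<And>X Y. X \<in> L \<Longrightarrow> Y \<in> L \<Longrightarrow> X \<noteq> Y \<Longrightarrow> e X * e Y = 0"
  proof (rule I.lift_orthogonal_contractions[of L a])
    show "finite L" by (rule L)
    show "a X \<in> central_seqs D" "positive_elem (a X)" if "X \<in> L" for X using a that by blast+
    show "a X * a Y \<in> null_seqs D" if "X \<in> L" "Y \<in> L" "X \<noteq> Y" for X Y using orth that by blast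
    show "\<exists>y. y - a X \<in> null_seqs D \<and> norm y < 1 + \<delta>" if "X \<in> L" "\<delta> > 0" for X \<delta>
      using small that by blast
  qed (rule that)
  show thesis
  proof (rule that[of e])
    show "\<phi> (ind {X}) = F_class D (e X)" if "X \<in> L" for X
      using a(3)[OF that] e(3)[OF that] by (simp add: F_class_eq_iff I.J_sym)
  qed (use e in auto)
qed

lemma positive_contraction_apply:
  fixes x :: "nat \<Rightarrow>\<^sub>C 'a::cstar_algebra"
  assumes "positive_contraction x"
  shows "positive_contraction (x n)"
proof -
  obtain z where z: "x = adj z * z" "norm x \<le> 1"
    using assms by (auto simp: positive_contraction_def positive_elem_def)
  have "x n = adj (z n) * z n" by (simp add: z)
  moreover have "norm (x n) \<le> 1" using norm_bounded[of x n] z(2) by linarith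
  ultimately show ?thesis by (auto simp: positive_contraction_def positive_elem_def)
qed

theorem rokhlin_dim_le_imp_towers:
  fixes G :: "('g, 'm) monoid_scheme" and \<alpha> :: "'g \<Rightarrow> 'a::cstar_algebra \<Rightarrow> 'a"
  assumes G: "group G" and H: "finite_index_subgroup G H" and D: "admissible_subalgebra G \<alpha> w D"
    and \<alpha>: "\<And>g. g \<in> carrier G \<Longrightarrow> star_automorphism (\<alpha> g)" and R: "rokhlin_dim_le G \<alpha> w H d"
  shows "\<exists>e. rokhlin_towers G \<alpha> D H d e"
proof -
  interpret group G by fact
  define L where "L = lcosets\<^bsub>G\<^esub> H"
  have L: "finite L" and sub: "subgroup H G" using H by (auto simp: L_def finite_index_subgroup_def)
  have Dadj: "adj ` D \<subseteq> D" and D0: "D \<noteq> {}" and Dsep: "separable_space (top_of_set D)"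
    using D by (auto simp: admissible_subalgebra_def cstar_subalgebra_def)
  interpret I: closed_ideal "central_seqs D" "null_seqs D" by (rule closed_ideal_seqs[OF Dadj])
  have "\<exists>\<phi>. (\<forall>l\<le>d. cpc_order_zero (fun_alg L) (central_alg D) (\<phi> l) \<and>
      (\<forall>g\<in>carrier G. \<forall>f\<in>carrier (fun_alg L).
         \<phi> l (shift G H g f) = induced_map (const_seq ` D) (seq_map (\<alpha> g)) (\<phi> l f))) \<and>
      (\<Oplus>\<^bsub>central_alg D\<^esub>l\<in>{..d}. \<phi> l \<one>\<^bsub>fun_alg L\<^esub>) = \<one>\<^bsub>central_alg D\<^esub>"
    using R[unfolded rokhlin_dim_le_def Let_def, rule_format, OF D] by (simp only: L_def)
  then obtain \<phi> where \<phi>0: "\<forall>l\<le>d. cpc_order_zero (fun_alg L) (central_alg D) (\<phi> l) \<and>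
      (\<forall>g\<in>carrier G. \<forall>f\<in>carrier (fun_alg L).
         \<phi> l (shift G H g f) = induced_map (const_seq ` D) (seq_map (\<alpha> g)) (\<phi> l f))"
    and \<phi>1: "(\<Oplus>\<^bsub>central_alg D\<^esub>l\<in>{..d}. \<phi> l \<one>\<^bsub>fun_alg L\<^esub>) = \<one>\<^bsub>central_alg D\<^esub>"
    by (elim exE conjE)
  have \<phi>: "\<And>l. l \<le> d \<Longrightarrow> cpc_order_zero (fun_alg L) (central_alg D) (\<phi> l)"
    "\<And>l g f. l \<le> d \<Longrightarrow> g \<in> carrier G \<Longrightarrow> f \<in> carrier (fun_alg L) \<Longrightarrow>
       \<phi> l (shift G H g f) = induced_map (const_seq ` D) (seq_map (\<alpha> g)) (\<phi> l f)"
    "(\<Oplus>\<^bsub>central_alg D\<^esub>l\<in>{..d}. \<phi> l \<one>\<^bsub>fun_alg L\<^esub>) = \<one>\<^bsub>central_alg D\<^esub>"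
    using \<phi>0 \<phi>1 by simp_all
  have "\<exists>e :: 'g set \<Rightarrow> nat \<Rightarrow>\<^sub>C 'a. \<forall>X\<in>L. e X \<in> central_seqs D \<and> positive_contraction (e X) \<and>
      \<phi> l (ind {X}) = F_class D (e X) \<and> (\<forall>Y\<in>L. X \<noteq> Y \<longrightarrow> e X * e Y = 0)" if l: "l \<le> d" for l
    by (rule cpc_order_zero_lift[OF \<phi>(1)[OF l] L Dadj]) blast
  then obtain e :: "nat \<Rightarrow> 'g set \<Rightarrow> nat \<Rightarrow>\<^sub>C 'a" where
    e: "\<forall>l\<le>d. \<forall>X\<in>L. e l X \<in> central_seqs D \<and> positive_contraction (e l X) \<and>
      \<phi> l (ind {X}) = F_class D (e l X) \<and> (\<forall>Y\<in>L. X \<noteq> Y \<longrightarrow> e l X * e l Y = 0)"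
    by metis
  have one: "\<one>\<^bsub>fun_alg L\<^esub> = ind L" by (simp add: fun_alg_def)
  have shift: "shift G H g (ind {X}) = ind {g <#\<^bsub>G\<^esub> X}" if "g \<in> carrier G" "X \<in> L" for g X
    unfolding shift_def L_def[symmetric]
    using lcoset_action[OF G sub that(1)] that(2)[unfolded L_def] by (auto simp: fun_eq_iff L_def)
  have null: "(\<lambda>n. (x n - y n) * a) \<longlonglongrightarrow> 0"
    if "F_class D x = F_class D y" "a \<in> D" for x y :: "nat \<Rightarrow>\<^sub>C 'a" and a
    using that by (simp add: F_class_eq_iff null_seqs_def)
  have equiv: "(\<lambda>n. (\<alpha> g (e l X n) - e l (g <#\<^bsub>G\<^esub> X) n) * a) \<longlonglongrightarrow> 0"
    if l: "l \<le> d" and X: "X \<in> L" and g: "g \<in> carrier G" and a: "a \<in> D" for l X g a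
  proof -
    have gX: "g <#\<^bsub>G\<^esub> X \<in> L" using lcoset_action(1)[OF G sub g] X by (simp add: L_def)
    note bl = star_automorphism_bounded_linear[OF \<alpha>[OF g]]
    have "norm (\<alpha> g (e l X n)) \<le> norm (e l X)" for n
      using bl(2) norm_bounded by (rule order_trans)
    then obtain y :: "nat \<Rightarrow>\<^sub>C 'a" where y: "apply_bcontfun y = (\<lambda>n. \<alpha> g (e l X n))"
      using exists_bcontfun_seq[of "\<lambda>n. \<alpha> g (e l X n)"] by blast
    have "seq_class (e l X) \<in> F_class D (e l X)" by (simp add: F_class_def in_ann_coset_iff ann_zero)
    \<comment> \<open>One inclusion suffices: the right-hand side turns out to be a single coset,
      which therefore contains the class of \<open>y\<close>.\<close>
    then have "ann_coset (const_seq ` D) (seq_map (\<alpha> g) (seq_class (e l X))) \<subseteq>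
        induced_map (const_seq ` D) (seq_map (\<alpha> g)) (\<phi> l (ind {X}))"
      using e l X unfolding induced_map_def by auto
    also have "\<dots> = \<phi> l (ind {g <#\<^bsub>G\<^esub> X})"
      using \<phi>(2)[OF l g, of "ind {X}"] shift[OF g X] ind_carrier[of "{X}" L] X by simp
    also have "\<dots> = F_class D (e l (g <#\<^bsub>G\<^esub> X))" using e l gX by simp
    also have "seq_map (\<alpha> g) (seq_class (e l X)) = seq_class y"
      by (rule seq_map_class[OF bl(1)]) (simp add: y)
    finally have "seq_class y \<in> F_class D (e l (g <#\<^bsub>G\<^esub> X))"
      by (auto simp: in_ann_coset_iff ann_zero)
    then have "F_class D y = F_class D (e l (g <#\<^bsub>G\<^esub> X))"
      by (simp add: F_class_def in_ann_coset_iff ann_coset_eq_iff)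
    from null[OF this a] show ?thesis by (simp add: y)
  qed
  have unit: "(\<lambda>n. (\<Sum>l\<le>d. \<Sum>X\<in>L. e l X n) * a - a) \<longlonglongrightarrow> 0" if a: "a \<in> D" for a
  proof -
    obtain u :: "nat \<Rightarrow>\<^sub>C 'a" where u: "u \<in> central_seqs D" "\<And>d. d \<in> D \<Longrightarrow> (\<lambda>n. u n * d - d) \<longlonglongrightarrow> 0"
    proof (rule exists_F_unit[OF Dsep D0])
      fix x :: "nat \<Rightarrow>\<^sub>C 'a"
      assume "x \<in> central_seqs D" "\<And>d. d \<in> D \<Longrightarrow> (\<lambda>n. x n * d - d) \<longlonglongrightarrow> 0"
      then show thesis by (rule that)
    qed
    let ?s = "\<lambda>l. \<Sum>X\<in>L. e l X"
    have s: "?s l \<in> central_seqs D" if "l \<le> d" for l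
      using e that by (intro cstar_subalgebra_sum[OF I.C]) blast
    have \<phi>l: "\<phi> l \<one>\<^bsub>fun_alg L\<^esub> = F_class D (?s l)" if l: "l \<le> d" for l
      unfolding one using e l by (intro cpc_order_zero_additive[OF \<phi>(1)[OF l]] L) auto
    have "(\<Oplus>\<^bsub>central_alg D\<^esub>l\<in>{..d}. \<phi> l \<one>\<^bsub>fun_alg L\<^esub>) = (\<Oplus>\<^bsub>central_alg D\<^esub>l\<in>{..d}. F_class D (?s l))"
      using s by (intro abelian_monoid.finsum_cong'[OF abelian_group.axioms(1)[OF abelian_group_F_alg]])
        (auto simp: \<phi>l F_class_carrier)
    also have "\<dots> = F_class D (\<Sum>l\<le>d. ?s l)" using s by (intro F_class_finsum) auto
    finally have "F_class D (\<Sum>l\<le>d. ?s l) = F_class D u"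
      using \<phi>(3) F_one[OF u] by simp
    from tendsto_add[OF null[OF this a] u(2)[OF a]] show ?thesis
      by (simp add: sum_bcontfun left_diff_distrib)
  qed
  have "rokhlin_towers G \<alpha> D H d (\<lambda>l X. apply_bcontfun (e l X))"
    unfolding rokhlin_towers_def L_def[symmetric]
  proof (intro conjI allI impI ballI)
    fix l X n assume "l \<le> d" "X \<in> L"
    then show "positive_contraction (e l X n)" using e positive_contraction_apply by blast
    fix Y assume "Y \<in> L" "X \<noteq> Y"
    then have "(e l X * e l Y) n = 0" using e \<open>l \<le> d\<close> \<open>X \<in> L\<close> by (metis zero_bcontfun.rep_eq)
    then show "e l X n * e l Y n = 0" by simp
  next
    fix l X a assume "l \<le> d" "X \<in> L" "a \<in> D"
    then show "(\<lambda>n. e l X n * a - a * e l X n) \<longlonglongrightarrow> 0" using e by (auto simp: central_seqs_def)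
  qed (use equiv unit in auto)
  then show ?thesis by blast
qed

theorem towers_imp_cpc_order_zero:
  fixes e :: "'x \<Rightarrow> nat \<Rightarrow>\<^sub>C 'a::cstar_algebra"
  assumes L: "finite L" "L \<noteq> {}" and D: "adj ` D \<subseteq> D"
    and e: "\<And>X. X \<in> L \<Longrightarrow> e X \<in> central_seqs D" "\<And>X. X \<in> L \<Longrightarrow> positive_contraction (e X)"
      "\<And>X Y. X \<in> L \<Longrightarrow> Y \<in> L \<Longrightarrow> X \<noteq> Y \<Longrightarrow> e X * e Y = 0"
  shows "cpc_order_zero (fun_alg L) (central_alg D) (\<lambda>f. F_class D (\<Sum>X\<in>L. f X *\<^sub>C e X))"
proof -
  interpret I: closed_ideal "central_seqs D" "null_seqs D" by (rule closed_ideal_seqs[OF D])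
  have Csc: "c *\<^sub>C x \<in> central_seqs D" if "x \<in> central_seqs D" for c x
    using I.C that by (simp add: cstar_subalgebra_def)
  have ep: "positive_elem (e X)" "adj (e X) = e X" "norm (e X) \<le> 1" if "X \<in> L" for X
    using e(2)[OF that] positive_elem_selfadj by (auto simp: positive_contraction_def)
  define \<psi> where "\<psi> f = (\<Sum>X\<in>L. f X *\<^sub>C e X)" for f :: "'x \<Rightarrow> complex"
  have \<psi>C: "\<psi> f \<in> central_seqs D" for f
    unfolding \<psi>_def by (intro cstar_subalgebra_sum[OF I.C] Csc e(1))
  define sr where "sr t = sqrt (pos_part t)" for t
  have sr: "fc_fun sr" unfolding sr_def by (intro fc_intros)
  define r where "r X = fc sr (e X)" for X
  have r: "r X \<in> central_seqs D" "adj (r X) = r X" "r X * r X = e X" if "X \<in> L" for X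
    unfolding r_def
    using fc_in_subalgebra[OF I.C e(1)[OF that] ep(2)[OF that] sr] fc_selfadj[OF ep(2)[OF that] sr]
      positive_elem_sqrt[OF ep(1)[OF that]] by (simp_all add: sr_def[abs_def])
  have ro: "r X * r Y = 0" if "X \<in> L" "Y \<in> L" "X \<noteq> Y" for X Y
    unfolding r_def using that e(3) ep(2) sr by (intro mult_fc_eq_0 fc_mult_eq_0) auto
  \<comment> \<open>Built from the square roots, so that \<open>adj (\<rho> f) * \<rho> g\<close> is
    \<open>\<psi>\<close> of the product of the conjugate of \<open>f\<close> with \<open>g\<close>.
    Applied entrywise, \<open>\<rho>\<close> turns a factorisation of a positive matrix of functions
    into one of its image.\<close>
  define \<rho> where "\<rho> f = (\<Sum>X\<in>L. f X *\<^sub>C r X)" for f :: "'x \<Rightarrow> complex"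
  have \<rho>C: "\<rho> f \<in> central_seqs D" for f
    unfolding \<rho>_def by (intro cstar_subalgebra_sum[OF I.C] Csc r(1))
  have \<rho>\<rho>: "adj (\<rho> f) * \<rho> g = \<psi> (\<lambda>X. cnj (f X) * g X)" for f g
  proof -
    have "adj (\<rho> f) * \<rho> g = (\<Sum>X\<in>L. cnj (f X) *\<^sub>C r X) * (\<Sum>X\<in>L. g X *\<^sub>C r X)"
      by (simp add: \<rho>_def adj_sum adj_scaleC r)
    also have "\<dots> = (\<Sum>X\<in>L. (cnj (f X) *\<^sub>C r X) * (g X *\<^sub>C r X))"
      by (rule sum_mult_sum_orthogonal[OF L(1)])
         (simp add: mult_scaleC_left mult_scaleC_right ro scaleC_zero)
    finally show ?thesis
      by (simp add: \<psi>_def mult_scaleC_left mult_scaleC_right scaleC_scaleC r mult.commute)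
  qed
  have \<psi>_add: "\<psi> (\<lambda>x. f x + g x) = \<psi> f + \<psi> g" for f g
    by (simp add: \<psi>_def scaleC_add_left sum.distrib)
  have \<psi>_sum: "\<psi> (\<lambda>x. \<Sum>k\<in>K. f k x) = (\<Sum>k\<in>K. \<psi> (f k))" if "finite K" for K and f :: "nat \<Rightarrow> 'x \<Rightarrow> complex"
    using that by (induct K rule: finite_induct) (simp_all add: \<psi>_add, simp add: \<psi>_def scaleC_zero_left)
  have \<psi>_scale: "\<psi> (\<lambda>x. c * f x) = c *\<^sub>C \<psi> f" for c f
    by (simp add: \<psi>_def scaleC_sum_right scaleC_scaleC)
  have lin: "linear_between (fun_alg L) (central_alg D) (\<lambda>f. F_class D (\<psi> f))"
    unfolding linear_between_def using \<psi>C
    by (auto simp: F_class_carrier F_class_add F_class_scale fun_alg_def \<psi>_add \<psi>_scale)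
  have cp: "mat_positive (central_alg D) n (\<lambda>i j. F_class D (\<psi> (X i j)))"
    if X: "mat_positive (fun_alg L) n X" for n X
  proof -
    obtain Z where Z: "\<forall>i<n. \<forall>j<n. Z i j \<in> carrier (fun_alg L)"
      "\<forall>i<n. \<forall>j<n. X i j = (\<Oplus>\<^bsub>fun_alg L\<^esub>k\<in>{..<n}. star_op (fun_alg L) (Z k i) \<otimes>\<^bsub>fun_alg L\<^esub> Z k j)"
      using X unfolding mat_positive_def by blast
    show ?thesis unfolding mat_positive_def
    proof (intro exI[of _ "\<lambda>k j. F_class D (\<rho> (Z k j))"] conjI allI impI)
      show "F_class D (\<rho> (Z i j)) \<in> carrier (central_alg D)" for i j by (rule F_class_carrier[OF \<rho>C])
      fix i j assume ij: "i < n" "j < n"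
      have "X i j = (\<lambda>x. \<Sum>k\<in>{..<n}. (star_op (fun_alg L) (Z k i) \<otimes>\<^bsub>fun_alg L\<^esub> Z k j) x)"
        using Z ij by (subst fun_alg_finsum[symmetric]) (auto simp: fun_alg_def)
      also have "\<dots> = (\<lambda>x. \<Sum>k\<in>{..<n}. cnj (Z k i x) * Z k j x)" by (simp add: fun_alg_def)
      finally have "\<psi> (X i j) = (\<Sum>k\<in>{..<n}. adj (\<rho> (Z k i)) * \<rho> (Z k j))"
        by (simp add: \<psi>_sum \<rho>\<rho>)
      moreover have "adj (\<rho> f) * \<rho> g \<in> central_seqs D" for f g using \<rho>C I.C_adj I.C_mult by blast
      then have "(\<Oplus>\<^bsub>central_alg D\<^esub>k\<in>{..<n}. F_class D (adj (\<rho> (Z k i)) * \<rho> (Z k j)))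
          = F_class D (\<Sum>k\<in>{..<n}. adj (\<rho> (Z k i)) * \<rho> (Z k j))"
        by (intro F_class_finsum) auto
      moreover have "star_op (central_alg D) (F_class D (\<rho> f)) \<otimes>\<^bsub>central_alg D\<^esub> F_class D (\<rho> g) =
          F_class D (adj (\<rho> f) * \<rho> g)" for f g
        using \<rho>C I.C_adj by (simp add: F_class_star[OF D] F_class_mult)
      ultimately show "F_class D (\<psi> (X i j)) = (\<Oplus>\<^bsub>central_alg D\<^esub>k\<in>{..<n}.
          star_op (central_alg D) (F_class D (\<rho> (Z k i))) \<otimes>\<^bsub>central_alg D\<^esub> F_class D (\<rho> (Z k j)))"
        by simp
    qed
  qed
  have ctr: "rnorm (central_alg D) (F_class D (\<psi> f)) \<le> rnorm (fun_alg L) f" for f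
  proof -
    obtain X where X: "X \<in> L" using L(2) by blast
    have "norm (\<psi> f) \<le> rnorm (fun_alg L) f" unfolding \<psi>_def
    proof (rule norm_scaled_sum_orthogonal_le[OF L(1)])
      show "cmod (f X) \<le> rnorm (fun_alg L) f" if "X \<in> L" for X by (rule fun_alg_rnorm_ge[OF L(1) that])
      from this[OF X] show "0 \<le> rnorm (fun_alg L) f" using norm_ge_zero order_trans by blast
    qed (use ep e(3) in auto)
    then show ?thesis using F_class_rnorm_le order_trans by blast
  qed
  have oz: "F_class D (\<psi> f) \<otimes>\<^bsub>central_alg D\<^esub> F_class D (\<psi> g) = \<zero>\<^bsub>central_alg D\<^esub>"
    if fg: "f \<otimes>\<^bsub>fun_alg L\<^esub> g = \<zero>\<^bsub>fun_alg L\<^esub>" for f g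
  proof -
    have fg0: "f X * g X = 0" for X using fg by (simp add: fun_alg_def fun_eq_iff)
    have "\<psi> f * \<psi> g = (\<Sum>X\<in>L. (f X *\<^sub>C e X) * (g X *\<^sub>C e X))" unfolding \<psi>_def
      by (rule sum_mult_sum_orthogonal[OF L(1)])
         (simp add: mult_scaleC_left mult_scaleC_right e(3) scaleC_zero)
    also have "\<dots> = (\<Sum>X\<in>L. (f X * g X) *\<^sub>C (e X * e X))"
      by (simp add: mult_scaleC_left mult_scaleC_right scaleC_scaleC mult.commute)
    also have "\<dots> = 0" by (simp add: fg0 scaleC_zero_left)
    finally show ?thesis using \<psi>C by (simp add: F_class_mult F_class_zero)
  qed
  show ?thesis
    unfolding cpc_order_zero_def completely_positive_def contractive_def order_zero_def \<psi>_def[symmetric]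
    using lin cp ctr oz by blast
qed

theorem towers_imp_rokhlin_dim_le:
  fixes G :: "('g, 'm) monoid_scheme" and \<alpha> :: "'g \<Rightarrow> 'a::cstar_algebra \<Rightarrow> 'a"
  assumes G: "group G" and H: "finite_index_subgroup G H" and c: "cocycle_action G \<alpha> w"
    and T: "\<And>D. admissible_subalgebra G \<alpha> w D \<Longrightarrow> \<exists>e. rokhlin_towers G \<alpha> D H d e"
  shows "rokhlin_dim_le G \<alpha> w H d"
  unfolding rokhlin_dim_le_def Let_def
proof (intro allI impI)
  interpret group G by fact
  fix D assume D: "admissible_subalgebra G \<alpha> w D"
  define L where "L = lcosets\<^bsub>G\<^esub> H"
  have L: "finite L" and sub: "subgroup H G" using H by (auto simp: L_def finite_index_subgroup_def)
  have L0: "L \<noteq> {}" unfolding L_def using lcosets_memI[OF one_closed] by blast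
  have Dadj: "adj ` D \<subseteq> D" using D by (auto simp: admissible_subalgebra_def cstar_subalgebra_def)
  interpret I: closed_ideal "central_seqs D" "null_seqs D" by (rule closed_ideal_seqs[OF Dadj])
  have \<alpha>: "star_automorphism (\<alpha> g)" if "g \<in> carrier G" for g
    using c that by (simp add: cocycle_action_def)
  obtain t where t: "rokhlin_towers G \<alpha> D H d t" using T[OF D] by blast
  note tpc = rokhlin_towersD(1)[OF t, folded L_def]
    and torth = rokhlin_towersD(2)[OF t, folded L_def]
    and tcomm = rokhlin_towersD(3)[OF t, folded L_def]
    and tequiv = rokhlin_towersD(4)[OF t, folded L_def]
    and tunit = rokhlin_towersD(5)[OF t, folded L_def]
  have "\<exists>x :: nat \<Rightarrow>\<^sub>C 'a. apply_bcontfun x = t l X" if "l \<le> d" "X \<in> L" for l X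
    by (rule exists_bcontfun_seq[of _ 1]) (use tpc[OF that] in \<open>simp add: positive_contraction_def\<close>)
  then obtain e :: "nat \<Rightarrow> 'g set \<Rightarrow> nat \<Rightarrow>\<^sub>C 'a" where
    e: "\<And>l X. l \<le> d \<Longrightarrow> X \<in> L \<Longrightarrow> apply_bcontfun (e l X) = t l X" by metis
  have eC: "e l X \<in> central_seqs D" if "l \<le> d" "X \<in> L" for l X
    using tcomm that by (simp add: central_seqs_def e)
  have epc: "positive_contraction (e l X)" if lX: "l \<le> d" "X \<in> L" for l X
  proof -
    have "\<exists>z. t l X n = adj z * z" for n
      using tpc[OF lX] by (simp add: positive_contraction_def positive_elem_def)
    then obtain z where z: "\<And>n. t l X n = adj (z n) * z n" by metis
    \<comment> \<open>By the C*-identity the componentwise roots are bounded, so they form an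
      element of the sequence algebra.\<close>
    have "norm (z n) \<le> 1" for n
      using tpc[OF lX, of n] by (simp add: positive_contraction_def z cstar_identity power_le_one_iff)
    then obtain y :: "nat \<Rightarrow>\<^sub>C 'a" where y: "apply_bcontfun y = z" using exists_bcontfun_seq by blast
    have "e l X = adj y * y" by (rule bcontfun_eqI) (simp add: y e[OF lX] z)
    moreover have "norm (e l X) \<le> 1"
      by (rule norm_bound) (use tpc[OF lX] in \<open>simp add: e[OF lX] positive_contraction_def\<close>)
    ultimately show ?thesis by (auto simp: positive_contraction_def positive_elem_def)
  qed
  have eo: "e l X * e l Y = 0" if "l \<le> d" "X \<in> L" "Y \<in> L" "X \<noteq> Y" for l X Y
    by (rule bcontfun_eqI) (use torth that in \<open>simp add: e\<close>)
  define \<psi> where "\<psi> l f = (\<Sum>X\<in>L. f X *\<^sub>C e l X)" for l and f :: "'g set \<Rightarrow> complex"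
  define \<phi> where "\<phi> l f = F_class D (\<psi> l f)" for l f
  have \<psi>C: "\<psi> l f \<in> central_seqs D" if "l \<le> d" for l f
    unfolding \<psi>_def using eC that I.C by (intro cstar_subalgebra_sum[OF I.C]) (simp add: cstar_subalgebra_def)
  have cpc: "cpc_order_zero (fun_alg L) (central_alg D) (\<phi> l)" if "l \<le> d" for l
    unfolding \<phi>_def \<psi>_def
    by (rule towers_imp_cpc_order_zero[OF L L0 Dadj]) (use eC epc eo that in auto)
  have equiv: "\<phi> l (shift G H g f) = induced_map (const_seq ` D) (seq_map (\<alpha> g)) (\<phi> l f)"
    if l: "l \<le> d" and g: "g \<in> carrier G" for l g f
  proof -
    note act = lcoset_action[OF G sub, folded L_def]
    note bl = star_automorphism_bounded_linear[OF \<alpha>[OF g]]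
    have \<alpha>_simps: "\<alpha> g (x + y) = \<alpha> g x + \<alpha> g y" "\<alpha> g (k *\<^sub>C x) = k *\<^sub>C \<alpha> g x"
      "\<alpha> g (x * y) = \<alpha> g x * \<alpha> g y" "\<alpha> g (adj x) = adj (\<alpha> g x)" for x y k
      using \<alpha>[OF g] by (auto simp: star_automorphism_def clinear_map_def)
    have \<alpha>_diff: "\<alpha> g (x - y) = \<alpha> g x - \<alpha> g y" for x y
      using bl(1) by (simp add: bounded_linear.linear linear_diff)
    have \<alpha>_sum: "\<alpha> g (\<Sum>i\<in>K. h i) = (\<Sum>i\<in>K. \<alpha> g (h i))" for K :: "'g set set" and h
      using linear_sum[OF bounded_linear.linear[OF bl(1)]] .
    have "\<exists>y :: nat \<Rightarrow>\<^sub>C 'a. apply_bcontfun y = (\<lambda>n. \<alpha> g (x n))" for x :: "nat \<Rightarrow>\<^sub>C 'a"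
      by (rule exists_bcontfun_seq[of _ "norm x"]) (meson bl(2) norm_bounded order_trans)
    then obtain a :: "(nat \<Rightarrow>\<^sub>C 'a) \<Rightarrow> nat \<Rightarrow>\<^sub>C 'a" where a: "\<And>x. apply_bcontfun (a x) = (\<lambda>n. \<alpha> g (x n))"
      by metis
    have sm: "seq_map (\<alpha> g) (seq_class x) = seq_class (a x)" for x
      by (rule seq_map_class[OF bl(1)]) (simp add: a)
    have a_diff: "a (x - y) = a x - a y" for x y by (rule bcontfun_eqI) (simp add: a \<alpha>_diff)
    \<comment> \<open>A test element \<open>b\<close> has to be pulled back to \<open>D\<close>
      along \<open>\<alpha> g\<close>, hence the surjectivity on \<open>D\<close>.\<close>
    have aJ: "a x \<in> null_seqs D" if x: "x \<in> null_seqs D" for x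
      unfolding null_seqs_def
    proof (intro CollectI ballI)
      fix b assume "b \<in> D"
      then obtain b' where b': "b' \<in> D" "\<alpha> g b' = b" using cocycle_action_surj_on[OF G c D g] by blast
      then have "(\<lambda>n. x n * b') \<longlonglongrightarrow> 0" "(\<lambda>n. b' * x n) \<longlonglongrightarrow> 0" using x by (auto simp: null_seqs_def)
      from bounded_linear.tendsto[OF bl(1) this(1)] bounded_linear.tendsto[OF bl(1) this(2)]
      show "(\<lambda>n. a x n * b) \<longlonglongrightarrow> 0 \<and> (\<lambda>n. b * a x n) \<longlonglongrightarrow> 0"
        using b'(2) linear_0[OF bounded_linear.linear[OF bl(1)]] by (simp add: \<alpha>_simps a)
    qed
    have "induced_map (const_seq ` D) (seq_map (\<alpha> g)) (\<phi> l f) =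
        ann_coset (const_seq ` D) (seq_map (\<alpha> g) (seq_class (\<psi> l f)))"
      unfolding induced_map_def \<phi>_def F_class_def
    proof (rule ann_coset_lift)
      fix x' assume x': "x' - seq_class (\<psi> l f) \<in> annihilator (const_seq ` D)"
      obtain y where y: "x' = seq_class y" by (rule seq_class_exhaust)
      have "y - \<psi> l f \<in> null_seqs D" using x' by (simp add: y null_seqs_iff seq_class_diff)
      from aJ[OF this] show "seq_map (\<alpha> g) x' - seq_map (\<alpha> g) (seq_class (\<psi> l f)) \<in> annihilator (const_seq ` D)"
        by (simp add: y sm a_diff null_seqs_iff seq_class_diff)
    qed
    also have "\<dots> = F_class D (a (\<psi> l f))" by (simp add: sm F_class_def)
    also have "\<dots> = F_class D (\<Sum>X\<in>L. f X *\<^sub>C e l (g <#\<^bsub>G\<^esub> X))"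
    proof -
      have "a (\<psi> l f) = (\<Sum>X\<in>L. f X *\<^sub>C a (e l X))"
        by (rule bcontfun_eqI) (simp add: a \<psi>_def sum_bcontfun \<alpha>_sum \<alpha>_simps)
      then have "a (\<psi> l f) - (\<Sum>X\<in>L. f X *\<^sub>C e l (g <#\<^bsub>G\<^esub> X)) =
          (\<Sum>X\<in>L. f X *\<^sub>C (a (e l X) - e l (g <#\<^bsub>G\<^esub> X)))"
        by (simp add: scaleC_diff_right sum_subtractf)
      also have "\<dots> \<in> null_seqs D"
      proof (rule I.J_sum)
        fix X assume X: "X \<in> L"
        have gX: "g <#\<^bsub>G\<^esub> X \<in> L" using act(1)[OF g X] .
        define y where "y = a (e l X) - e l (g <#\<^bsub>G\<^esub> X)"
        have yd: "(\<lambda>n. y n * b) \<longlonglongrightarrow> 0" if "b \<in> D" for b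
          using tequiv[OF l X g that] by (simp add: y_def a e[OF l X] e[OF l gX])
        \<comment> \<open>The towers control multiplication by \<open>b\<close> from the right;
          self-adjointness supplies the left.\<close>
        have ys: "adj (y n) = y n" for n
          using tpc[OF l X, of n] tpc[OF l gX, of n]
          by (simp add: y_def a e[OF l X] e[OF l gX] adj_minus positive_contraction_def
              positive_elem_selfadj flip: \<alpha>_simps(4))
        have "(\<lambda>n. b * y n) \<longlonglongrightarrow> 0" if "b \<in> D" for b
        proof -
          have "adj b \<in> D" using Dadj that by blast
          from bounded_linear.tendsto[OF bounded_linear_adj yd[OF this]] show ?thesis
            by (simp add: adj_mult adj_adj ys adj_zero)
        qed
        with yd have "y \<in> null_seqs D" by (simp add: null_seqs_def)
        then show "f X *\<^sub>C (a (e l X) - e l (g <#\<^bsub>G\<^esub> X)) \<in> null_seqs D"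
          unfolding y_def[symmetric] null_seqs_iff seq_class_scaleC[symmetric] by (rule ann_scaleC)
      qed
      finally show ?thesis by (simp add: F_class_eq_iff)
    qed
    also have "(\<Sum>X\<in>L. f X *\<^sub>C e l (g <#\<^bsub>G\<^esub> X)) = \<psi> l (shift G H g f)"
      unfolding \<psi>_def
    proof (rule sum.reindex_bij_witness[where i = "\<lambda>X. inv\<^bsub>G\<^esub> g <#\<^bsub>G\<^esub> X" and j = "\<lambda>X. g <#\<^bsub>G\<^esub> X"])
      fix X assume X: "X \<in> L"
      show "inv\<^bsub>G\<^esub> g <#\<^bsub>G\<^esub> (g <#\<^bsub>G\<^esub> X) = X" "g <#\<^bsub>G\<^esub> X \<in> L" "g <#\<^bsub>G\<^esub> (inv\<^bsub>G\<^esub> g <#\<^bsub>G\<^esub> X) = X"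
        using act[OF g X] by auto
      show "inv\<^bsub>G\<^esub> g <#\<^bsub>G\<^esub> X \<in> L" using act(1)[OF inv_closed[OF g] X] .
      show "shift G H g f (g <#\<^bsub>G\<^esub> X) *\<^sub>C e l (g <#\<^bsub>G\<^esub> X) = f X *\<^sub>C e l (g <#\<^bsub>G\<^esub> X)"
        unfolding shift_def L_def[symmetric] using act[OF g X] by simp
    qed
    finally show ?thesis by (simp add: \<phi>_def)
  qed
  have unit: "(\<Oplus>\<^bsub>central_alg D\<^esub>l\<in>{..d}. \<phi> l \<one>\<^bsub>fun_alg L\<^esub>) = \<one>\<^bsub>central_alg D\<^esub>"
  proof -
    let ?s = "\<Sum>l\<le>d. \<psi> l \<one>\<^bsub>fun_alg L\<^esub>"
    have "(\<Oplus>\<^bsub>central_alg D\<^esub>l\<in>{..d}. \<phi> l \<one>\<^bsub>fun_alg L\<^esub>) = F_class D ?s"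
      unfolding \<phi>_def by (rule F_class_finsum) (auto intro: \<psi>C)
    also have "\<dots> = \<one>\<^bsub>central_alg D\<^esub>"
    proof (rule F_one[symmetric])
      show "?s \<in> central_seqs D" by (rule cstar_subalgebra_sum[OF I.C]) (auto intro: \<psi>C)
      have "?s n = (\<Sum>l\<le>d. \<Sum>X\<in>L. t l X n)" for n
        by (simp add: sum_bcontfun \<psi>_def fun_alg_def scaleC_one e)
      then show "(\<lambda>n. ?s n * b - b) \<longlonglongrightarrow> 0" if "b \<in> D" for b using tunit[OF that] by simp
    qed
    finally show ?thesis .
  qed
  show "\<exists>\<phi>. (\<forall>l\<le>d. cpc_order_zero (fun_alg (lcosets\<^bsub>G\<^esub> H)) (central_alg D) (\<phi> l) \<and>
          (\<forall>g\<in>carrier G. \<forall>f\<in>carrier (fun_alg (lcosets\<^bsub>G\<^esub> H)).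
             \<phi> l (shift G H g f) = induced_map (const_seq ` D) (seq_map (\<alpha> g)) (\<phi> l f))) \<and>
        (\<Oplus>\<^bsub>central_alg D\<^esub>l\<in>{..d}. \<phi> l \<one>\<^bsub>fun_alg (lcosets\<^bsub>G\<^esub> H)\<^esub>) = \<one>\<^bsub>central_alg D\<^esub>"
    unfolding L_def[symmetric] using cpc equiv unit by (intro exI[of _ \<phi>]) blast
qed


section \<open>Separable invariant subalgebras\<close>

lemma bounded_linear_scaleC_left: "bounded_linear (\<lambda>c. c *\<^sub>C (x :: 'a::cstar_algebra))"
  by (rule bounded_linear_intro[where K = "norm x"])
     (simp_all add: scaleC_add_left norm_scaleC scaleR_scaleC scaleC_scaleC scaleR_conv_of_real)

lemma closure_invariant:
  assumes "bounded_linear f" "\<And>x. x \<in> T \<Longrightarrow> f x \<in> closure T" "x \<in> closure T"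
  shows "f x \<in> closure T"
proof -
  have "f ` closure T \<subseteq> closure T"
    using assms(2) by (intro image_closure_subset linear_continuous_on[OF assms(1)]) auto
  then show ?thesis using assms(3) by blast
qed

text \<open>The closure of a countable set stable under all operations, with scalars from a
  countable dense set; continuity extends stability to the closure and to all scalars.\<close>

lemma exists_admissible_subalgebra:
  fixes G :: "('g, 'm) monoid_scheme" and \<alpha> :: "'g \<Rightarrow> 'a::cstar_algebra \<Rightarrow> 'a"
  assumes G: "countable (carrier G)" and c: "cocycle_action G \<alpha> w" and S: "countable S"
  shows "\<exists>D. admissible_subalgebra G \<alpha> w D \<and> S \<subseteq> D"
proof -
  obtain Q :: "complex set" where Qc: "countable Q"
    and dense: "\<And>X. open X \<Longrightarrow> X \<noteq> {} \<Longrightarrow> \<exists>q\<in>Q. q \<in> X"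
  proof (rule countable_dense_setE[where 'a = complex], goal_cases)
    case (1 D)
    from 1(2-) show ?case by (rule 1(1))
  qed
  have "z \<in> closure Q" for z
    unfolding closure_approachable
  proof (intro allI impI)
    fix r :: real assume "r > 0"
    then show "\<exists>q\<in>Q. dist q z < r" using dense[of "ball z r"] by (auto simp: dist_commute)
  qed
  with Qc have Q: "countable Q" "closure Q = UNIV" by auto
  define step where "step X = insert 0 (X \<union> (\<lambda>(x, y). x + y) ` (X \<times> X) \<union> (\<lambda>(x, y). x * y) ` (X \<times> X)
    \<union> adj ` X \<union> (\<Union>q\<in>Q. (\<lambda>x. q *\<^sub>C x) ` X) \<union> (\<Union>g\<in>carrier G. \<alpha> g ` X)
    \<union> (\<Union>g\<in>carrier G. \<Union>h\<in>carrier G. mult_left (w g h) ` X \<union> (\<lambda>x. mult_right x (w g h)) ` X))"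
    for X :: "'a set"
  define T where "T = (\<Union>n. (step ^^ n) S)"
  have "countable ((step ^^ n) S)" for n
    by (induct n) (use G S Q in \<open>auto simp: step_def\<close>)
  then have Tc: "countable T" by (simp add: T_def)
  have mono: "(step ^^ n) S \<subseteq> (step ^^ m) S" if "n \<le> m" for n m
    by (rule lift_Suc_mono_le[OF _ that]) (auto simp: step_def)
  have T2: "\<exists>n. x \<in> (step ^^ n) S \<and> y \<in> (step ^^ n) S" if xy: "x \<in> T" "y \<in> T" for x y
  proof -
    obtain n where "x \<in> (step ^^ n) S" using xy(1) by (auto simp: T_def)
    moreover obtain m where "y \<in> (step ^^ m) S" using xy(2) by (auto simp: T_def)
    ultimately show ?thesis using mono[of n "max n m"] mono[of m "max n m"] by auto
  qed
  have stepT: "z \<in> T" if "z \<in> step ((step ^^ n) S)" for z n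
    unfolding T_def using that by (intro UN_I[of "Suc n"]) simp_all
  have T0: "0 \<in> T" by (rule stepT[of _ 0]) (simp add: step_def)
  have Tadd: "x + y \<in> T" and Tmult: "x * y \<in> T" if xy: "x \<in> T" "y \<in> T" for x y
  proof -
    obtain n where n: "x \<in> (step ^^ n) S" "y \<in> (step ^^ n) S" using T2[OF xy] by blast
    then show "x + y \<in> T" "x * y \<in> T"
      by (auto intro!: stepT[of _ n] simp: step_def)
  qed
  have T1: "adj x \<in> T" "q \<in> Q \<Longrightarrow> q *\<^sub>C x \<in> T" "g \<in> carrier G \<Longrightarrow> \<alpha> g x \<in> T"
    "g \<in> carrier G \<Longrightarrow> h \<in> carrier G \<Longrightarrow> mult_left (w g h) x \<in> T \<and> mult_right x (w g h) \<in> T"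
    if x: "x \<in> T" for x q g h
  proof -
    obtain n where "x \<in> (step ^^ n) S" using x by (auto simp: T_def)
    moreover define X where "X = (step ^^ n) S"
    ultimately have x: "x \<in> X" by simp
    have "adj x \<in> adj ` X" "q \<in> Q \<Longrightarrow> q *\<^sub>C x \<in> (\<Union>q\<in>Q. (\<lambda>x. q *\<^sub>C x) ` X)"
      "g \<in> carrier G \<Longrightarrow> \<alpha> g x \<in> (\<Union>g\<in>carrier G. \<alpha> g ` X)"
      using x by blast+
    moreover have "z \<in> (\<Union>g\<in>carrier G. \<Union>h\<in>carrier G. mult_left (w g h) ` X \<union> (\<lambda>x. mult_right x (w g h)) ` X)"
      if "g \<in> carrier G" "h \<in> carrier G" "z = mult_left (w g h) x \<or> z = mult_right x (w g h)" for z
      using that x by blast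
    ultimately have "adj x \<in> step X" "q \<in> Q \<Longrightarrow> q *\<^sub>C x \<in> step X"
      "g \<in> carrier G \<Longrightarrow> \<alpha> g x \<in> step X"
      "g \<in> carrier G \<Longrightarrow> h \<in> carrier G \<Longrightarrow> mult_left (w g h) x \<in> step X \<and> mult_right x (w g h) \<in> step X"
      by (simp_all only: step_def Un_iff insert_iff simp_thms)
    then show "adj x \<in> T" "q \<in> Q \<Longrightarrow> q *\<^sub>C x \<in> T" "g \<in> carrier G \<Longrightarrow> \<alpha> g x \<in> T"
      "g \<in> carrier G \<Longrightarrow> h \<in> carrier G \<Longrightarrow> mult_left (w g h) x \<in> T \<and> mult_right x (w g h) \<in> T"
      using stepT[of _ n] by (simp_all add: X_def)
  qed
  let ?D = "closure T"
  have sub: "x \<in> T \<Longrightarrow> x \<in> ?D" for x using closure_subset by blast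
  have Dadd: "x + y \<in> ?D" if xy: "x \<in> ?D" "y \<in> ?D" for x y
  proof -
    obtain f where f: "\<forall>n. f n \<in> T" "f \<longlonglongrightarrow> x" using xy(1) unfolding closure_sequential by blast
    obtain g where g: "\<forall>n. g n \<in> T" "g \<longlonglongrightarrow> y" using xy(2) unfolding closure_sequential by blast
    have "\<forall>n. f n + g n \<in> T" using f(1) g(1) Tadd by blast
    then show ?thesis unfolding closure_sequential
      using tendsto_add[OF f(2) g(2)] by (intro exI[of _ "\<lambda>n. f n + g n"] conjI)
  qed
  have Dmult: "x * y \<in> ?D" if xy: "x \<in> ?D" "y \<in> ?D" for x y
  proof -
    obtain f where f: "\<forall>n. f n \<in> T" "f \<longlonglongrightarrow> x" using xy(1) unfolding closure_sequential by blast
    obtain g where g: "\<forall>n. g n \<in> T" "g \<longlonglongrightarrow> y" using xy(2) unfolding closure_sequential by blast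
    have "\<forall>n. f n * g n \<in> T" using f(1) g(1) Tmult by blast
    then show ?thesis unfolding closure_sequential
      using tendsto_mult[OF f(2) g(2)] by (intro exI[of _ "\<lambda>n. f n * g n"] conjI)
  qed
  have Dadj: "adj x \<in> ?D" if "x \<in> ?D" for x
    using closure_invariant[OF bounded_linear_adj _ that] T1(1) sub by blast
  have Dscale: "k *\<^sub>C x \<in> ?D" if x: "x \<in> ?D" for k x
  proof -
    have "q *\<^sub>C x \<in> ?D" if "q \<in> Q" for q
      using closure_invariant[OF bounded_linear_scaleC _ x] T1(2) sub that by blast
    then have "(\<lambda>k. k *\<^sub>C x) ` closure Q \<subseteq> ?D"
      by (intro image_closure_subset linear_continuous_on[OF bounded_linear_scaleC_left]) auto
    then show ?thesis using Q(2) by auto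
  qed
  have D\<alpha>: "\<alpha> g x \<in> ?D" if g: "g \<in> carrier G" and x: "x \<in> ?D" for g x
  proof (rule closure_invariant[OF _ _ x])
    show "bounded_linear (\<alpha> g)"
      using c g by (simp add: cocycle_action_def star_automorphism_bounded_linear(1))
  qed (use T1(3) g sub in blast)
  have Dw: "mult_left (w g h) x \<in> ?D \<and> mult_right x (w g h) \<in> ?D"
    if gh: "g \<in> carrier G" "h \<in> carrier G" and x: "x \<in> ?D" for g h x
  proof -
    have "w g h \<in> multipliers"
      using c gh by (simp add: cocycle_action_def unitary_multipliers_def)
    then have bl: "bounded_linear (mult_left (w g h))" "bounded_linear (\<lambda>x. mult_right x (w g h))"
      by (auto simp: multipliers_def split: prod.splits)
    show ?thesis
      using closure_invariant[OF bl(1) _ x] closure_invariant[OF bl(2) _ x] T1(4) gh sub by blast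
  qed
  have "separable_space (top_of_set ?D)"
    unfolding separable_space_def
    using Tc closure_subset[of T] by (intro exI[of _ T]) (auto simp: closure_of_subtopology inf.absorb2)
  then have "admissible_subalgebra G \<alpha> w ?D"
    unfolding admissible_subalgebra_def cstar_subalgebra_def
    using Dadd Dmult Dadj Dscale D\<alpha> Dw sub[OF T0] by auto
  moreover have "S \<subseteq> ?D" using sub by (force simp: T_def intro: exI[of _ 0])
  ultimately show ?thesis by blast
qed


section \<open>From amenability dimension to Rokhlin towers\<close>

lemma (in group) sum_over_lcosets:
  assumes H: "subgroup H G" "finite (lcosets H)" and S: "finite S" "S \<subseteq> carrier G"
  shows "(\<Sum>X\<in>lcosets H. \<Sum>g\<in>{g \<in> S. g <# H = X}. f g) = (\<Sum>g\<in>S. f g)"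
  using S H(2) lcosets_memI by (intro sum.group) auto

lemma (in group) lcoset_eq_iff_mem:
  assumes "subgroup H G" "X \<in> lcosets H" "g \<in> carrier G"
  shows "g <# H = X \<longleftrightarrow> g \<in> X"
  using lcos_self[OF assms(3,1)] lcosets_eq_lcoset[OF assms(1,2)] by metis

lemma tendsto_zero_if_norm_le_inverse:
  fixes f :: "nat \<Rightarrow> 'a::real_normed_vector"
  assumes "\<And>n. k \<le> n \<Longrightarrow> norm (f n) \<le> inverse (real (Suc n))"
  shows "f \<longlonglongrightarrow> 0"
  by (rule Lim_null_comparison[OF _ LIMSEQ_inverse_real_of_nat])
     (use assms in \<open>auto simp: eventually_sequentially\<close>)

text \<open>The \<open>n\<close>-th witness serves the first \<open>n + 1\<close> terms of a dense
  sequence in \<open>D\<close> and of an enumeration of the group, with tolerance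
  \<open>1 / (n + 1)\<close>. Boundedness of the towers then extends the limits to all of
  \<open>D\<close>.\<close>

theorem am_dim_le_imp_towers:
  fixes G :: "('g, 'm) monoid_scheme" and \<alpha> :: "'g \<Rightarrow> 'a::cstar_algebra \<Rightarrow> 'a"
  assumes G: "group G" "countable (carrier G)" and H: "finite_index_subgroup G H"
    and \<alpha>: "\<And>g. g \<in> carrier G \<Longrightarrow> star_automorphism (\<alpha> g)" and am: "am_dim_le G \<alpha> d"
    and D: "separable_space (top_of_set D)" "D \<noteq> {}"
  shows "\<exists>e. rokhlin_towers G \<alpha> D H d e"
proof -
  interpret group G by fact
  define L where "L = lcosets\<^bsub>G\<^esub> H"
  have L: "finite L" and sub: "subgroup H G" using H by (auto simp: L_def finite_index_subgroup_def)
  have LX: "X \<subseteq> carrier G" if "X \<in> L" for X using lcosets_subset_carrier[OF sub] that by (simp add: L_def)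
  obtain c :: "nat \<Rightarrow> 'a" where c: "range c \<subseteq> D" "D \<subseteq> closure (range c)"
    by (rule separable_dense_sequence[OF D]) (rule that)
  define gs where "gs = from_nat_into (carrier G)"
  have gs: "range gs = carrier G" unfolding gs_def using G(2) one_closed by (intro range_from_nat_into) auto
  define P where "P n \<mu> \<longleftrightarrow>
          (\<forall>l\<le>d. finite {g \<in> carrier G. \<mu> l g \<noteq> 0} \<and> (\<forall>g\<in>carrier G. positive_contraction (\<mu> l g))) \<and>
          (\<forall>a\<in>c ` {..n}. norm ((\<Sum>l\<le>d. \<Sum>g\<in>{g \<in> carrier G. \<mu> l g \<noteq> 0}. \<mu> l g) * a - a) \<le> inverse (real (Suc n))) \<and>
          (\<forall>l\<le>d. \<forall>g\<in>carrier G. \<forall>h\<in>carrier G. g \<noteq> h \<longrightarrow> \<mu> l g * \<mu> l h = 0) \<and>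
          (\<forall>a\<in>c ` {..n}. \<forall>l\<le>d. \<forall>g\<in>gs ` {..n}. \<forall>E. E \<subseteq> carrier G \<and> finite E \<longrightarrow>
             norm ((\<Sum>h\<in>E. \<alpha> g (\<mu> l h) - \<mu> l (g \<otimes>\<^bsub>G\<^esub> h)) * a) \<le> inverse (real (Suc n))) \<and>
          (\<forall>a\<in>c ` {..n}. \<forall>l\<le>d. \<forall>E. E \<subseteq> carrier G \<and> finite E \<longrightarrow>
             norm ((\<Sum>g\<in>E. \<mu> l g) * a - a * (\<Sum>g\<in>E. \<mu> l g)) \<le> inverse (real (Suc n)))"
    for n and \<mu> :: "nat \<Rightarrow> 'g \<Rightarrow> 'a"
  have "\<exists>\<mu>. P n \<mu>" for n
  proof -
    have "inverse (real (Suc n)) > 0" "gs ` {..n} \<subseteq> carrier G \<and> finite (gs ` {..n}) \<and> finite (c ` {..n})"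
      using gs by auto
    from am[unfolded am_dim_le_def, rule_format, OF this] show ?thesis unfolding P_def .
  qed
  then have "\<forall>n. \<exists>\<mu>. P n \<mu>" ..
  from choice[OF this] obtain \<mu> where \<mu>: "\<forall>n. P n (\<mu> n)" ..
  note \<mu>' = \<mu>[unfolded P_def, THEN spec]
  note \<mu>1 = conjunct1[OF \<mu>'] and \<mu>'' = conjunct2[OF \<mu>']
  note \<mu>2 = conjunct1[OF \<mu>''] and \<mu>''' = conjunct2[OF \<mu>'']
  note \<mu>3 = conjunct1[OF \<mu>'''] and \<mu>4 = conjunct1[OF conjunct2[OF \<mu>''']]
    and \<mu>5 = conjunct2[OF conjunct2[OF \<mu>''']]
  have fin: "finite {g \<in> carrier G. \<mu> n l g \<noteq> 0}" if "l \<le> d" for n l using \<mu>1[of n] that by blast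
  have pc: "positive_contraction (\<mu> n l g)" if "l \<le> d" "g \<in> carrier G" for n l g using \<mu>1[of n] that by blast
  have orth: "\<mu> n l g * \<mu> n l h = 0" if "l \<le> d" "g \<in> carrier G" "h \<in> carrier G" "g \<noteq> h" for n l g h
    using \<mu>3[of n] that by blast
  have unit: "norm ((\<Sum>l\<le>d. \<Sum>g\<in>{g \<in> carrier G. \<mu> n l g \<noteq> 0}. \<mu> n l g) * c k - c k) \<le> inverse (real (Suc n))"
    if "k \<le> n" for n k using \<mu>2[of n] that by auto
  have equiv: "norm ((\<Sum>h\<in>E. \<alpha> (gs j) (\<mu> n l h) - \<mu> n l (gs j \<otimes>\<^bsub>G\<^esub> h)) * c k) \<le> inverse (real (Suc n))"
    if "k \<le> n" "j \<le> n" "l \<le> d" "E \<subseteq> carrier G" "finite E" for n k j l E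
    using \<mu>4[of n] that by blast
  have comm: "norm ((\<Sum>g\<in>E. \<mu> n l g) * c k - c k * (\<Sum>g\<in>E. \<mu> n l g)) \<le> inverse (real (Suc n))"
    if "k \<le> n" "l \<le> d" "E \<subseteq> carrier G" "finite E" for n k l E
    using \<mu>5[of n] that by blast
  define E where "E n l X = {g \<in> X. \<mu> n l g \<noteq> 0}" for n l X
  have E: "finite (E n l X)" "E n l X \<subseteq> carrier G" if "l \<le> d" "X \<in> L" for n l X
    using LX[OF that(2)] by (auto simp: E_def intro: finite_subset[OF _ fin[OF that(1), of n]])
  define e where "e l X n = (\<Sum>g\<in>E n l X. \<mu> n l g)" for l X n
  have sa: "adj (\<mu> n l g) = \<mu> n l g" "norm (\<mu> n l g) \<le> 1" if "l \<le> d" "g \<in> carrier G" for n l g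
    using pc[OF that, of n] positive_elem_selfadj by (auto simp: positive_contraction_def)
  have epc: "positive_contraction (e l X n)" if lX: "l \<le> d" "X \<in> L" for l X n
    unfolding positive_contraction_def e_def
  proof
    show "positive_elem (\<Sum>g\<in>E n l X. \<mu> n l g)"
      using pc[OF lX(1)] subsetD[OF E(2)[OF lX]]
      by (intro positive_elem_sum) (auto simp: positive_contraction_def)
    show "norm (\<Sum>g\<in>E n l X. \<mu> n l g) \<le> 1"
      using E[OF lX, of n] lX by (intro norm_sum_orthogonal_le) (auto intro!: sa orth)
  qed
  have eo: "e l X n * e l Y n = 0" if lXY: "l \<le> d" "X \<in> L" "Y \<in> L" "X \<noteq> Y" for l X Y n
  proof -
    have "X \<inter> Y = {}" using lcos_disjoint[OF sub] lXY by (auto simp: L_def)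
    then have "g \<noteq> h" if "g \<in> E n l X" "h \<in> E n l Y" for g h using that by (auto simp: E_def)
    then have "\<mu> n l g * \<mu> n l h = 0" if "g \<in> E n l X" "h \<in> E n l Y" for g h
      using that E(2)[OF lXY(1,2)] E(2)[OF lXY(1,3)] orth[OF lXY(1)] by blast
    then show ?thesis unfolding e_def sum_product by (intro sum.neutral ballI)
  qed
  have e1: "norm (e l X n) \<le> 1" if "l \<le> d" "X \<in> L" for l X n
    using epc[OF that] by (simp add: positive_contraction_def)
  have ecomm: "(\<lambda>n. e l X n * a - a * e l X n) \<longlonglongrightarrow> 0" if lX: "l \<le> d" "X \<in> L" and a: "a \<in> D" for l X a
  proof (rule commutator_tendsto_dense[OF e1[OF lX] _ subsetD[OF c(2) a]])
    fix b assume "b \<in> range c"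
    then obtain k where "b = c k" by blast
    then show "(\<lambda>n. e l X n * b - b * e l X n) \<longlonglongrightarrow> 0"
      unfolding e_def using comm[OF _ lX(1) E(2,1)[OF lX]]
      by (intro tendsto_zero_if_norm_le_inverse[of k]) simp
  qed
  \<comment> \<open>\<open>F\<close> contains the support in \<open>X\<close> and the translate back
    to \<open>X\<close> of the support in the coset of \<open>g\<close>. Almost equivariance for
    this one finite set is exactly the defect of the tower.\<close>
  have move: "(\<Sum>h\<in>F. \<alpha> g (\<mu> n l h) - \<mu> n l (g \<otimes>\<^bsub>G\<^esub> h)) = \<alpha> g (e l X n) - e l (g <#\<^bsub>G\<^esub> X) n"
    if lX: "l \<le> d" "X \<in> L" and g: "g \<in> carrier G" and F: "F = E n l X \<union> (\<lambda>k. inv\<^bsub>G\<^esub> g \<otimes>\<^bsub>G\<^esub> k) ` E n l (g <#\<^bsub>G\<^esub> X)"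
    for l X n g F
  proof -
    have gX: "g <#\<^bsub>G\<^esub> X \<in> L" using lcoset_action(1)[OF G(1) sub g] lX(2) by (simp add: L_def)
    note E' = E[OF lX, of n] E[OF lX(1) gX, of n]
    have "inv\<^bsub>G\<^esub> g \<otimes>\<^bsub>G\<^esub> k \<in> X" if "k \<in> g <#\<^bsub>G\<^esub> X" for k
      using that g LX[OF lX(2)] by (auto simp: l_coset_def m_assoc[symmetric])
    then have FX: "F \<subseteq> X" unfolding F by (auto simp: E_def)
    have Ff: "finite F" unfolding F using E' by simp
    have "\<alpha> g (\<Sum>h\<in>F. \<mu> n l h) = (\<Sum>h\<in>F. \<alpha> g (\<mu> n l h))"
      using linear_sum[OF bounded_linear.linear[OF star_automorphism_bounded_linear(1)[OF \<alpha>[OF g]]]] .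
    moreover have "(\<Sum>h\<in>F. \<mu> n l h) = e l X n"
      unfolding e_def by (rule sum.mono_neutral_right[OF Ff]) (use FX F in \<open>auto simp: E_def\<close>)
    moreover have "(\<Sum>h\<in>F. \<mu> n l (g \<otimes>\<^bsub>G\<^esub> h)) = e l (g <#\<^bsub>G\<^esub> X) n"
    proof -
      have inj: "inj_on (\<lambda>h. g \<otimes>\<^bsub>G\<^esub> h) F"
      proof (rule inj_onI)
        fix x y assume "x \<in> F" "y \<in> F" and eq: "g \<otimes>\<^bsub>G\<^esub> x = g \<otimes>\<^bsub>G\<^esub> y"
        then have "x \<in> carrier G" "y \<in> carrier G" using FX LX[OF lX(2)] by blast+
        with eq g show "x = y" by simp
      qed
      have "(\<Sum>h\<in>F. \<mu> n l (g \<otimes>\<^bsub>G\<^esub> h)) = (\<Sum>k\<in>(\<lambda>h. g \<otimes>\<^bsub>G\<^esub> h) ` F. \<mu> n l k)"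
        by (simp add: sum.reindex[OF inj])
      also have "\<dots> = (\<Sum>k\<in>E n l (g <#\<^bsub>G\<^esub> X). \<mu> n l k)"
      proof (rule sum.mono_neutral_right)
        show "E n l (g <#\<^bsub>G\<^esub> X) \<subseteq> (\<lambda>h. g \<otimes>\<^bsub>G\<^esub> h) ` F"
        proof
          fix k assume k: "k \<in> E n l (g <#\<^bsub>G\<^esub> X)"
          then have "k = g \<otimes>\<^bsub>G\<^esub> (inv\<^bsub>G\<^esub> g \<otimes>\<^bsub>G\<^esub> k)" using E'(4) g by (auto simp: m_assoc[symmetric])
          then show "k \<in> (\<lambda>h. g \<otimes>\<^bsub>G\<^esub> h) ` F" using k unfolding F by blast
        qed
        show "\<forall>k\<in>(\<lambda>h. g \<otimes>\<^bsub>G\<^esub> h) ` F - E n l (g <#\<^bsub>G\<^esub> X). \<mu> n l k = 0"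
          using FX by (auto simp: E_def l_coset_def)
      qed (use Ff in simp)
      finally show ?thesis by (simp add: e_def)
    qed
    ultimately show ?thesis by (simp add: sum_subtractf)
  qed
  have eequiv: "(\<lambda>n. (\<alpha> g (e l X n) - e l (g <#\<^bsub>G\<^esub> X) n) * a) \<longlonglongrightarrow> 0"
    if lX: "l \<le> d" "X \<in> L" and g: "g \<in> carrier G" and a: "a \<in> D" for l X g a
  proof (rule mult_tendsto_dense[OF _ _ subsetD[OF c(2) a]])
    have gX: "g <#\<^bsub>G\<^esub> X \<in> L" using lcoset_action(1)[OF G(1) sub g] lX(2) by (simp add: L_def)
    fix n
    show "norm (\<alpha> g (e l X n) - e l (g <#\<^bsub>G\<^esub> X) n) \<le> 1 + 1"
      using star_automorphism_bounded_linear(2)[OF \<alpha>[OF g], of "e l X n"] e1[OF lX, of n] e1[OF lX(1) gX, of n]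
        norm_triangle_ineq4[of "\<alpha> g (e l X n)" "e l (g <#\<^bsub>G\<^esub> X) n"] by linarith
  next
    have gX: "g <#\<^bsub>G\<^esub> X \<in> L" using lcoset_action(1)[OF G(1) sub g] lX(2) by (simp add: L_def)
    fix b assume "b \<in> range c"
    then obtain k where k: "b = c k" by blast
    obtain j where j: "g = gs j" using g gs by blast
    show "(\<lambda>n. (\<alpha> g (e l X n) - e l (g <#\<^bsub>G\<^esub> X) n) * b) \<longlonglongrightarrow> 0"
    proof (rule tendsto_zero_if_norm_le_inverse[of "max k j"])
      fix n assume n: "max k j \<le> n"
      let ?F = "E n l X \<union> (\<lambda>k. inv\<^bsub>G\<^esub> g \<otimes>\<^bsub>G\<^esub> k) ` E n l (g <#\<^bsub>G\<^esub> X)"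
      have "?F \<subseteq> carrier G" "finite ?F" using E[OF lX, of n] E[OF lX(1) gX, of n] g by auto
      from equiv[OF _ _ lX(1) this, of k n j] n
      have "norm ((\<Sum>h\<in>?F. \<alpha> g (\<mu> n l h) - \<mu> n l (g \<otimes>\<^bsub>G\<^esub> h)) * b) \<le> inverse (real (Suc n))"
        by (simp add: k flip: j)
      then show "norm ((\<alpha> g (e l X n) - e l (g <#\<^bsub>G\<^esub> X) n) * b) \<le> inverse (real (Suc n))"
        by (simp only: move[OF lX g refl])
    qed
  qed
  have eunit: "(\<lambda>n. (\<Sum>l\<le>d. \<Sum>X\<in>L. e l X n) * a - a) \<longlonglongrightarrow> 0" if a: "a \<in> D" for a
  proof (rule unit_tendsto_dense[OF _ _ subsetD[OF c(2) a]])
    fix n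
    have "norm (\<Sum>l\<le>d. \<Sum>X\<in>L. e l X n) \<le> (\<Sum>l\<le>d. \<Sum>X\<in>L. 1)"
      by (intro order_trans[OF norm_sum] sum_mono e1) auto
    then show "norm (\<Sum>l\<le>d. \<Sum>X\<in>L. e l X n) \<le> (\<Sum>l\<le>d. \<Sum>X\<in>L. 1)" .
  next
    fix b assume "b \<in> range c"
    then obtain k where k: "b = c k" by blast
    have "(\<Sum>X\<in>L. e l X n) = (\<Sum>g\<in>{g \<in> carrier G. \<mu> n l g \<noteq> 0}. \<mu> n l g)" if l: "l \<le> d" for l n
    proof -
      have "{g \<in> {g \<in> carrier G. \<mu> n l g \<noteq> 0}. g <#\<^bsub>G\<^esub> H = X} = E n l X" if "X \<in> L" for X
        using lcoset_eq_iff_mem[OF sub that[unfolded L_def]] LX[OF that] by (auto simp: E_def)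
      then show ?thesis
        using sum_over_lcosets[OF sub L[unfolded L_def] fin[OF l, of n], of "\<mu> n l"]
        by (simp add: e_def flip: L_def)
    qed
    then show "(\<lambda>n. (\<Sum>l\<le>d. \<Sum>X\<in>L. e l X n) * b - b) \<longlonglongrightarrow> 0"
      unfolding k using unit by (intro tendsto_zero_if_norm_le_inverse[of k]) simp
  qed
  have "rokhlin_towers G \<alpha> D H d e"
    unfolding rokhlin_towers_def L_def[symmetric] using epc eo ecomm eequiv eunit by simp
  then show ?thesis by blast
qed


section \<open>From Rokhlin towers to amenability dimension\<close>

text \<open>Pairs of colours are numbered by \<open>l * Suc s + j\<close>, with largest number
  \<open>d * Suc s + s\<close>.\<close>

lemma sum_colours:
  fixes f :: "nat \<Rightarrow> nat \<Rightarrow> 'a::comm_monoid_add"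
  shows "(\<Sum>m\<le>d * Suc s + s. f (m div Suc s) (m mod Suc s)) = (\<Sum>l\<le>d. \<Sum>j\<le>s. f l j)"
proof -
  have "(\<Sum>l\<le>d. \<Sum>j\<le>s. f l j) = (\<Sum>(l, j)\<in>{..d} \<times> {..s}. f l j)" by (rule sum.cartesian_product)
  also have "\<dots> = (\<Sum>m\<le>d * Suc s + s. f (m div Suc s) (m mod Suc s))"
  proof (rule sum.reindex_bij_witness[where i = "\<lambda>m. (m div Suc s, m mod Suc s)" and j = "\<lambda>(l, j). l * Suc s + j"])
    fix m assume "m \<in> {..d * Suc s + s}"
    then have "m < Suc d * Suc s" by simp
    then have "m div Suc s < Suc d" by (rule less_mult_imp_div_less)
    then show "(m div Suc s, m mod Suc s) \<in> {..d} \<times> {..s}" by (simp add: less_Suc_eq_le[symmetric])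
    show "(case (m div Suc s, m mod Suc s) of (l, j) \<Rightarrow> l * Suc s + j) = m"
      by (simp only: prod.case div_mult_mod_eq)
  next
    fix p assume "p \<in> {..d} \<times> {..s}"
    then obtain l j where p: "p = (l, j)" "l \<le> d" "j < Suc s" by auto
    have "l * Suc s \<le> d * Suc s" using p by (intro mult_le_mono1)
    then show "(case p of (l, j) \<Rightarrow> l * Suc s + j) \<in> {..d * Suc s + s}"
      using p by (simp only: prod.case atMost_iff)
    have dm: "(l * Suc s + j) div Suc s = l" "(l * Suc s + j) mod Suc s = j"
      using p by (simp_all only: div_mult_self3 mod_mult_self3 div_less mod_less add_0_right Suc_neq_Zero not_False_eq_True)
    show "((case p of (l, j) \<Rightarrow> l * Suc s + j) div Suc s, (case p of (l, j) \<Rightarrow> l * Suc s + j) mod Suc s) = p"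
      using dm by (simp only: p prod.case)
    show "f ((case p of (l, j) \<Rightarrow> l * Suc s + j) div Suc s) ((case p of (l, j) \<Rightarrow> l * Suc s + j) mod Suc s)
        = (case p of (l, j) \<Rightarrow> f l j)"
      using dm by (simp only: p prod.case)
  qed
  finally show ?thesis ..
qed

theorem (in proper_metric_group) rokhlin_dim_imp_am_dim_le:
  fixes \<alpha> :: "'g \<Rightarrow> 'a::cstar_algebra \<Rightarrow> 'a"
  assumes \<sigma>: "regular_approximation G \<sigma>" and dB: "box_space_metric G d \<sigma> dB"
    and asd: "asdim_le (box_space G \<sigma>) dB s" and cG: "countable (carrier G)"
    and c: "cocycle_action G \<alpha> w"
    and R: "\<And>H. finite_index_subgroup G H \<Longrightarrow> \<exists>q\<le>p. rokhlin_dim_le G \<alpha> w H q"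
  shows "am_dim_le G \<alpha> (p * Suc s + s)"
  unfolding am_dim_le_def
proof (intro allI impI)
  fix \<epsilon> :: real and M and F :: "'a set"
  assume \<epsilon>: "\<epsilon> > 0" and "M \<subseteq> carrier G \<and> finite M \<and> finite F"
  then have M: "finite M" "M \<subseteq> carrier G" and F: "finite F" by auto
  have \<alpha>: "star_automorphism (\<alpha> g)" if "g \<in> carrier G" for g
    using c that by (simp add: cocycle_action_def)
  obtain D where D: "admissible_subalgebra G \<alpha> w D" "F \<subseteq> D"
    using exists_admissible_subalgebra[OF cG c countable_finite[OF F]] by blast
  \<comment> \<open>Bounds the norms on \<open>F\<close>; the summand 1 permits division by
    \<open>K\<close>.\<close>
  define K where "K = 1 + (\<Sum>a\<in>F. norm a)"
  have K: "K \<ge> 1" by (simp add: K_def sum_nonneg)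
  have FK: "norm a \<le> K" if "a \<in> F" for a
    using member_le_sum[OF that, of norm] F by (simp add: K_def)
  \<comment> \<open>Two such errors per coset, multiplied by an element of norm at most
    \<open>K\<close>, give \<open>\<epsilon> / 2\<close>.\<close>
  have "\<epsilon> / (4 * K) > 0" using \<epsilon> K by simp
  note pos = this
  obtain n and \<nu> :: "nat \<Rightarrow> 'g \<Rightarrow> real" where \<nu>:
    "\<And>l g. 0 \<le> \<nu> l g" "\<And>l g. \<nu> l g \<le> 1" "\<And>l. finite {g \<in> carrier G. \<nu> l g \<noteq> 0}"
    "\<And>l g h. g \<in> carrier G \<Longrightarrow> h \<in> carrier G \<Longrightarrow> g <# \<sigma> n = h <# \<sigma> n \<Longrightarrow>
       \<nu> l g \<noteq> 0 \<Longrightarrow> \<nu> l h \<noteq> 0 \<Longrightarrow> g = h"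
    "\<And>X. X \<in> lcosets (\<sigma> n) \<Longrightarrow> (\<Sum>l\<le>s. \<Sum>g\<in>{g \<in> X. \<nu> l g \<noteq> 0}. \<nu> l g) = 1"
    "\<And>l k g. k \<in> M \<Longrightarrow> g \<in> carrier G \<Longrightarrow> \<bar>\<nu> l g - \<nu> l (k \<otimes> g)\<bar> \<le> \<epsilon> / (4 * K)"
  proof (rule box_partition_of_unity[OF \<sigma> dB asd M pos], goal_cases)
    case (1 n \<nu>)
    from 1(2-) show ?case by (rule 1(1))
  qed
  define H where "H = \<sigma> n"
  have H: "finite_index_subgroup G H" using \<sigma> by (simp add: H_def regular_approximation_def)
  define L where "L = lcosets H"
  have L: "finite L" and sub: "subgroup H G" using H by (auto simp: L_def finite_index_subgroup_def)
  have LX: "X \<subseteq> carrier G" if "X \<in> L" for X using lcosets_subset_carrier[OF sub] that by (simp add: L_def)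
  have gL: "g <# H \<in> L" if "g \<in> carrier G" for g using lcosets_memI[OF that] by (simp add: L_def)
  obtain q where q: "q \<le> p" "rokhlin_dim_le G \<alpha> w H q" using R[OF H] by blast
  obtain e where e: "rokhlin_towers G \<alpha> D H q e"
    using rokhlin_dim_le_imp_towers[OF is_group H D(1) \<alpha> q(2)] by blast
  note tow = rokhlin_towersD[OF e, folded L_def]
  define T where "T j = {g \<in> carrier G. \<nu> j g \<noteq> 0}" for j
  have T: "finite (T j)" for j unfolding T_def by (rule \<nu>(3))
  define N where "N = (\<Sum>j\<le>s. real (card (T j))) + 1"
  have N1: "N \<ge> 1" by (simp add: N_def sum_nonneg)
  have TN: "real (card (T j)) \<le> N" if "j \<le> s" for j
    using member_le_sum[of j "{..s}" "\<lambda>j. real (card (T j))"] that by (simp add: N_def)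
  \<comment> \<open>Tower errors are added over at most \<open>N\<close> points, giving
    \<open>\<epsilon> / 4\<close>. Dependence on \<open>n\<close> is harmless, as the position
    \<open>i\<close> in the towers is chosen afterwards.\<close>
  define \<eta> where "\<eta> = \<epsilon> / (4 * N)"
  have \<eta>: "\<eta> > 0" using \<epsilon> N1 by (simp add: \<eta>_def)
  have small: "\<forall>\<^sub>F i in sequentially. norm (x i) \<le> r" if "x \<longlonglongrightarrow> 0" "r > 0" for x :: "nat \<Rightarrow> 'a" and r
    using tendstoD[OF that] by (auto elim: eventually_mono)
  have "\<forall>\<^sub>F i in sequentially. \<forall>a\<in>F. norm ((\<Sum>l\<le>q. \<Sum>X\<in>L. e l X i) * a - a) \<le> \<epsilon>"
    using D(2) \<epsilon> by (intro eventually_ball_finite[OF F] ballI small tow(5)) auto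
  moreover have "\<forall>\<^sub>F i in sequentially. \<forall>a\<in>F. \<forall>l\<in>{..q}. \<forall>X\<in>L. norm (e l X i * a - a * e l X i) \<le> \<eta>"
    using D(2) \<eta> by (intro eventually_ball_finite[OF F] eventually_ball_finite[OF finite_atMost]
        eventually_ball_finite[OF L] ballI small tow(3)) auto
  moreover have "\<forall>\<^sub>F i in sequentially. \<forall>a\<in>F. \<forall>l\<in>{..q}. \<forall>X\<in>L. \<forall>g\<in>M.
      norm ((\<alpha> g (e l X i) - e l (g <# X) i) * a) \<le> \<eta>"
    using D(2) \<eta> M(2) by (intro eventually_ball_finite[OF F] eventually_ball_finite[OF finite_atMost]
        eventually_ball_finite[OF L] eventually_ball_finite[OF M(1)] ballI small tow(4)) auto
  ultimately have "\<forall>\<^sub>F i in sequentially. (\<forall>a\<in>F. norm ((\<Sum>l\<le>q. \<Sum>X\<in>L. e l X i) * a - a) \<le> \<epsilon>) \<and>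
      (\<forall>a\<in>F. \<forall>l\<in>{..q}. \<forall>X\<in>L. norm (e l X i * a - a * e l X i) \<le> \<eta>) \<and>
      (\<forall>a\<in>F. \<forall>l\<in>{..q}. \<forall>X\<in>L. \<forall>g\<in>M. norm ((\<alpha> g (e l X i) - e l (g <# X) i) * a) \<le> \<eta>)"
    by (intro eventually_conj)
  from eventually_happens'[OF sequentially_bot this] obtain i where
    i: "(\<forall>a\<in>F. norm ((\<Sum>l\<le>q. \<Sum>X\<in>L. e l X i) * a - a) \<le> \<epsilon>) \<and>
      (\<forall>a\<in>F. \<forall>l\<in>{..q}. \<forall>X\<in>L. norm (e l X i * a - a * e l X i) \<le> \<eta>) \<and>
      (\<forall>a\<in>F. \<forall>l\<in>{..q}. \<forall>X\<in>L. \<forall>g\<in>M. norm ((\<alpha> g (e l X i) - e l (g <# X) i) * a) \<le> \<eta>)" ..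
  then have i1: "\<And>a. a \<in> F \<Longrightarrow> norm ((\<Sum>l\<le>q. \<Sum>X\<in>L. e l X i) * a - a) \<le> \<epsilon>"
    and i2: "\<And>a l X. a \<in> F \<Longrightarrow> l \<le> q \<Longrightarrow> X \<in> L \<Longrightarrow> norm (e l X i * a - a * e l X i) \<le> \<eta>"
    and i3: "\<And>a l X g. a \<in> F \<Longrightarrow> l \<le> q \<Longrightarrow> X \<in> L \<Longrightarrow> g \<in> M \<Longrightarrow>
      norm ((\<alpha> g (e l X i) - e l (g <# X) i) * a) \<le> \<eta>"
    by simp_all
  define E where "E l X = e l X i" for l X
  have Ep: "positive_elem (E l X)" "norm (E l X) \<le> 1" "adj (E l X) = E l X" if "l \<le> q" "X \<in> L" for l X
    using tow(1)[OF that, of i] positive_elem_selfadj by (auto simp: E_def positive_contraction_def)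
  have Eo: "E l X * E l Y = 0" if "l \<le> q" "X \<in> L" "Y \<in> L" "X \<noteq> Y" for l X Y
    using tow(2)[OF that] by (simp add: E_def)
  \<comment> \<open>The dimension \<open>q\<close> depends on \<open>H\<close>; the colours from
    \<open>q + 1\<close> up to the uniform bound \<open>p\<close> are filled with zero.\<close>
  define \<kappa> where "\<kappa> l j g = (if l \<le> q \<and> g \<in> carrier G then \<nu> j g *\<^sub>R E l (g <# H) else 0)" for l j g
  have supp: "{g \<in> carrier G. \<kappa> l j g \<noteq> 0} \<subseteq> T j" for l j by (auto simp: \<kappa>_def T_def)
  have \<kappa>fin: "finite {g \<in> carrier G. \<kappa> l j g \<noteq> 0}" for l j using supp T by (rule finite_subset)
  have \<kappa>pc: "positive_contraction (\<kappa> l j g)" if g: "g \<in> carrier G" for l j g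
  proof (cases "l \<le> q")
    case True
    have "\<nu> j g * norm (E l (g <# H)) \<le> 1 * 1"
      using \<nu>(1,2) Ep(2)[OF True gL[OF g]] by (intro mult_mono) auto
    then show ?thesis
      using Ep(1)[OF True gL[OF g]] g True \<nu>(1)[of j g]
      by (simp add: \<kappa>_def positive_contraction_def positive_elem_scaleR)
  qed (simp add: \<kappa>_def positive_contraction_def positive_elem_0)
  have \<kappa>o: "\<kappa> l j g * \<kappa> l j h = 0" if gh: "g \<in> carrier G" "h \<in> carrier G" "g \<noteq> h" for l j g h
  proof (cases "l \<le> q")
    case True
    show ?thesis
    proof (cases "g <# H = h <# H")
      case eq: True
      have "\<nu> j g = 0 \<or> \<nu> j h = 0" using \<nu>(4)[OF gh(1,2) eq[unfolded H_def]] gh(3) by blast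
      then show ?thesis by (auto simp: \<kappa>_def)
    next
      case False
      then show ?thesis using Eo[OF True gL gL] gh by (simp add: \<kappa>_def)
    qed
  qed (simp add: \<kappa>_def)
  have \<kappa>sum: "(\<Sum>j\<le>s. \<Sum>g\<in>{g \<in> carrier G. \<kappa> l j g \<noteq> 0}. \<kappa> l j g) = (if l \<le> q then \<Sum>X\<in>L. E l X else 0)" for l
  proof (cases "l \<le> q")
    case True
    have "(\<Sum>g\<in>{g \<in> carrier G. \<kappa> l j g \<noteq> 0}. \<kappa> l j g) =
        (\<Sum>X\<in>L. (\<Sum>g\<in>{g \<in> X. \<nu> j g \<noteq> 0}. \<nu> j g) *\<^sub>R E l X)" for j
    proof -
      have "(\<Sum>g\<in>{g \<in> carrier G. \<kappa> l j g \<noteq> 0}. \<kappa> l j g) = (\<Sum>g\<in>T j. \<kappa> l j g)"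
        using supp by (intro sum.mono_neutral_left T) (auto simp: T_def)
      also have "\<dots> = (\<Sum>X\<in>L. \<Sum>g\<in>{g \<in> T j. g <# H = X}. \<kappa> l j g)"
        using sum_over_lcosets[OF sub L[unfolded L_def] T[of j], of "\<kappa> l j"] by (simp add: T_def L_def)
      also have "\<dots> = (\<Sum>X\<in>L. (\<Sum>g\<in>{g \<in> X. \<nu> j g \<noteq> 0}. \<nu> j g) *\<^sub>R E l X)"
      proof (rule sum.cong[OF refl])
        fix X assume X: "X \<in> L"
        have "{g \<in> T j. g <# H = X} = {g \<in> X. \<nu> j g \<noteq> 0}"
          using lcoset_eq_iff_mem[OF sub X[unfolded L_def]] LX[OF X] by (auto simp: T_def)
        moreover have "\<kappa> l j g = \<nu> j g *\<^sub>R E l X" if "g \<in> X" for g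
          using that True LX[OF X] lcosets_eq_lcoset[OF sub X[unfolded L_def] that] by (auto simp: \<kappa>_def)
        ultimately show "(\<Sum>g\<in>{g \<in> T j. g <# H = X}. \<kappa> l j g) = (\<Sum>g\<in>{g \<in> X. \<nu> j g \<noteq> 0}. \<nu> j g) *\<^sub>R E l X"
          by (simp add: scaleR_left.sum)
      qed
      finally show ?thesis .
    qed
    then have "(\<Sum>j\<le>s. \<Sum>g\<in>{g \<in> carrier G. \<kappa> l j g \<noteq> 0}. \<kappa> l j g) =
        (\<Sum>X\<in>L. (\<Sum>j\<le>s. \<Sum>g\<in>{g \<in> X. \<nu> j g \<noteq> 0}. \<nu> j g) *\<^sub>R E l X)"
      by (simp add: scaleR_left.sum) (rule sum.swap)
    then show ?thesis using \<nu>(5) True by (simp add: L_def H_def)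
  qed (simp add: \<kappa>_def)
  have colour: "m mod Suc s \<le> s" for m using mod_less_divisor[of "Suc s" m] by linarith
  have sumT: "(\<Sum>h\<in>A. \<nu> j h * r) \<le> N * r" if A: "finite A" "A \<subseteq> carrier G" and j: "j \<le> s" and r: "0 \<le> r" for A j r
  proof -
    have "(\<Sum>h\<in>A. \<nu> j h) = (\<Sum>h\<in>A \<inter> T j. \<nu> j h)"
      using A by (intro sum.mono_neutral_right) (auto simp: T_def)
    also have "\<dots> \<le> (\<Sum>h\<in>A \<inter> T j. 1)" by (intro sum_mono \<nu>(2))
    also have "\<dots> \<le> real (card (T j))" using card_mono[OF T[of j], of "A \<inter> T j"] by simp
    also have "\<dots> \<le> N" by (rule TN[OF j])
    finally show ?thesis using r by (simp add: mult_right_mono flip: sum_distrib_right)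
  qed
  have N\<eta>: "N * \<eta> = \<epsilon> / 4" using N1 by (simp add: \<eta>_def)
  have \<kappa>comm: "norm ((\<Sum>g\<in>A. \<kappa> l j g) * a - a * (\<Sum>g\<in>A. \<kappa> l j g)) \<le> \<epsilon>"
    if A: "A \<subseteq> carrier G" "finite A" and a: "a \<in> F" and j: "j \<le> s" for A l j a
  proof (cases "l \<le> q")
    case True
    have "(\<Sum>g\<in>A. \<kappa> l j g) * a - a * (\<Sum>g\<in>A. \<kappa> l j g) = (\<Sum>g\<in>A. \<kappa> l j g * a - a * \<kappa> l j g)"
      by (simp add: sum_distrib_left sum_distrib_right sum_subtractf)
    also have "norm \<dots> \<le> (\<Sum>g\<in>A. \<nu> j g * \<eta>)"
    proof (rule order_trans[OF norm_sum], rule sum_mono)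
      fix g assume "g \<in> A"
      then have g: "g \<in> carrier G" using A by blast
      have "\<kappa> l j g * a - a * \<kappa> l j g = \<nu> j g *\<^sub>R (E l (g <# H) * a - a * E l (g <# H))"
        using g True by (simp add: \<kappa>_def scaleR_right_diff_distrib)
      then show "norm (\<kappa> l j g * a - a * \<kappa> l j g) \<le> \<nu> j g * \<eta>"
        using i2[OF a True gL[OF g]] \<nu>(1)[of j g] by (simp add: E_def mult_left_mono)
    qed
    also have "\<dots> \<le> N * \<eta>" using A j \<eta> by (intro sumT) auto
    finally show ?thesis using N\<eta> \<epsilon> by simp
  qed (use \<epsilon> in \<open>simp add: \<kappa>_def\<close>)
  have \<kappa>equiv: "norm ((\<Sum>h\<in>A. \<alpha> g (\<kappa> l j h) - \<kappa> l j (g \<otimes> h)) * a) \<le> \<epsilon>"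
    if A: "A \<subseteq> carrier G" "finite A" and a: "a \<in> F" and g: "g \<in> M" and j: "j \<le> s" for A l j a g
  proof (cases "l \<le> q")
    case True
    have gc: "g \<in> carrier G" using g M by blast
    note bl = star_automorphism_bounded_linear(1)[OF \<alpha>[OF gc]]
    have act: "(g \<otimes> h) <# H = g <# (h <# H)" if "h \<in> carrier G" for h
      using lcos_m_assoc[OF subgroup.subset[OF sub] gc that] by simp
    \<comment> \<open>\<open>?u\<close> is the equivariance error of the tower weighted by
      \<open>\<nu> j\<close>, \<open>?v\<close> the variation of \<open>\<nu> j\<close> carried by
      the tower.\<close>
    let ?u = "\<lambda>h. \<nu> j h *\<^sub>R (\<alpha> g (E l (h <# H)) - E l (g <# (h <# H)))"
    let ?v = "\<lambda>h. (\<nu> j h - \<nu> j (g \<otimes> h)) *\<^sub>R E l ((g \<otimes> h) <# H)"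
    have split: "\<alpha> g (\<kappa> l j h) - \<kappa> l j (g \<otimes> h) = ?u h + ?v h" if "h \<in> A" for h
    proof -
      have h: "h \<in> carrier G" using that A by blast
      have "\<alpha> g (\<nu> j h *\<^sub>R x) = \<nu> j h *\<^sub>R \<alpha> g x" for x
        using linear_scale[OF bounded_linear.linear[OF bl]] .
      then show ?thesis using True h gc by (simp add: \<kappa>_def act algebra_simps)
    qed
    have "norm ((\<Sum>h\<in>A. ?u h) * a) \<le> (\<Sum>h\<in>A. \<nu> j h * \<eta>)"
      unfolding sum_distrib_right
    proof (rule order_trans[OF norm_sum], rule sum_mono)
      fix h assume "h \<in> A"
      then have h: "h \<in> carrier G" using A by blast
      show "norm (?u h * a) \<le> \<nu> j h * \<eta>"
        using i3[OF a True gL[OF h] g] \<nu>(1)[of j h] by (simp add: E_def mult_left_mono)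
    qed
    also have "\<dots> \<le> N * \<eta>" using A j \<eta> by (intro sumT) auto
    finally have u: "norm ((\<Sum>h\<in>A. ?u h) * a) \<le> \<epsilon> / 4" using N\<eta> by simp
    \<comment> \<open>Grouping by the coset of \<open>g \<otimes> h\<close> makes the sum of the
      \<open>?v h\<close> an orthogonal combination of the \<open>E l X\<close>, so only the largest
      coefficient counts, however large \<open>A\<close> is.\<close>
    define k where "k X = (\<Sum>h\<in>{h \<in> A. (g \<otimes> h) <# H = X}. \<nu> j h - \<nu> j (g \<otimes> h))" for X
    have kX: "\<bar>k X\<bar> \<le> 2 * (\<epsilon> / (4 * K))" for X
    proof -
      let ?A = "{h \<in> A. (g \<otimes> h) <# H = X}"
      \<comment> \<open>Within one coset, injectivity of \<open>\<nu> j\<close> modulo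
        \<open>H\<close> leaves at most one nonzero value \<open>\<nu> j h\<close> and at most one
        nonzero value \<open>\<nu> j (g \<otimes> h)\<close>.\<close>
      let ?B = "{h \<in> ?A. \<nu> j h \<noteq> 0}" and ?C = "{h \<in> ?A. \<nu> j (g \<otimes> h) \<noteq> 0}"
      have one: "card B \<le> 1" if "\<And>x y. x \<in> B \<Longrightarrow> y \<in> B \<Longrightarrow> x = y" for B :: "'g set"
        using that by (metis card_le_Suc0_iff_eq card.infinite One_nat_def le0)
      have hc: "h \<in> carrier G" "g \<otimes> h \<in> carrier G" if "h \<in> A" for h using that A gc by auto
      have "card ?B \<le> 1"
      proof (rule one)
        fix x y assume xy: "x \<in> ?B" "y \<in> ?B"
        have "h <# H = inv g <# X" if "h \<in> ?B" for h
          using lcoset_action(2)[OF is_group sub gc, of "h <# H"] gL[of h] act[of h] hc[of h] that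
          by (simp add: L_def)
        then have "x <# H = y <# H" using xy by simp
        then show "x = y" using xy hc \<nu>(4)[of x y j] by (simp add: H_def)
      qed
      moreover have "card ?C \<le> 1"
      proof (rule one)
        fix x y assume xy: "x \<in> ?C" "y \<in> ?C"
        then have "g \<otimes> x = g \<otimes> y" using hc \<nu>(4)[of "g \<otimes> x" "g \<otimes> y" j] by (auto simp: H_def)
        then show "x = y" using xy hc gc by auto
      qed
      ultimately have card2: "card (?B \<union> ?C) \<le> 2" using card_Un_le[of ?B ?C] by linarith
      have k_eq: "k X = (\<Sum>h\<in>?B \<union> ?C. \<nu> j h - \<nu> j (g \<otimes> h))"
        unfolding k_def using A by (intro sum.mono_neutral_right) auto
      have "\<bar>k X\<bar> \<le> (\<Sum>h\<in>?B \<union> ?C. \<epsilon> / (4 * K))"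
        unfolding k_eq using \<nu>(6)[OF g] hc by (intro order_trans[OF sum_abs] sum_mono) auto
      also have "\<dots> = real (card (?B \<union> ?C)) * (\<epsilon> / (4 * K))" by simp
      also have "\<dots> \<le> 2 * (\<epsilon> / (4 * K))" using card2 \<epsilon> K by (intro mult_right_mono) auto
      finally show ?thesis .
    qed
    have "(\<Sum>h\<in>A. ?v h) = (\<Sum>X\<in>L. \<Sum>h\<in>{h \<in> A. (g \<otimes> h) <# H = X}. ?v h)"
      using A L gL gc by (intro sum.group[symmetric]) auto
    also have "\<dots> = (\<Sum>X\<in>L. k X *\<^sub>R E l X)"
      by (intro sum.cong refl) (simp add: k_def scaleR_left.sum)
    also have "\<dots> = (\<Sum>X\<in>L. complex_of_real (k X) *\<^sub>C E l X)" by (simp add: scaleR_scaleC)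
    finally have veq: "(\<Sum>h\<in>A. ?v h) = (\<Sum>X\<in>L. complex_of_real (k X) *\<^sub>C E l X)" .
    have "norm (\<Sum>h\<in>A. ?v h) \<le> 2 * (\<epsilon> / (4 * K))"
      unfolding veq
      using Ep[OF True] Eo[OF True] kX \<epsilon> K by (intro norm_scaled_sum_orthogonal_le[OF L]) auto
    then have "norm ((\<Sum>h\<in>A. ?v h) * a) \<le> 2 * (\<epsilon> / (4 * K)) * K"
      using FK[OF a] \<epsilon> K by (intro order_trans[OF norm_mult_ineq] mult_mono) auto
    then have v: "norm ((\<Sum>h\<in>A. ?v h) * a) \<le> \<epsilon> / 2" using K by simp
    have "(\<Sum>h\<in>A. \<alpha> g (\<kappa> l j h) - \<kappa> l j (g \<otimes> h)) * a = (\<Sum>h\<in>A. ?u h) * a + (\<Sum>h\<in>A. ?v h) * a"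
      using split by (simp add: sum.distrib distrib_right)
    also have "norm \<dots> \<le> \<epsilon>"
      by (rule order_trans[OF norm_triangle_ineq]) (use u v \<epsilon> in linarith)
    finally show ?thesis .
  next
    case False
    have "\<alpha> g 0 = 0"
      using star_automorphism_bounded_linear(1)[OF \<alpha>] g M(2) by (blast intro: linear_0 bounded_linear.linear)
    then show ?thesis using False \<epsilon> by (simp add: \<kappa>_def)
  qed
  define \<mu> where "\<mu> m = \<kappa> (m div Suc s) (m mod Suc s)" for m
  have "(\<Sum>m\<le>p * Suc s + s. \<Sum>g\<in>{g \<in> carrier G. \<mu> m g \<noteq> 0}. \<mu> m g) =
      (\<Sum>l\<le>p. \<Sum>j\<le>s. \<Sum>g\<in>{g \<in> carrier G. \<kappa> l j g \<noteq> 0}. \<kappa> l j g)"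
    unfolding \<mu>_def by (rule sum_colours)
  also have "\<dots> = (\<Sum>l\<le>p. if l \<le> q then \<Sum>X\<in>L. E l X else 0)" by (simp only: \<kappa>sum)
  also have "\<dots> = (\<Sum>l\<le>q. \<Sum>X\<in>L. E l X)"
    using q(1) by (intro sum.mono_neutral_cong_right) auto
  finally have tot: "(\<Sum>m\<le>p * Suc s + s. \<Sum>g\<in>{g \<in> carrier G. \<mu> m g \<noteq> 0}. \<mu> m g) = (\<Sum>l\<le>q. \<Sum>X\<in>L. E l X)" .
  show "\<exists>\<mu> :: nat \<Rightarrow> 'g \<Rightarrow> 'a.
      (\<forall>l\<le>p * Suc s + s. finite {g \<in> carrier G. \<mu> l g \<noteq> 0} \<and> (\<forall>g\<in>carrier G. positive_contraction (\<mu> l g))) \<and>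
      (\<forall>a\<in>F. norm ((\<Sum>l\<le>p * Suc s + s. \<Sum>g\<in>{g \<in> carrier G. \<mu> l g \<noteq> 0}. \<mu> l g) * a - a) \<le> \<epsilon>) \<and>
      (\<forall>l\<le>p * Suc s + s. \<forall>g\<in>carrier G. \<forall>h\<in>carrier G. g \<noteq> h \<longrightarrow> \<mu> l g * \<mu> l h = 0) \<and>
      (\<forall>a\<in>F. \<forall>l\<le>p * Suc s + s. \<forall>g\<in>M. \<forall>E. E \<subseteq> carrier G \<and> finite E \<longrightarrow>
         norm ((\<Sum>h\<in>E. \<alpha> g (\<mu> l h) - \<mu> l (g \<otimes> h)) * a) \<le> \<epsilon>) \<and>
      (\<forall>a\<in>F. \<forall>l\<le>p * Suc s + s. \<forall>E. E \<subseteq> carrier G \<and> finite E \<longrightarrow>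
         norm ((\<Sum>g\<in>E. \<mu> l g) * a - a * (\<Sum>g\<in>E. \<mu> l g)) \<le> \<epsilon>)"
  proof (rule exI[of _ \<mu>], intro conjI)
    show "\<forall>a\<in>F. norm ((\<Sum>l\<le>p * Suc s + s. \<Sum>g\<in>{g \<in> carrier G. \<mu> l g \<noteq> 0}. \<mu> l g) * a - a) \<le> \<epsilon>"
      unfolding tot using i1 by (simp add: E_def)
  qed (use \<kappa>fin \<kappa>pc \<kappa>o \<kappa>equiv \<kappa>comm colour in \<open>simp_all add: \<mu>_def\<close>)
qed


section \<open>Finiteness of the two dimensions\<close>

lemma Inf_enat_less_infinity_iff: "Inf {enat d |d. P d} < \<infinity> \<longleftrightarrow> (\<exists>d. P d)"
proof
  assume fin: "Inf {enat d |d. P d} < \<infinity>"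
  show "\<exists>d. P d"
  proof (rule ccontr)
    assume "\<nexists>d. P d"
    then have "{enat d |d. P d} = {}" by blast
    then have "Inf {enat d |d. P d} = \<infinity>" by (simp only: Inf_empty top_enat_def)
    with fin show False by simp
  qed
next
  assume "\<exists>d. P d"
  then obtain d where "P d" ..
  then have "Inf {enat d |d. P d} \<le> enat d" by (intro Inf_lower) blast
  then show "Inf {enat d |d. P d} < \<infinity>" by (rule le_less_trans) simp
qed

text \<open>A nonempty set in a well-order attains its infimum.\<close>

lemma Inf_enat_le_iff: "Inf {enat d |d. P d} \<le> enat p \<longleftrightarrow> (\<exists>d\<le>p. P d)"
proof
  assume le: "Inf {enat d |d. P d} \<le> enat p"
  then have "Inf {enat d |d. P d} < \<infinity>" by (rule le_less_trans) simp
  then have "\<exists>d. P d" by (rule iffD1[OF Inf_enat_less_infinity_iff])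
  then obtain d where "P d" ..
  then have "enat d \<in> {enat d |d. P d}" by blast
  then have "Inf {enat d |d. P d} \<in> {enat d |d. P d}" by (rule wellorder_InfI)
  with le show "\<exists>d\<le>p. P d" by auto
next
  assume "\<exists>d\<le>p. P d"
  then show "Inf {enat d |d. P d} \<le> enat p" by (auto intro!: Inf_lower2)
qed

lemma dim_Rok_finite_iff:
  "dim_Rok G \<alpha> w < \<infinity> \<longleftrightarrow>
     (\<exists>p. \<forall>H. finite_index_subgroup G H \<longrightarrow> (\<exists>q\<le>p. rokhlin_dim_le G \<alpha> w H q))"
proof -
  have "dim_Rok G \<alpha> w < \<infinity> \<longleftrightarrow> (\<exists>p. dim_Rok G \<alpha> w \<le> enat p)"
    by (cases "dim_Rok G \<alpha> w") auto
  also have "\<dots> \<longleftrightarrow> (\<exists>p. \<forall>H. finite_index_subgroup G H \<longrightarrow> dim_Rok_at G \<alpha> w H \<le> enat p)"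
    unfolding dim_Rok_def Sup_le_iff by blast
  finally show ?thesis unfolding dim_Rok_at_def Inf_enat_le_iff .
qed

theorem theoremD:
  fixes G :: "('g, 'm) monoid_scheme"
    and \<alpha> :: "'g \<Rightarrow> 'a::cstar_algebra \<Rightarrow> 'a"
    and w :: "'g \<Rightarrow> 'g \<Rightarrow> 'a multiplier"
  assumes "group G" and "countable (carrier G)" and "residually_finite G"
    and "\<exists>\<sigma> d dB. regular_approximation G \<sigma> \<and> proper_right_invariant_metric G d \<and>
           box_space_metric G d \<sigma> dB \<and> asdim (box_space G \<sigma>) dB < \<infinity>"
    and "cocycle_action G \<alpha> w"
  shows "dim_Rok G \<alpha> w < \<infinity> \<longleftrightarrow> dim_am G \<alpha> < \<infinity>"
proof
  obtain \<sigma> d dB where \<sigma>: "regular_approximation G \<sigma>" and d: "proper_right_invariant_metric G d"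
    and dB: "box_space_metric G d \<sigma> dB" and "asdim (box_space G \<sigma>) dB < \<infinity>"
    using assms(4) by blast
  then obtain s where s: "asdim_le (box_space G \<sigma>) dB s"
    unfolding asdim_def Inf_enat_less_infinity_iff by blast
  have pmg: "proper_metric_group G d"
    using assms(1) d
    by (auto simp: proper_metric_group_def proper_metric_group_axioms_def proper_right_invariant_metric_def)
  assume "dim_Rok G \<alpha> w < \<infinity>"
  then obtain p where "\<And>H. finite_index_subgroup G H \<Longrightarrow> \<exists>q\<le>p. rokhlin_dim_le G \<alpha> w H q"
    unfolding dim_Rok_finite_iff by blast
  from proper_metric_group.rokhlin_dim_imp_am_dim_le[OF pmg \<sigma> dB s assms(2,5) this]
  have "am_dim_le G \<alpha> (p * Suc s + s)" .
  then show "dim_am G \<alpha> < \<infinity>" unfolding dim_am_def Inf_enat_less_infinity_iff by blast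
next
  assume "dim_am G \<alpha> < \<infinity>"
  then obtain p where p: "am_dim_le G \<alpha> p" unfolding dim_am_def Inf_enat_less_infinity_iff by blast
  \<comment> \<open>One \<open>p\<close> for all \<open>H\<close>, which is what bounds the
    supremum.\<close>
  have "rokhlin_dim_le G \<alpha> w H p" if H: "finite_index_subgroup G H" for H
  proof (rule towers_imp_rokhlin_dim_le[OF assms(1) H assms(5)])
    fix D assume "admissible_subalgebra G \<alpha> w D"
    then have "separable_space (top_of_set D)" "D \<noteq> {}"
      by (auto simp: admissible_subalgebra_def cstar_subalgebra_def)
    then show "\<exists>e. rokhlin_towers G \<alpha> D H p e"
      using assms(5) by (intro am_dim_le_imp_towers[OF assms(1,2) H _ p]) (auto simp: cocycle_action_def)
  qed
  then show "dim_Rok G \<alpha> w < \<infinity>" unfolding dim_Rok_finite_iff by blast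
qed

end
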